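(* Let $p$ and $q$ be irreducible monic polynomials with degree $2$ over $\mathbb{F}$. Assume that $q=H_d(p)$ for some $d\in\mathbb{F}\setminus\{0\}$, and that $\operatorname{tr}p\neq 0$. Set $$r:=t^2-\frac{(\operatorname{tr}p)(\operatorname{tr}q)-2d\,q(0)}{q(0)}\,t+\frac{p(0)}{q(0)}.$$ Let $u$ be an endomorphism of a finite-dimensional vector space $V$ over $\mathbb{F}$. Then, the following conditions are equivalent: (i) $u$ is a q-exceptional $(p,q)$-quotient. (ii) The minimal polynomial of $u$ is the product of a power of $t-d$ with a power of $r$. Moreover, the invariant factors of $u$ read $s_1,s_2,\dots,s_{2k-1},s_{2k},\dots$ where, for every positive integer $k$, we have $s_{2k-1}=s_{2k}$ or $s_{2k-1}=r\,s_{2k}$. (iii) In some basis of $V$, the endomorphism $u$ is represented by a block-diagonal matrix in which every diagonal block equals either $C(r^{n+\epsilon})\oplus C(r^n)$ for some integer $n\geq 0$ and some $\epsilon\in\{0,1\}$, or $C\bigl((t-d)^n\bigr)\oplus C\bigl((t-d)^n\bigr)$ for some positive integer $n$.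
   Context: $\mathbb{F}$ is an arbitrary field with algebraic closure $\overline{\mathbb{F}}$. For a monic polynomial $p$ of degree $n\ge 1$, $\operatorname{tr}(p)$ is the opposite of the coefficient of $p$ on $t^{n-1}$, and $\operatorname{Root}(p)$ is its set of roots in $\overline{\mathbb{F}}$. For $p$ monic of degree $2$ and $d\in\mathbb{F}\setminus\{0\}$, $H_d(p):=d^{-2}p(dt)$. An endomorphism $u$ of $V$ is a $(p,q)$-quotient if $u=ab^{-1}$ for some automorphisms $a,b$ of $V$ with $p(a)=0$ and $q(b)=0$. It is q-exceptional with respect to $(p,q)$ if all its eigenvalues in $\overline{\mathbb{F}}$ belong to $\operatorname{Root}(p)\operatorname{Root}(q)^{-1}=\{xy^{-1}: x\in\operatorname{Root}(p),\,y\in\operatorname{Root}(q)\}$; a q-exceptional $(p,q)$-quotient is a $(p,q)$-quotient that is q-exceptional with respect to $(p,q)$. $C(r)$ is the companion matrix of the monic polynomial $r$ ($C(1)$ is the $0\times0$ matrix), and $\oplus$ is block-diagonal sum. The invariant factors of $u$ are the monic polynomials $s_1,s_2,\dots$ with $s_{i+1}\mid s_i$ such that $u$ is represented in some basis by $C(s_1)\oplus C(s_2)\oplus\cdots$; the finite list of nonconstant ones is extended to an infinite sequence by $s_i=1$. *)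

theory Defs
  imports
    "HOL-Algebra.Algebraic_Closure_Type"
    "Jordan_Normal_Form.Char_Poly"
begin

text \<open>A vector space is given by a scalar multiplication \<open>scale\<close> on a whole type of vectors,
  as in the locale \<^locale>\<open>vector_space\<close>.\<close>

subsection \<open>Polynomials\<close>

definition tr :: "'a::field poly \<Rightarrow> 'a" where
  "tr p = - Polynomial.coeff p (Polynomial.degree p - 1)"

definition H :: "'a::field \<Rightarrow> 'a poly \<Rightarrow> 'a poly" where
  "H d p = Polynomial.smult (inverse (d ^ 2)) (pcompose p [:0, d:])"

definition Root :: "'a::field poly \<Rightarrow> 'a alg_closure set" where
  "Root p = {x. poly (map_poly to_ac p) x = 0}"

text \<open>Ones on the subdiagonal and the negated coefficients in the last column;
  \<open>companion 1\<close> is the empty matrix.\<close>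

definition companion :: "'a::field poly \<Rightarrow> 'a mat" where
  "companion p = (let n = Polynomial.degree p in
     mat n n (\<lambda>(i, j). if j = n - 1 then - Polynomial.coeff p i
                       else if i = j + 1 then 1 else 0))"

subsection \<open>Endomorphisms\<close>

definition poly_endo ::
    "('a::field \<Rightarrow> 'v \<Rightarrow> 'v) \<Rightarrow> 'a poly \<Rightarrow> ('v \<Rightarrow> 'v) \<Rightarrow> 'v \<Rightarrow> 'v::ab_group_add" where
  "poly_endo scale p u = (\<lambda>v. \<Sum>i\<le>Polynomial.degree p. scale (Polynomial.coeff p i) ((u ^^ i) v))"

definition automorphism :: "('a::field \<Rightarrow> 'v \<Rightarrow> 'v) \<Rightarrow> ('v \<Rightarrow> 'v::ab_group_add) \<Rightarrow> bool" where
  "automorphism scale a \<longleftrightarrow> Vector_Spaces.linear scale scale a \<and> bij a"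

definition pq_quotient ::
    "('a::field \<Rightarrow> 'v \<Rightarrow> 'v) \<Rightarrow> 'a poly \<Rightarrow> 'a poly \<Rightarrow> ('v \<Rightarrow> 'v::ab_group_add) \<Rightarrow> bool" where
  "pq_quotient scale p q u \<longleftrightarrow>
     (\<exists>a b. automorphism scale a \<and> automorphism scale b \<and>
        poly_endo scale p a = (\<lambda>_. 0) \<and> poly_endo scale q b = (\<lambda>_. 0) \<and>
        u = a \<circ> inv_into UNIV b)"

definition ordered_basis :: "('a::field \<Rightarrow> 'v \<Rightarrow> 'v) \<Rightarrow> 'v::ab_group_add list \<Rightarrow> bool" where
  "ordered_basis scale B \<longleftrightarrow>
     distinct B \<and> \<not> Modules.module.dependent scale (set B) \<and>
     Modules.module.span scale (set B) = UNIV"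

text \<open>Column \<open>j\<close> of the matrix holds the coordinates of the image of the \<open>j\<close>-th basis vector.\<close>

definition represented_by ::
    "('a::field \<Rightarrow> 'v \<Rightarrow> 'v) \<Rightarrow> ('v \<Rightarrow> 'v::ab_group_add) \<Rightarrow> 'v list \<Rightarrow> 'a mat \<Rightarrow> bool" where
  "represented_by scale u B A \<longleftrightarrow>
     ordered_basis scale B \<and> A \<in> carrier_mat (length B) (length B) \<and>
     (\<forall>j<length B. u (B ! j) = (\<Sum>i<length B. scale (A $$ (i, j)) (B ! i)))"

text \<open>The eigenvalues of \<open>u\<close> in the algebraic closure are those of any matrix representing \<open>u\<close>,
  with its entries seen in the algebraic closure.\<close>

definition closure_eigenvalues ::
    "('a::field \<Rightarrow> 'v \<Rightarrow> 'v) \<Rightarrow> ('v \<Rightarrow> 'v::ab_group_add) \<Rightarrow> 'a alg_closure set" where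
  "closure_eigenvalues scale u =
     {x. \<exists>B A. represented_by scale u B A \<and> eigenvalue (map_mat to_ac A) x}"

definition q_exceptional ::
    "('a::field \<Rightarrow> 'v \<Rightarrow> 'v) \<Rightarrow> 'a poly \<Rightarrow> 'a poly \<Rightarrow> ('v \<Rightarrow> 'v::ab_group_add) \<Rightarrow> bool" where
  "q_exceptional scale p q u \<longleftrightarrow>
     closure_eigenvalues scale u \<subseteq> {x * inverse y | x y. x \<in> Root p \<and> y \<in> Root q}"

definition is_minimal_polynomial ::
    "('a::field \<Rightarrow> 'v \<Rightarrow> 'v) \<Rightarrow> ('v \<Rightarrow> 'v::ab_group_add) \<Rightarrow> 'a poly \<Rightarrow> bool" where
  "is_minimal_polynomial scale u m \<longleftrightarrow>
     monic m \<and> poly_endo scale m u = (\<lambda>_. 0) \<and>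
     (\<forall>f. poly_endo scale f u = (\<lambda>_. 0) \<longrightarrow> m dvd f)"

text \<open>The sequence of invariant factors is indexed from 1; the value at 0 is irrelevant.\<close>

definition are_invariant_factors ::
    "('a::field \<Rightarrow> 'v \<Rightarrow> 'v) \<Rightarrow> ('v \<Rightarrow> 'v::ab_group_add) \<Rightarrow> (nat \<Rightarrow> 'a poly) \<Rightarrow> bool" where
  "are_invariant_factors scale u s \<longleftrightarrow>
     (\<forall>i\<ge>1. monic (s i) \<and> s (i + 1) dvd s i) \<and>
     (\<exists>N. (\<forall>i>N. s i = 1) \<and>
        (\<exists>B. represented_by scale u B
               (diag_block_mat (map (\<lambda>i. companion (s i)) [1..<N + 1]))))"

end

theory Submission
  imports Defs "HOL-Library.Function_Algebras" "HOL-Library.Product_Plus"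
begin

text \<open>Put \<open>\<tau> = tr p\<close> and \<open>N = p(0)\<close>. If \<open>u = a b\<^sup>-\<^sup>1\<close> with \<open>p(a) = 0\<close> and \<open>q(b) = 0\<close>, then
  \<open>u a u = d\<^sup>2 a - \<tau> u (d - u)\<close>, and conversely this relation together with \<open>p(a) = 0\<close> makes \<open>u\<close> a
  \<open>(p, q)\<close>-quotient, with \<open>b = u\<^sup>-\<^sup>1 a\<close>. The relation implies that every \<open>ker (u - d)\<^sup>k\<close> is stable
  under \<open>a\<close>, hence has even dimension as \<open>p\<close> is irreducible of degree 2. The operator
  \<open>c = (d + u) a - \<tau> u\<close> satisfies \<open>u c u = d\<^sup>2 c\<close> and \<open>u c\<^sup>2 = - d N r(u)\<close>, so that
  \<open>ker c\<^sup>2\<^sup>k = ker r(u)\<^sup>k\<close>; since every \<open>ker c\<^sup>k\<close> is \<open>u\<close>-stable and \<open>r\<close> is irreducible of degree 2,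
  the dimensions of the \<open>ker c\<^sup>k\<close> form an even concave sequence. These two facts force the pairing
  of the invariant factors. Conversely, on a module with paired cyclic summands, \<open>a\<close> is defined on
  the generators and extended to the whole space along the relation.\<close>

subsection \<open>Polynomials over a field\<close>

text \<open>Substituting \<open>b = u\<^sup>-\<^sup>1 a\<close> into \<open>q(b) = 0\<close>,
  writing \<open>- N\<close> as \<open>(a - \<tau>) a\<close> and cancelling the invertible
  \<open>a\<close> on the right turns one of the two quadratic conditions into one that is affine in
  \<open>a\<close>; this is why \<open>a\<close> can be prescribed on generators and extended. Where
  \<open>u + d\<close> is invertible, \<open>\<tau> u (u + d)\<^sup>-\<^sup>1\<close> is a solution
  that commutes with \<open>u\<close>. The operator \<open>c\<close> is the difference of
  \<open>a\<close> and this solution, multiplied by \<open>u + d\<close>, which is why it satisfies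
  the homogeneous relation. The polynomial \<open>r\<close> appears because
  \<open>N r(z) = (z + d)\<^sup>2 p(\<tau> z / (z + d))\<close>. The obstacle is that the kernels of
  \<open>r(u)\<^sup>k\<close> have even dimension anyway, so parity alone says nothing about the
  exponents of \<open>r\<close>. The odd powers of \<open>c\<close> insert one even-dimensional
  kernel between consecutive kernels of powers of \<open>r(u)\<close>, and concavity then turns
  evenness into divisibility by 4 wherever two consecutive jumps agree. No step divides by 2, so
  characteristic 2 is included.\<close>

definition comaximal :: "'a::comm_ring_1 \<Rightarrow> 'a \<Rightarrow> bool" where
  "comaximal f g \<longleftrightarrow> (\<exists>x y. x * f + y * g = 1)"

lemma comaximal_commute: "comaximal f g \<Longrightarrow> comaximal g f"
  unfolding comaximal_def by (subst (asm) add.commute) blast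

lemma comaximalI: "x * f + y * g = 1 \<Longrightarrow> comaximal f g"
  unfolding comaximal_def by blast

lemma comaximal_1 [simp]: "comaximal 1 g" "comaximal g 1"
  by (rule comaximalI [of 1 _ 0], simp) (rule comaximalI [of 0 _ 1], simp)

lemma comaximal_mult:
  assumes "comaximal f g" "comaximal f h"
  shows "comaximal f (g * h)"
proof -
  obtain x y x' y' where e: "x * f + y * g = 1" "x' * f + y' * h = 1"
    using assms unfolding comaximal_def by metis
  have "(x * f * x' + x * y' * h + y * g * x') * f + (y * y') * (g * h)
      = (x * f + y * g) * (x' * f + y' * h)"
    by (simp add: algebra_simps)
  then show ?thesis by (intro comaximalI) (simp add: e)
qed

lemma comaximal_power_right: "comaximal f g \<Longrightarrow> comaximal f (g ^ n)"
  by (induction n) (simp_all add: comaximal_mult)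

lemma comaximal_powers: "comaximal f g \<Longrightarrow> comaximal (f ^ m) (g ^ n)"
  by (meson comaximal_commute comaximal_power_right)

lemma comaximal_dvd_mult:
  assumes "comaximal f g" "f dvd g * h"
  shows "f dvd h"
proof -
  obtain x y where e: "x * f + y * g = 1"
    using assms(1) unfolding comaximal_def by auto
  have "h = (x * f + y * g) * h" by (simp add: e)
  also have "\<dots> = f * (x * h) + y * (g * h)" by (simp add: algebra_simps)
  also have "f dvd \<dots>" using assms(2) by (intro dvd_add dvd_mult[of f "g * h" y] dvd_triv_left)
  finally show ?thesis .
qed

lemma comaximal_mult_dvd:
  assumes "comaximal f g" "f dvd h" "g dvd h"
  shows "f * g dvd h"
proof -
  obtain k where k: "h = g * k" using assms(3) by (elim dvdE)
  have "f dvd k" using assms(1,2) k comaximal_dvd_mult by blast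
  then show ?thesis using k by (metis mult.commute mult_dvd_mono dvd_refl)
qed

lemma poly_bezout:
  fixes f g :: "'a::field poly"
  obtains h x y where "h = x * f + y * g" "h dvd f" "h dvd g"
proof -
  have "\<exists>h x y. h = x * f + y * g \<and> h dvd f \<and> h dvd g"
  proof (induction "if g = 0 then 0 else Suc (degree g)" arbitrary: f g rule: less_induct)
    case less
    show ?case
    proof (cases "g = 0")
      case True
      have "f = 1 * f + 0 * g \<and> f dvd f \<and> f dvd g" using True by simp
      then show ?thesis by blast
    next
      case False
      \<comment> \<open>The measure puts the zero polynomial strictly below the nonzero constants,
        so the last Euclidean step decreases it too.\<close>
      have "(if f mod g = 0 then 0 else Suc (degree (f mod g))) < (if g = 0 then 0 else Suc (degree g))"
        using degree_mod_less[OF False, of f] False by auto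
      then obtain h x y where h: "h = x * g + y * (f mod g)" "h dvd g" "h dvd f mod g"
        using less[of "f mod g" g] by blast
      have "h dvd f" using h(2,3) by (metis dvd_mod_imp_dvd)
      moreover have "h = y * f + (x - y * (f div g)) * g"
        using h(1) by (simp add: minus_div_mult_eq_mod[symmetric] algebra_simps)
      ultimately show ?thesis using h(2) by blast
    qed
  qed
  then show thesis using that by blast
qed

lemma irreducible_poly_degree_pos:
  fixes f :: "'a::field poly"
  assumes "irreducible f"
  shows "degree f > 0"
  using assms is_unit_iff_degree[of f] by (auto simp: irreducible_def)

lemma irreducible_comaximal:
  fixes f g :: "'a::field poly"
  assumes "irreducible f" "\<not> f dvd g"
  shows "comaximal f g"
proof -
  obtain h x y where h: "h = x * f + y * g" "h dvd f" "h dvd g"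
    using poly_bezout .
  obtain k where k: "f = h * k" using h(2) by (elim dvdE)
  have "\<not> is_unit k"
  proof
    assume "is_unit k"
    then have "f dvd h" unfolding k by (simp only: mult_unit_dvd_iff dvd_refl)
    then show False using assms(2) h(3) dvd_trans by blast
  qed
  then have "is_unit h" using assms(1) k irreducibleD by blast
  then obtain h' where "h' * h = 1" by (metis dvdE mult.commute)
  then have "(h' * x) * f + (h' * y) * g = 1" using h(1) by (simp add: algebra_simps)
  then show ?thesis by (rule comaximalI)
qed

lemma exists_irreducible_factor:
  fixes f :: "'a::field poly"
  assumes "degree f > 0"
  obtains g where "irreducible g" "g dvd f"
proof -
  have "\<exists>g. irreducible g \<and> g dvd f" using assms
  proof (induction "degree f" arbitrary: f rule: less_induct)
    case less
    show ?case
    proof (cases "irreducible f")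
      case True
      then show ?thesis using dvd_refl by blast
    next
      case False
      have f0: "f \<noteq> 0" using less(2) by auto
      have nu: "\<not> is_unit f" using less(2) is_unit_iff_degree[OF f0] by simp
      obtain g h where gh: "f = g * h" "\<not> is_unit g" "\<not> is_unit h"
        using False f0 nu unfolding irreducible_def by auto
      have ne: "g \<noteq> 0" "h \<noteq> 0" using gh f0 by auto
      then have "degree g > 0" "degree h > 0"
        using gh is_unit_iff_degree[of g] is_unit_iff_degree[of h] by auto
      then have "degree g < degree f" using gh(1) ne by (simp add: degree_mult_eq)
      then show ?thesis using less(1)[of g] \<open>degree g > 0\<close> gh(1) by (meson dvd_mult2)
    qed
  qed
  then show thesis using that by blast
qed

lemma poly_multiplicity_decompose:
  fixes f g :: "'a::field poly"
  assumes "f \<noteq> 0" "degree g > 0"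
  obtains n h where "f = g ^ n * h" "\<not> g dvd h"
proof -
  have "\<exists>n h. f = g ^ n * h \<and> \<not> g dvd h" using assms(1)
  proof (induction "degree f" arbitrary: f rule: less_induct)
    case less
    show ?case
    proof (cases "g dvd f")
      case False
      then have "f = g ^ 0 * f \<and> \<not> g dvd f" by simp
      then show ?thesis by blast
    next
      case True
      then obtain k where k: "f = g * k" by (elim dvdE)
      have "k \<noteq> 0" "g \<noteq> 0" using k less(2) by auto
      then have "degree k < degree f" using k assms(2) by (simp add: degree_mult_eq)
      then obtain n h where "k = g ^ n * h" "\<not> g dvd h" using less(1) \<open>k \<noteq> 0\<close> by blast
      then have "f = g ^ Suc n * h \<and> \<not> g dvd h" using k by simp
      then show ?thesis by blast
    qed
  qed
  then show thesis using that by blast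
qed

text \<open>Take a prime \<open>h\<close> of \<open>g\<close>. If its multiplicity in
  \<open>f\<close> is at least that in \<open>g\<close>, it can be stripped from \<open>g\<close>,
  and by comaximality what remains still fails to divide \<open>f\<close>. The degree drops, so a
  prime with larger multiplicity in \<open>g\<close> must appear.\<close>

lemma not_dvd_imp_prime_power:
  fixes f g :: "'a::field poly"
  assumes "f \<noteq> 0" "g \<noteq> 0" "\<not> g dvd f"
  obtains h m n f' g' where "irreducible h" "f = h ^ m * f'" "g = h ^ n * g'"
    "m < n" "\<not> h dvd f'"
proof -
  have "\<exists>h m n f' g'. irreducible h \<and> f = h ^ m * f' \<and> g = h ^ n * g' \<and> m < n \<and> \<not> h dvd f'"
    using assms(2,3)
  proof (induction "degree g" arbitrary: g rule: less_induct)
    case less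
    have "\<not> is_unit g" using less(3) unit_imp_dvd by blast
    then have "degree g > 0" using less(2) is_unit_iff_degree[of g] by simp
    then obtain h where h: "irreducible h" "h dvd g" using exists_irreducible_factor by blast
    note dh = irreducible_poly_degree_pos[OF h(1)]
    obtain m f' where f: "f = h ^ m * f'" "\<not> h dvd f'"
      using poly_multiplicity_decompose assms(1) dh by metis
    obtain n g' where g: "g = h ^ n * g'" "\<not> h dvd g'"
      using poly_multiplicity_decompose less(2) dh by metis
    show ?case
    proof (cases "m < n")
      case True
      then show ?thesis using f g h by blast
    next
      case False
      have nz: "g' \<noteq> 0" "h ^ n \<noteq> 0" using g(1) less(2) by auto
      have "n > 0" using g h(2) by (cases n) auto
      then have "degree g' < degree g"
        using g(1) nz dh by (simp add: degree_mult_eq degree_power_eq)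
      moreover have "\<not> g' dvd f"
      proof
        assume "g' dvd f"
        moreover have "h ^ n dvd f" using f(1) False by (simp add: le_imp_power_dvd)
        moreover have "comaximal (h ^ n) g'"
          using irreducible_comaximal[OF h(1) g(2)] by (metis comaximal_commute comaximal_power_right)
        ultimately show False using comaximal_mult_dvd g(1) less(3) by metis
      qed
      ultimately obtain k m' n' f'' g'' where k: "irreducible k" "f = k ^ m' * f''"
        "g' = k ^ n' * g''" "m' < n'" "\<not> k dvd f''"
        using less(1)[OF _ nz(1)] by blast
      have "g = k ^ n' * (h ^ n * g'')" using g(1) k(3) by (simp add: mult_ac)
      then show ?thesis using k by blast
    qed
  qed
  then show thesis using that by blast
qed

lemma monic_degree_0:
  fixes f :: "'a::field poly"
  shows "monic f \<Longrightarrow> degree f = 0 \<Longrightarrow> f = 1"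
  by (auto elim!: degree_eq_zeroE)

lemma monic_multD:
  fixes f g :: "'a::field poly"
  shows "monic f \<Longrightarrow> monic (f * g) \<Longrightarrow> monic g"
  by (simp add: lead_coeff_mult)

lemma monic_dvd_comaximal:
  fixes f g :: "'a::field poly"
  assumes "monic f" "f dvd g" "comaximal f g"
  shows "f = 1"
proof -
  have "f dvd g * 1" using assms by simp
  then have "f dvd 1" using assms(3) by (rule comaximal_dvd_mult [rotated])
  then show ?thesis using assms(1) by (metis is_unit_iff_degree dvd_0_left_iff zero_neq_one monic_degree_0)
qed

lemma powers_dvd_powers:
  fixes f g :: "'a::field poly"
  assumes "comaximal f g" "degree f > 0" "degree g > 0" "f ^ m * g ^ n dvd f ^ k * g ^ l"
  shows "m \<le> k \<and> n \<le> l"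
proof -
  have "f ^ m dvd g ^ l * f ^ k" "g ^ n dvd f ^ k * g ^ l"
    using assms(4) by (auto simp: mult.commute dest: dvd_mult_left dvd_mult_right)
  then have "f ^ m dvd f ^ k" "g ^ n dvd g ^ l"
    using comaximal_dvd_mult comaximal_powers assms(1) comaximal_commute by metis+
  moreover have "f \<noteq> 0" "g \<noteq> 0" using assms(2,3) by auto
  ultimately have "degree (f ^ m) \<le> degree (f ^ k)" "degree (g ^ n) \<le> degree (g ^ l)"
    by (auto intro!: dvd_imp_degree_le)
  then show ?thesis
    using \<open>f \<noteq> 0\<close> \<open>g \<noteq> 0\<close> assms(2,3) by (simp add: degree_power_eq)
qed

text \<open>Stripping \<open>f\<close> and \<open>g\<close> from \<open>h\<close> leaves a monic
  divisor of \<open>f ^ k * g ^ l\<close> that is comaximal with this product, hence 1.\<close>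

lemma monic_dvd_powers:
  fixes f g h :: "'a::field poly"
  assumes irr: "irreducible f" "irreducible g" and mon: "monic f" "monic g" "monic h"
    and fg: "comaximal f g" and dvd: "h dvd f ^ k * g ^ l"
  obtains m n where "h = f ^ m * g ^ n" "m \<le> k" "n \<le> l"
proof -
  note deg = irr[THEN irreducible_poly_degree_pos]
  have "h \<noteq> 0" using mon by auto
  then obtain m h1 where h1: "h = f ^ m * h1" "\<not> f dvd h1"
    using poly_multiplicity_decompose deg by metis
  have "h1 \<noteq> 0" using h1 by auto
  then obtain n h2 where h2: "h1 = g ^ n * h2" "\<not> g dvd h2"
    using poly_multiplicity_decompose deg by metis
  have mon': "monic (f ^ m)" "monic (g ^ n)" using mon by (simp_all add: monic_power)
  have "monic h1" using monic_multD[OF mon'(1), of h1] h1 mon by simp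
  then have "monic h2" using monic_multD[OF mon'(2), of h2] h2 by simp
  have "\<not> f dvd h2" using h1 h2 dvd_mult by blast
  then have "comaximal h2 (f ^ k)" "comaximal h2 (g ^ l)"
    using irreducible_comaximal[OF irr(1), of h2] irreducible_comaximal[OF irr(2), of h2] h1 h2
    by (auto intro: comaximal_power_right comaximal_commute)
  then have "comaximal h2 (f ^ k * g ^ l)" by (rule comaximal_mult)
  moreover have "h2 dvd f ^ k * g ^ l"
    using dvd h1 h2 by (metis dvd_mult_right)
  ultimately have "h2 = 1" using \<open>monic h2\<close> monic_dvd_comaximal by blast
  then have h: "h = f ^ m * g ^ n" using h1 h2 by simp
  have "m \<le> k \<and> n \<le> l"
    using powers_dvd_powers [OF fg deg] dvd h by blast
  then show thesis using that h by blast
qed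

subsection \<open>Endomorphisms and cyclic decompositions\<close>

text \<open>Allowing any bound \<open>n\<close> avoids a case distinction where \<open>pCons\<close>
  does not raise the degree.\<close>

lemma poly_endo_eq_sum:
  assumes "Modules.module scale" "degree g \<le> n"
  shows "poly_endo scale g u v = (\<Sum>i\<le>n. scale (coeff g i) ((u ^^ i) v))"
proof -
  interpret Modules.module scale by fact
  show ?thesis
    unfolding poly_endo_def using assms(2)
    by (intro sum.mono_neutral_left) (auto simp: coeff_eq_0)
qed

section \<open>The module over the polynomial ring defined by an endomorphism\<close>

locale endo = vector_space scale
  for scale :: "'a::field \<Rightarrow> 'v::ab_group_add \<Rightarrow> 'v" +
  fixes u :: "'v \<Rightarrow> 'v"
  assumes lin: "Vector_Spaces.linear scale scale u"
begin

sublocale u: Vector_Spaces.linear scale scale u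
  by (rule lin)

abbreviation act :: "'a poly \<Rightarrow> 'v \<Rightarrow> 'v" where
  "act g v \<equiv> poly_endo scale g u v"

lemma act_0 [simp]: "act 0 v = 0"
  by (simp add: poly_endo_def)

lemma act_pCons [simp]: "act (pCons c g) v = scale c v + u (act g v)"
proof -
  have "act (pCons c g) v = (\<Sum>i\<le>Suc (degree g). scale (coeff (pCons c g) i) ((u ^^ i) v))"
    by (intro poly_endo_eq_sum) (auto simp: degree_pCons_le module_axioms)
  also have "\<dots> = scale c v + (\<Sum>i\<le>degree g. scale (coeff g i) (u ((u ^^ i) v)))"
    by (subst sum.atMost_Suc_shift) simp
  also have "(\<Sum>i\<le>degree g. scale (coeff g i) (u ((u ^^ i) v))) = u (act g v)"
    by (simp add: poly_endo_def u.sum u.scale)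
  finally show ?thesis .
qed

lemma act_1 [simp]: "act 1 v = v"
  by (simp add: one_pCons)

lemma act_add: "act (g + h) v = act g v + act h v"
  by (induction g h rule: poly_induct2)
    (simp_all add: u.add scale_left_distrib algebra_simps)

lemma act_smult: "act (smult c g) v = scale c (act g v)"
  by (induction g) (simp_all add: u.scale scale_right_distrib)

lemma act_minus: "act (- g) v = - act g v"
  using act_smult[of "-1" g v] by simp

lemma act_diff: "act (g - h) v = act g v - act h v"
  using act_add[of g "- h" v] by (simp add: act_minus)

lemma act_u: "act g (u v) = u (act g v)"
  by (induction g) (simp_all add: u.add u.scale)

lemma act_mult: "act (g * h) v = act g (act h v)"
  by (induction g) (simp_all add: act_add act_smult)

lemma act_commute: "act g (act h v) = act h (act g v)"
  by (metis act_mult mult.commute)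

lemma act_sum: "act (\<Sum>i\<in>I. g i) v = (\<Sum>i\<in>I. act (g i) v)"
  by (induction I rule: infinite_finite_induct) (simp_all add: act_add)

lemma act_linear: "Vector_Spaces.linear scale scale (act g)"
proof (induction g)
  case 0
  have "poly_endo scale 0 u = (\<lambda>_. 0)" by (simp add: fun_eq_iff)
  then show ?case by (simp add: Vector_Spaces.linear_iff vector_space_axioms)
next
  case (pCons c g)
  interpret g: Vector_Spaces.linear scale scale "act g" by (rule pCons(2))
  show ?case
    by (simp add: Vector_Spaces.linear_iff vector_space_axioms g.add g.scale u.add u.scale
        scale_right_distrib mult.commute)
qed

sublocale act: Vector_Spaces.linear scale scale "act g" for g
  by (rule act_linear)

lemma act_unit_0:
  assumes "g \<noteq> 0" "degree g = 0" "act g v = 0"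
  shows "v = 0"
  using assms by (auto elim!: degree_eq_zeroE)

lemma act_eq_0_dvd: "g dvd h \<Longrightarrow> act g v = 0 \<Longrightarrow> act h v = 0"
  by (metis act.zero act_mult dvdE mult.commute)

lemma act_mod: "act f v = 0 \<Longrightarrow> act (g mod f) v = act g v"
  by (metis act.zero act_add act_mult add_0 div_mult_mod_eq)

text \<open>For finite \<open>I\<close>, the submodule over the polynomial ring generated by the
  \<open>v i\<close>.\<close>

definition gen :: "'i set \<Rightarrow> ('i \<Rightarrow> 'v) \<Rightarrow> 'v set" where
  "gen I v = range (\<lambda>g. \<Sum>i\<in>I. act (g i) (v i))"

lemma genI: "(\<Sum>i\<in>I. act (g i) (v i)) \<in> gen I v"
  by (auto simp: gen_def)

lemma genE:
  assumes "x \<in> gen I v"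
  obtains g where "x = (\<Sum>i\<in>I. act (g i) (v i))"
  using assms by (auto simp: gen_def)

lemma gen_act: "x \<in> gen I v \<Longrightarrow> act h x \<in> gen I v"
  using genI [where v = v and I = I and g = "\<lambda>i. h * _ i"]
  by (auto elim!: genE simp: act.sum act_mult)

lemma gen_subspace: "subspace (gen I v)"
proof (rule subspaceI)
  show "0 \<in> gen I v" using genI [where g = "\<lambda>_. 0"] by simp
next
  fix x y assume "x \<in> gen I v" "y \<in> gen I v"
  then obtain g h where gh: "x = (\<Sum>i\<in>I. act (g i) (v i))" "y = (\<Sum>i\<in>I. act (h i) (v i))"
    by (auto elim!: genE)
  have "x + y = (\<Sum>i\<in>I. act (g i + h i) (v i))"
    by (simp add: gh act_add sum.distrib)
  then show "x + y \<in> gen I v" using genI by metis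
next
  fix c x assume "x \<in> gen I v"
  then have "act [:c:] x \<in> gen I v" by (rule gen_act)
  then show "scale c x \<in> gen I v" by simp
qed

lemma gen_base: "finite I \<Longrightarrow> i \<in> I \<Longrightarrow> act g (v i) \<in> gen I v"
  using genI [where g = "\<lambda>j. if j = i then g else 0" and I = I and v = v]
  by (simp add: if_distrib [where f = "\<lambda>x. poly_endo scale x u _"] cong: if_cong)

lemma gen_leastI:
  assumes "subspace W" "\<And>x. x \<in> W \<Longrightarrow> u x \<in> W" "\<And>i. i \<in> I \<Longrightarrow> v i \<in> W"
  shows "gen I v \<subseteq> W"
proof -
  have "act g x \<in> W" if "x \<in> W" for g x
    using that assms by (induction g) (auto intro!: subspace_add subspace_scale simp: subspace_0)
  then show ?thesis
    using assms by (auto elim!: genE intro!: subspace_sum)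
qed

lemma act_in_span:
  assumes "f \<noteq> 0" "act f x = 0"
  shows "act g x \<in> span ((\<lambda>j. (u ^^ j) x) ` {..<degree f})"
proof (cases "g mod f = 0")
  case True
  then show ?thesis using act_mod [OF assms(2), of g] by (simp add: span_zero)
next
  case False
  then have "degree (g mod f) < degree f"
    using degree_mod_less [OF assms(1), of g] by simp
  then have "act (g mod f) x \<in> span ((\<lambda>j. (u ^^ j) x) ` {..<degree f})"
    unfolding poly_endo_def by (intro span_sum span_scale span_base) auto
  then show ?thesis using act_mod [OF assms(2), of g] by simp
qed

lemma gen_subset_span:
  assumes "\<And>i. i \<in> I \<Longrightarrow> f i \<noteq> 0 \<and> act (f i) (v i) = 0"
  shows "gen I v \<subseteq> span (\<Union>i\<in>I. (\<lambda>j. (u ^^ j) (v i)) ` {..<degree (f i)})" (is "_ \<subseteq> span ?S")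
proof
  fix x assume "x \<in> gen I v"
  then obtain g where x: "x = (\<Sum>i\<in>I. act (g i) (v i))" by (rule genE)
  have "act (g i) (v i) \<in> span ?S" if "i \<in> I" for i
    using act_in_span [of "f i" "v i" "g i"] assms [OF that] that
    by (meson UN_upper span_mono subsetD)
  then show "x \<in> span ?S" unfolding x by (rule span_sum)
qed

end

section \<open>The rank formula and cyclic decompositions with a dimension count\<close>

context finite_dimensional_vector_space
begin

text \<open>A linear right inverse of \<open>f\<close> on the image of \<open>W\<close> maps this
  image isomorphically onto a complement of the kernel in \<open>W\<close>.\<close>

lemma dim_kernel_image:
  assumes f: "Vector_Spaces.linear scale scale f" and W: "subspace W"
  shows "dim {x \<in> W. f x = 0} + dim (f ` W) = dim W"
proof -
  interpret pair: finite_dimensional_vector_space_pair scale Basis scale Basis ..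
  interpret f: Vector_Spaces.linear scale scale f by (rule f)
  obtain g where g: "g ` UNIV \<subseteq> W" "Vector_Spaces.linear scale scale g"
    "\<And>v. v \<in> f ` W \<Longrightarrow> f (g v) = v"
    using pair.linear_exists_right_inverse_on [OF f W] by auto
  interpret g: Vector_Spaces.linear scale scale g by (rule g)
  let ?K = "{x \<in> W. f x = 0}" and ?G = "g ` f ` W"
  have fW: "subspace (f ` W)" by (rule f.subspace_image [OF W])
  have K: "subspace ?K"
    using W by (auto simp: subspace_def f.zero f.add f.scale)
  have G: "subspace ?G" by (rule g.subspace_image [OF fW])
  have "inj_on g (span (f ` W))"
    unfolding span_eq_iff [THEN iffD2, OF fW] by (rule inj_on_inverseI [of _ f]) (rule g(3))
  then have dG: "dim ?G = dim (f ` W)" by (rule pair.dim_image_eq [OF g(2)])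
  have "z = 0" if "z \<in> ?K \<inter> ?G" for z
  proof -
    have "f z = 0" "z \<in> g ` (f ` W)" using that by auto
    then obtain y where y: "z = g y" "y \<in> f ` W" "f z = 0" by (elim imageE) simp
    then have "y = 0" using g(3) by simp
    then show ?thesis using y(1) g.zero by simp
  qed
  then have "?K \<inter> ?G = {0}"
    using subspace_0 [OF K] subspace_0 [OF G] by blast
  then have D0: "dim (?K \<inter> ?G) = 0" by simp
  have S: "{x + y |x y. x \<in> ?K \<and> y \<in> ?G} = W"
  proof (intro equalityI subsetI)
    fix z assume "z \<in> {x + y |x y. x \<in> ?K \<and> y \<in> ?G}"
    then show "z \<in> W" using g(1) W by (auto intro!: subspace_add)
  next
    fix z assume z: "z \<in> W"
    have "z - g (f z) \<in> ?K"
      using z g(1,3) W by (auto intro!: subspace_diff simp: f.diff)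
    moreover have "g (f z) \<in> ?G" using z by blast
    moreover have "z = (z - g (f z)) + g (f z)" by simp
    ultimately show "z \<in> {x + y |x y. x \<in> ?K \<and> y \<in> ?G}" by blast
  qed
  show ?thesis using dim_sums_Int [OF K G, unfolded D0 S dG] by simp
qed

end

locale fd_endo = endo scale u + finite_dimensional_vector_space scale Basis
  for scale :: "'a::field \<Rightarrow> 'v::ab_group_add \<Rightarrow> 'v" and u Basis
begin

text \<open>\<open>W\<close> is the direct sum of cyclic submodules isomorphic to the polynomial
  ring modulo \<open>f i\<close>. Directness is encoded by the dimension count, which can be read
  off a spanning list of the right length; \<open>decomp_dvd\<close> recovers it. The parameter
  \<open>W\<close> allows induction over stable subspaces of a fixed type.\<close>

definition decomp :: "'v set \<Rightarrow> 'i set \<Rightarrow> ('i \<Rightarrow> 'a poly) \<Rightarrow> ('i \<Rightarrow> 'v) \<Rightarrow> bool" where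
  "decomp W I f v \<longleftrightarrow> finite I \<and> (\<forall>i\<in>I. monic (f i) \<and> act (f i) (v i) = 0) \<and>
     gen I v = W \<and> (\<Sum>i\<in>I. degree (f i)) = dim W"

lemma card_cyclic_le:
  assumes "finite I"
  shows "card (\<Union>i\<in>I. (\<lambda>j. (u ^^ j) (v i)) ` {..<n i}) \<le> (\<Sum>i\<in>I. n i)"
proof -
  have "card (\<Union>i\<in>I. (\<lambda>j. (u ^^ j) (v i)) ` {..<n i})
      \<le> (\<Sum>i\<in>I. card ((\<lambda>j. (u ^^ j) (v i)) ` {..<n i}))"
    by (rule card_UN_le [OF assms])
  also have "\<dots> \<le> (\<Sum>i\<in>I. n i)"
    by (intro sum_mono order_trans [OF card_image_le]) auto
  finally show ?thesis .
qed

lemma dim_le_cyclic: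
  assumes "finite I" "W \<subseteq> span (\<Union>i\<in>I. (\<lambda>j. (u ^^ j) (v i)) ` {..<n i})"
  shows "dim W \<le> (\<Sum>i\<in>I. n i)"
  using dim_le_card [OF assms(2)] card_cyclic_le [OF assms(1)] assms(1)
  by (meson finite_UN_I finite_imageI finite_lessThan order_trans)

lemma dim_gen_le:
  assumes "finite I" "\<And>i. i \<in> I \<Longrightarrow> f i \<noteq> 0 \<and> act (f i) (v i) = 0"
  shows "dim (gen I v) \<le> (\<Sum>i\<in>I. degree (f i))"
  by (rule dim_le_cyclic [OF assms(1) gen_subset_span [OF assms(2)]])

text \<open>If \<open>f k\<close> did not divide \<open>g k\<close>, then \<open>f k\<close> could be replaced by a proper divisor, and
  \<open>W\<close> would be spanned by fewer than \<open>dim W\<close> vectors.\<close>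

lemma decomp_dvd:
  assumes D: "decomp W I f v" and 0: "(\<Sum>i\<in>I. act (g i) (v i)) = 0" and k: "k \<in> I"
  shows "f k dvd g k"
proof (rule ccontr)
  assume nd: "\<not> f k dvd g k"
  have fin: "finite I" and f: "\<And>i. i \<in> I \<Longrightarrow> f i \<noteq> 0 \<and> act (f i) (v i) = 0"
    and W: "gen I v = W" and dimW: "(\<Sum>i\<in>I. degree (f i)) = dim W"
    using D by (auto simp: decomp_def)
  obtain h x y where h: "h = x * f k + y * g k" "h dvd f k" "h dvd g k"
    using poly_bezout .
  have h0: "h \<noteq> 0" using h(2) f [OF k] by auto
  obtain c where c: "f k = h * c" using h(2) by (elim dvdE)
  have c0: "c \<noteq> 0" using c f [OF k] by auto
  have "\<not> is_unit c"
  proof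
    assume "is_unit c"
    then have "f k dvd h" unfolding c by (simp only: mult_unit_dvd_iff dvd_refl)
    then show False using nd h(3) dvd_trans by blast
  qed
  then have "degree c > 0" using is_unit_iff_degree [OF c0] c0 by auto
  then have deg: "degree h < degree (f k)" using c h0 c0 by (simp add: degree_mult_eq)
  let ?I = "I - {k}"
  define n where "n = (\<lambda>i. degree (f i))(k := degree h)"
  let ?S = "\<Union>i\<in>I. (\<lambda>j. (u ^^ j) (v i)) ` {..<n i}"
  have S1: "gen ?I v \<subseteq> span ?S"
  proof -
    have "gen ?I v \<subseteq> span (\<Union>i\<in>?I. (\<lambda>j. (u ^^ j) (v i)) ` {..<degree (f i)})"
      by (rule gen_subset_span) (use f in auto)
    also have "\<dots> \<subseteq> span ?S" by (intro span_mono UN_mono) (auto simp: n_def)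
    finally show ?thesis .
  qed
  have "act (g k) (v k) = - (\<Sum>i\<in>?I. act (g i) (v i))"
    using 0 sum.remove [OF fin k, of "\<lambda>i. act (g i) (v i)"] by (simp add: eq_neg_iff_add_eq_0)
  then have hv: "act h (v k) \<in> gen ?I v"
    using f [OF k] gen_act [OF subspace_neg [OF gen_subspace genI [where I = ?I and g = g and v = v]], of y]
    by (simp add: h(1) act_add act_mult)
  have hk: "act e (v k) \<in> span ?S" for e
  proof -
    have "act e (v k) = act (e div h) (act h (v k)) + act (e mod h) (v k)"
      by (metis act_add act_mult div_mult_mod_eq)
    moreover have "act (e div h) (act h (v k)) \<in> span ?S"
      using gen_act [OF hv] S1 by blast
    moreover have "act (e mod h) (v k) \<in> span ?S"
    proof (cases "e mod h = 0")
      case False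
      then have "degree (e mod h) < degree h"
        using degree_mod_less [OF h0, of e] by simp
      then show ?thesis
        unfolding poly_endo_def
        by (intro span_sum span_scale span_base UN_I [OF k]) (auto simp: n_def)
    qed (simp add: span_zero)
    ultimately show ?thesis by (simp add: span_add)
  qed
  have "W \<subseteq> span ?S"
  proof
    fix z assume "z \<in> W"
    then obtain e where z: "z = (\<Sum>i\<in>I. act (e i) (v i))" using W by (auto elim: genE)
    have "(\<Sum>i\<in>?I. act (e i) (v i)) \<in> span ?S" using S1 genI by blast
    then show "z \<in> span ?S"
      unfolding z sum.remove [OF fin k] using hk by (intro span_add)
  qed
  then have "dim W \<le> sum n I" by (rule dim_le_cyclic [OF fin])
  also have "\<dots> < (\<Sum>i\<in>I. degree (f i))"
    by (rule sum_strict_mono_ex1 [OF fin]) (use deg k in \<open>auto simp: n_def\<close>)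
  finally show False using dimW by simp
qed

text \<open>Each \<open>h i\<close> is a gcd of \<open>f i\<close> and \<open>g\<close>, in Bezout
  form. Write \<open>f i = h i * k i\<close>. The kernel lies in the submodule generated by the
  vectors \<open>act (k i) (v i)\<close>, which \<open>h i\<close> kills, and the image in the one
  generated by the \<open>act g (v i)\<close>, which \<open>k i\<close> kills. This bounds both
  dimensions from above, and the rank formula makes the bounds sharp.\<close>

lemma dim_ker_act:
  assumes D: "decomp UNIV I f v"
    and h: "\<And>i. i \<in> I \<Longrightarrow> h i dvd f i \<and> h i dvd g \<and> (\<exists>x y. h i = x * f i + y * g)"
  shows "dim {x. act g x = 0} = (\<Sum>i\<in>I. degree (h i))"
proof -
  have fin: "finite I" and f: "\<And>i. i \<in> I \<Longrightarrow> f i \<noteq> 0 \<and> act (f i) (v i) = 0"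
    and W: "gen I v = UNIV" and dimW: "(\<Sum>i\<in>I. degree (f i)) = dim UNIV"
    using D by (auto simp: decomp_def)
  define k where "k i = f i div h i" for i
  have fk: "f i = h i * k i" if "i \<in> I" for i using h [OF that] by (simp add: k_def)
  have nz: "h i \<noteq> 0" "k i \<noteq> 0" if "i \<in> I" for i using fk [OF that] f [OF that] by auto
  have "{x. act g x = 0} \<subseteq> gen I (\<lambda>i. act (k i) (v i))"
  proof
    fix x assume "x \<in> {x. act g x = 0}"
    then have gx: "act g x = 0" by simp
    obtain e where x: "x = (\<Sum>i\<in>I. act (e i) (v i))" using W by (metis UNIV_I genE)
    have 0: "(\<Sum>i\<in>I. act (g * e i) (v i)) = 0"
      using gx by (simp add: x act.sum act_mult)
    \<comment> \<open>Cancelling \<open>h i\<close> from \<open>f i dvd g * e i\<close> leaves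
      \<open>k i\<close> dividing \<open>g' * e i\<close>, where \<open>g'\<close> is comaximal with
      \<open>k i\<close>.\<close>
    have "k i dvd e i" if i: "i \<in> I" for i
    proof -
      have dvd: "h i * k i dvd g * e i" using decomp_dvd [OF D 0 i] fk [OF i] by simp
      have "h i dvd g" using h [OF i] by simp
      then obtain g' where g': "g = h i * g'" by (elim dvdE)
      obtain x y where "h i = x * f i + y * g" using h [OF i] by blast
      then have "h i * 1 = h i * (x * k i + y * g')"
        by (simp add: fk [OF i] g' algebra_simps)
      then have "x * k i + y * g' = 1"
        using nz [OF i] mult_left_cancel by metis
      then have "comaximal (k i) g'" by (rule comaximalI)
      moreover have "k i dvd g' * e i"
        using dvd nz [OF i] by (simp add: g' mult.assoc)
      ultimately show ?thesis by (rule comaximal_dvd_mult)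
    qed
    then have "e i = (e i div k i) * k i" if "i \<in> I" for i using that by simp
    then have "x = (\<Sum>i\<in>I. act (e i div k i) (act (k i) (v i)))"
      unfolding x by (intro sum.cong) (simp_all flip: act_mult)
    then show "x \<in> gen I (\<lambda>i. act (k i) (v i))" by (simp add: genI)
  qed
  then have "dim {x. act g x = 0} \<le> dim (gen I (\<lambda>i. act (k i) (v i)))" by (rule dim_subset)
  also have "\<dots> \<le> (\<Sum>i\<in>I. degree (h i))"
    by (rule dim_gen_le [OF fin]) (use f fk nz in \<open>auto simp flip: act_mult\<close>)
  finally have le: "dim {x. act g x = 0} \<le> (\<Sum>i\<in>I. degree (h i))" .
  have "range (act g) \<subseteq> gen I (\<lambda>i. act g (v i))"
  proof
    fix y assume "y \<in> range (act g)"
    then obtain e where "y = act g (\<Sum>i\<in>I. act (e i) (v i))" using W by (metis UNIV_I genE rangeE)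
    then have "y = (\<Sum>i\<in>I. act (e i) (act g (v i)))" by (simp add: act.sum act_commute)
    then show "y \<in> gen I (\<lambda>i. act g (v i))" by (simp add: genI)
  qed
  then have "dim (range (act g)) \<le> dim (gen I (\<lambda>i. act g (v i)))" by (rule dim_subset)
  also have "\<dots> \<le> (\<Sum>i\<in>I. degree (k i))"
  proof (rule dim_gen_le [OF fin])
    fix i assume i: "i \<in> I"
    have "f i dvd k i * g" using h [OF i] fk [OF i] by (metis mult.commute mult_dvd_mono dvd_refl)
    then show "k i \<noteq> 0 \<and> act (k i) (act g (v i)) = 0"
      using act_eq_0_dvd f [OF i] nz [OF i] by (metis act_mult)
  qed
  finally have "dim (range (act g)) \<le> (\<Sum>i\<in>I. degree (k i))" .
  moreover have "dim {x. act g x = 0} + dim (range (act g)) = dim UNIV"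
    using dim_kernel_image [OF act_linear, of UNIV g] by simp
  moreover have "dim UNIV = (\<Sum>i\<in>I. degree (h i)) + (\<Sum>i\<in>I. degree (k i))"
    unfolding dimW [symmetric] sum.distrib [symmetric] using fk nz
    by (intro sum.cong) (auto simp: degree_mult_eq)
  ultimately show ?thesis using le by simp
qed

end

subsection \<open>The rational canonical form\<close>

lemma poly_ideal_generator:
  fixes S :: "'a::field poly set"
  assumes g: "g \<in> S" "g \<noteq> 0" and S: "\<And>f g h. f \<in> S \<Longrightarrow> g \<in> S \<Longrightarrow> f + h * g \<in> S"
  obtains m where "monic m" "m \<in> S" "\<And>f. f \<in> S \<Longrightarrow> m dvd f"
proof -
  obtain k where k: "k \<in> S" "k \<noteq> 0" and min: "\<And>f. f \<in> S \<Longrightarrow> f \<noteq> 0 \<Longrightarrow> degree k \<le> degree f"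
    using arg_min_natI [of "\<lambda>f. f \<in> S \<and> f \<noteq> 0" g degree] arg_min_nat_le [of "\<lambda>f. f \<in> S \<and> f \<noteq> 0" _ degree] g
    by blast
  have "k + (- 1) * k \<in> S" by (rule S [OF k(1) k(1)])
  then have 0: "0 \<in> S" by simp
  define m where "m = smult (inverse (lead_coeff k)) k"
  have "monic m" using k by (simp add: m_def)
  moreover have "m \<in> S" using S [OF 0 k(1), of "[:inverse (lead_coeff k):]"] by (simp add: m_def)
  moreover have "m dvd f" if f: "f \<in> S" for f
  proof -
    have "f mod k = f + (- (f div k)) * k" by (simp add: minus_div_mult_eq_mod)
    then have "f mod k \<in> S" using S [OF f k(1)] by metis
    then have "f mod k = 0" using min degree_mod_less [OF k(2), of f] by fastforce
    then have "k dvd f" by (simp add: dvd_eq_mod_eq_0)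
    then show ?thesis using k by (simp add: m_def smult_dvd_iff)
  qed
  ultimately show thesis using that by blast
qed

context endo
begin

lemma act_monom: "act (monom c n) v = scale c ((u ^^ n) v)"
  by (induction n) (simp_all add: monom_0 monom_Suc u.scale)

lemma act_sum_monom: "act (\<Sum>j<n. monom (c j) j) v = (\<Sum>j<n. scale (c j) ((u ^^ j) v))"
  by (simp add: act_sum act_monom)

text \<open>The monic generator of the annihilator of \<open>v\<close>, that is, the minimal
  polynomial of \<open>u\<close> at \<open>v\<close>.\<close>

definition is_order :: "'a poly \<Rightarrow> 'v \<Rightarrow> bool" where
  "is_order g v \<longleftrightarrow> monic g \<and> (\<forall>h. act h v = 0 \<longleftrightarrow> g dvd h)"

lemma is_orderD: "is_order g v \<Longrightarrow> act g v = 0"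
  by (simp add: is_order_def)

lemma exists_order:
  assumes "act g v = 0" "g \<noteq> 0"
  obtains m where "is_order m v"
proof -
  obtain m where "monic m" "m \<in> {h. act h v = 0}" "\<And>f. f \<in> {h. act h v = 0} \<Longrightarrow> m dvd f"
    by (rule poly_ideal_generator [of g "{h. act h v = 0}"]) (use assms in \<open>auto simp: act_add act_mult\<close>)
  then have "is_order m v" unfolding is_order_def using act_eq_0_dvd by blast
  then show thesis by (rule that)
qed

lemma powers_independent:
  assumes small: "\<forall>g. act g v = 0 \<longrightarrow> degree g < n \<longrightarrow> g = 0"
  shows "inj_on (\<lambda>j. (u ^^ j) v) {..<n}" "independent ((\<lambda>j. (u ^^ j) v) ` {..<n})"
proof -
  have deg: "degree (\<Sum>j<n. monom (c j) j) < n" if "n > 0" for c :: "nat \<Rightarrow> 'a"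
    using that by (intro degree_sum_less) (auto intro: le_less_trans [OF degree_monom_le])
  have coeff: "coeff (\<Sum>j<n. monom (c j) j) i = c i" if "i < n" for c :: "nat \<Rightarrow> 'a" and i
    using that by (simp add: coeff_sum)
  have zero: "c i = 0" if "(\<Sum>j<n. scale (c j) ((u ^^ j) v)) = 0" "i < n" for c i
  proof -
    have "(\<Sum>j<n. monom (c j) j) = 0"
      using that deg [of c] by (intro small [rule_format]) (simp_all add: act_sum_monom)
    then show ?thesis using coeff [OF that(2), of c] by simp
  qed
  show inj: "inj_on (\<lambda>j. (u ^^ j) v) {..<n}"
  proof (rule inj_onI, rule ccontr)
    fix i j assume ij: "i \<in> {..<n}" "j \<in> {..<n}" "(u ^^ i) v = (u ^^ j) v" "i \<noteq> j"
    let ?c = "\<lambda>k. if k = i then 1 else if k = j then - 1 else (0::'a)"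
    have "(\<Sum>k<n. scale (?c k) ((u ^^ k) v)) = (\<Sum>k\<in>{i, j}. scale (?c k) ((u ^^ k) v))"
      using ij by (intro sum.mono_neutral_right) auto
    also have "\<dots> = 0" using ij by simp
    finally have "?c i = 0" using ij by (intro zero) auto
    then show False by simp
  qed
  show "independent ((\<lambda>j. (u ^^ j) v) ` {..<n})"
  proof (rule independent_if_scalars_zero)
    fix c x assume 0: "(\<Sum>x\<in>(\<lambda>j. (u ^^ j) v) ` {..<n}. scale (c x) x) = 0"
      and "x \<in> (\<lambda>j. (u ^^ j) v) ` {..<n}"
    then obtain i where i: "i < n" "x = (u ^^ i) v" by auto
    show "c x = 0"
      using zero [of "\<lambda>j. c ((u ^^ j) v)", OF _ i(1)] 0 i(2) by (simp add: sum.reindex [OF inj])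
  qed simp
qed

end

context fd_endo
begin

lemma exists_annihilator:
  obtains g where "g \<noteq> 0" "degree g \<le> dim UNIV" "act g v = 0"
proof (rule ccontr)
  assume "\<not> thesis"
  then have "\<forall>g. act g v = 0 \<longrightarrow> degree g < Suc (dim UNIV) \<longrightarrow> g = 0"
    using that less_Suc_eq_le by blast
  note ind = powers_independent [OF this]
  have "card ((\<lambda>j. (u ^^ j) v) ` {..<Suc (dim UNIV)}) \<le> dim UNIV"
    using independent_card_le_dim [OF subset_UNIV ind(2)] .
  then show False using card_image [OF ind(1)] by simp
qed

text \<open>A vector whose order has the largest degree works. If it did not, some prime
  \<open>h\<close> would have a larger multiplicity in the order of another vector \<open>w\<close>;
  then \<open>act (h ^ k) v\<close> and \<open>act g' w\<close> have the comaximal orders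
  \<open>f'\<close> and \<open>h ^ l\<close>, so their sum has an order of larger degree.\<close>

lemma exists_maximal_order:
  assumes W: "subspace W" and inv: "\<And>x. x \<in> W \<Longrightarrow> u x \<in> W"
  obtains v m where "v \<in> W" "is_order m v" "\<And>w. w \<in> W \<Longrightarrow> act m w = 0"
proof -
  have act_W: "act g x \<in> W" if "x \<in> W" for g x
    using that assms by (induction g) (auto intro!: subspace_add subspace_scale simp: subspace_0)
  have ord: "\<exists>m. is_order m v \<and> degree m \<le> dim UNIV" for v
  proof -
    obtain g where g: "g \<noteq> 0" "degree g \<le> dim UNIV" "act g v = 0" by (rule exists_annihilator)
    obtain m where m: "is_order m v" using exists_order g by metis
    then have "m dvd g" using g by (simp add: is_order_def)
    then show ?thesis using m g dvd_imp_degree_le order_trans by blast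
  qed
  define P where "P m \<longleftrightarrow> (\<exists>v\<in>W. is_order m v)" for m
  have bound: "degree m \<le> dim UNIV" if "P m" for m
  proof -
    from that obtain v where "is_order m v" unfolding P_def by blast
    moreover obtain m' where "is_order m' v" "degree m' \<le> dim UNIV" using ord by blast
    ultimately show ?thesis
      by (metis dvd_refl is_order_def dvd_imp_degree_le order_trans leading_coeff_0_iff zero_neq_one)
  qed
  obtain m0 where "P m0" using ord [of 0] subspace_0 [OF W] unfolding P_def by blast
  then obtain m where m: "P m" and max: "\<And>m'. P m' \<Longrightarrow> degree m' \<le> degree m"
    using ex_has_greatest_nat [of P m0 degree "Suc (dim UNIV)"] bound le_imp_less_Suc by blast
  obtain v where v: "v \<in> W" "is_order m v" using m by (auto simp: P_def)
  have "act m w = 0" if w: "w \<in> W" for w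
  proof (rule ccontr)
    assume nz: "act m w \<noteq> 0"
    obtain g where g: "is_order g w" using ord by blast
    have "m \<noteq> 0" "g \<noteq> 0" using v g by (auto simp: is_order_def)
    moreover have "\<not> g dvd m" using nz g by (simp add: is_order_def)
    ultimately obtain h k l f' g' where h: "irreducible h" "m = h ^ k * f'" "g = h ^ l * g'"
      "k < l" "\<not> h dvd f'" by (rule not_dvd_imp_prime_power)
    let ?z = "act (h ^ k) v + act g' w"
    have cm: "comaximal (h ^ l) f'" "comaximal f' (h ^ l)"
      using irreducible_comaximal [OF h(1,5)] by (metis comaximal_commute comaximal_power_right)+
    have h0: "h \<noteq> 0" using irreducible_poly_degree_pos [OF h(1)] by auto
    then have nz': "h ^ l \<noteq> 0" "f' \<noteq> 0" "g' \<noteq> 0" "h ^ k \<noteq> 0" using h(2,3) \<open>m \<noteq> 0\<close> \<open>g \<noteq> 0\<close> by auto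
    have 1: "act e (act (h ^ k) v) = 0 \<longleftrightarrow> f' dvd e" for e
      using v(2) nz' h0 by (simp add: is_order_def h(2) mult.commute flip: act_mult)
    have 2: "act e (act g' w) = 0 \<longleftrightarrow> h ^ l dvd e" for e
      using g nz' h0 by (simp add: is_order_def h(3) flip: act_mult)
    have ez: "act e ?z = 0 \<longleftrightarrow> h ^ l * f' dvd e" for e
    proof
      assume "h ^ l * f' dvd e"
      then have "h ^ l dvd e" "f' dvd e" using dvd_mult_left dvd_mult_right by blast+
      then show "act e ?z = 0" using 1 [of e] 2 [of e] by (simp add: act.add)
    next
      assume "act e ?z = 0"
      then have "act f' (act e ?z) = 0" "act (h ^ l) (act e ?z) = 0" by simp_all
      moreover have "act (f' * e) (act (h ^ k) v) = 0" "act (h ^ l * e) (act g' w) = 0"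
        by (simp_all add: 1 2)
      ultimately have "act (f' * e) (act g' w) = 0" "act (h ^ l * e) (act (h ^ k) v) = 0"
        by (simp_all add: act.add act_mult)
      then have "h ^ l dvd f' * e" "f' dvd h ^ l * e" by (simp_all add: 1 2)
      then have "h ^ l dvd e" "f' dvd e" using cm comaximal_dvd_mult by blast+
      then show "h ^ l * f' dvd e" using cm comaximal_mult_dvd by blast
    qed
    have "?z \<in> W" using v(1) w act_W W by (intro subspace_add) auto
    obtain g2 where g2: "is_order g2 ?z" using ord by blast
    then have "P g2" using \<open>?z \<in> W\<close> by (auto simp: P_def)
    then have le: "degree g2 \<le> degree m" by (rule max)
    have "h ^ l * f' dvd g2" using g2 ez by (simp add: is_order_def)
    moreover have "g2 \<noteq> 0" using g2 by (auto simp: is_order_def)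
    ultimately have "degree (h ^ l * f') \<le> degree g2" by (rule dvd_imp_degree_le)
    then have "degree (h ^ l * f') \<le> degree (h ^ k * f')" using le h(2) by simp
    then show False
      using nz' h(4) irreducible_poly_degree_pos [OF h(1)]
      by (simp add: degree_mult_eq degree_power_eq)
  qed
  then show thesis using that v by blast
qed

text \<open>The complement consists of the \<open>w\<close> with \<open>\<phi> (u\<^sup>i w) = 0\<close> for all \<open>i\<close>, where \<open>\<phi>\<close> is a linear form
  that kills \<open>u\<^sup>i v\<close> for \<open>i < degree m - 1\<close> but not for \<open>i = degree m - 1\<close>.\<close>

lemma cyclic_complement:
  assumes W: "subspace W" and inv: "\<And>x. x \<in> W \<Longrightarrow> u x \<in> W"
    and v: "v \<in> W" "is_order m v" and m: "\<And>w. w \<in> W \<Longrightarrow> act m w = 0" and pos: "degree m > 0"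
  obtains W' where "subspace W'" "\<And>x. x \<in> W' \<Longrightarrow> u x \<in> W'" "W' \<subseteq> W"
    "W = {act g v + w |g w. w \<in> W'}" "dim W = degree m + dim W'"
proof -
  define n where "n = degree m"
  let ?B = "(\<lambda>j. (u ^^ j) v) ` {..<n}"
  have mon: "monic m" using v(2) by (simp add: is_order_def)
  have "\<forall>g. act g v = 0 \<longrightarrow> degree g < n \<longrightarrow> g = 0"
    using v(2) dvd_imp_degree_le [of m] unfolding is_order_def n_def by (metis leD)
  note ind = powers_independent [OF this]
  have m_nz: "m \<noteq> 0" using mon by auto
  have npos: "n > 0" using pos by (simp add: n_def)
  interpret pair: vector_space_pair scale "(*) :: 'a \<Rightarrow> 'a \<Rightarrow> 'a"
    by unfold_locales (auto simp: algebra_simps)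
  obtain \<phi> where phi: "Vector_Spaces.linear scale (*) \<phi>"
    and phiB: "\<And>x. x \<in> ?B \<Longrightarrow> \<phi> x = (if x = (u ^^ (n - 1)) v then 1 else 0)"
    using pair.linear_independent_extend [OF ind(2), of "\<lambda>x. if x = (u ^^ (n - 1)) v then 1 else 0"] by blast
  interpret phi: Vector_Spaces.linear scale "(*)" \<phi> by (rule phi)
  have phi1: "\<phi> ((u ^^ i) v) = (if i = n - 1 then 1 else 0)" if "i < n" for i
    using phiB [of "(u ^^ i) v"] that npos inj_on_eq_iff [OF ind(1), of i "n - 1"] by auto
  have upow: "(u ^^ i) (x + y) = (u ^^ i) x + (u ^^ i) y" "(u ^^ i) (scale c x) = scale c ((u ^^ i) x)"
    for i x y c using act_monom [of 1 i] act.add act.scale by (metis scale_one)+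
  define W' where "W' = {w \<in> W. \<forall>i<n. \<phi> ((u ^^ i) w) = 0}"
  have upow0: "(u ^^ i) 0 = 0" for i using upow(2) [of i 0 0] by simp
  have sub: "subspace W'"
    using W by (auto simp: W'_def subspace_def upow upow0 phi.add phi.scale phi.zero)
  have inv': "u x \<in> W'" if x: "x \<in> W'" for x
  proof -
    have xW: "x \<in> W" using x by (simp add: W'_def)
    have "\<phi> ((u ^^ i) (u x)) = 0" if i: "i < n" for i
    proof (cases "Suc i < n")
      case True
      then show ?thesis using x by (simp add: W'_def funpow_swap1 del: funpow.simps) (metis funpow_simps_right(2) o_apply)
    next
      case False
      \<comment> \<open>In this last case the vanishing of \<open>act m x\<close> expresses the
        \<open>n\<close>-th iterate at \<open>x\<close> by lower ones, on which
        \<open>\<phi>\<close> vanishes.\<close>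
      then have "n = Suc i" using i by simp
      then have "(u ^^ i) (u x) = (u ^^ n) x" by (simp add: funpow_swap1)
      moreover have "act m x = (\<Sum>j<n. scale (coeff m j) ((u ^^ j) x)) + (u ^^ n) x"
        using mon by (simp add: poly_endo_def n_def lessThan_Suc_atMost [symmetric])
      then have "\<phi> ((\<Sum>j<n. scale (coeff m j) ((u ^^ j) x)) + (u ^^ n) x) = 0"
        using m [OF xW] phi.zero by simp
      then have "\<phi> ((u ^^ n) x) = 0"
        using x by (simp add: phi.add phi.sum phi.scale W'_def)
      ultimately show ?thesis by simp
    qed
    then show ?thesis using inv [OF xW] by (simp add: W'_def)
  qed
  have act_W: "act g x \<in> W" if "x \<in> W" for g x
    using that W inv by (induction g) (auto intro!: subspace_add subspace_scale simp: subspace_0)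
  \<comment> \<open>On \<open>(u ^^ (n - 1 - k)) v\<close>, the form \<open>\<phi>\<close> composed
    with \<open>u ^^ i\<close> vanishes for \<open>i < k\<close> and is 1 for \<open>i = k\<close>.
    Correcting by a multiple of this vector therefore achieves the condition for \<open>k\<close>
    and keeps the earlier ones.\<close>
  have approx: "\<exists>g. \<forall>i<k. \<phi> ((u ^^ i) (w - act g v)) = 0" if "k \<le> n" for k w
    using that
  proof (induction k)
    case (Suc k)
    then obtain g where g: "\<And>i. i < k \<Longrightarrow> \<phi> ((u ^^ i) (w - act g v)) = 0" by fastforce
    let ?c = "\<phi> ((u ^^ k) (w - act g v))"
    have "\<phi> ((u ^^ i) (w - act (g + monom ?c (n - 1 - k)) v)) = 0" if i: "i < Suc k" for i
    proof -
      have "w - act (g + monom ?c (n - 1 - k)) v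
          = (w - act g v) + scale (- ?c) ((u ^^ (n - 1 - k)) v)"
        by (simp add: act_add act_monom)
      then have "\<phi> ((u ^^ i) (w - act (g + monom ?c (n - 1 - k)) v))
          = \<phi> ((u ^^ i) (w - act g v)) - ?c * \<phi> ((u ^^ (i + (n - 1 - k))) v)"
        by (simp only: upow phi.add phi.scale funpow_add o_apply) simp
      moreover have "i + (n - 1 - k) < n" "i + (n - 1 - k) = n - 1 \<longleftrightarrow> i = k"
        using i Suc.prems by auto
      ultimately show ?thesis using phi1 g i by (auto simp: less_Suc_eq)
    qed
    then show ?case by blast
  qed simp
  have split: "W = {act g v + w |g w. w \<in> W'}"
  proof (intro equalityI subsetI)
    fix w assume w: "w \<in> W"
    obtain g where g: "\<And>i. i < n \<Longrightarrow> \<phi> ((u ^^ i) (w - act g v)) = 0"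
      using approx [of n w] by blast
    have "w - act g v \<in> W'"
      using g w v W act_W by (auto simp: W'_def intro!: subspace_diff)
    then have "w = act g v + (w - act g v) \<and> w - act g v \<in> W'" by simp
    then show "w \<in> {act g v + w |g w. w \<in> W'}" by blast
  next
    fix w assume "w \<in> {act g v + w |g w. w \<in> W'}"
    then show "w \<in> W" using v W act_W by (auto simp: W'_def intro!: subspace_add)
  qed
  have act_monom1: "act (monom 1 j) v = (u ^^ j) v" for j by (simp add: act_monom)
  let ?Z = "gen {()} (\<lambda>_. v)"
  have Z: "?Z = range (\<lambda>g. act g v)"
    unfolding gen_def by (auto simp: image_iff)
  have "?Z = span ?B"
  proof (rule antisym)
    show "?Z \<subseteq> span ?B"
      using gen_subset_span [of "{()}" "\<lambda>_. m" "\<lambda>_. v"] m_nz is_orderD [OF v(2)]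
      by (simp add: n_def)
    show "span ?B \<subseteq> ?Z"
    proof (rule span_minimal [OF _ gen_subspace], rule image_subsetI)
      show "(u ^^ j) v \<in> ?Z" for j
        unfolding Z by (subst act_monom1 [symmetric]) (rule rangeI)
    qed
  qed
  then have dimZ: "dim ?Z = n"
    using dim_span_eq_card_independent [OF ind(2)] card_image [OF ind(1)] by simp
  have "z = 0" if z: "z \<in> ?Z" "z \<in> W'" for z
  proof (rule ccontr)
    assume nz: "z \<noteq> 0"
    obtain e where e: "z = act e v" using z Z by auto
    define g where "g = e mod m"
    have zg: "z = act g v" using act_mod [OF is_orderD [OF v(2)]] e by (simp add: g_def)
    then have g0: "g \<noteq> 0" using nz by auto
    have deg: "degree g < n"
      using degree_mod_less [OF m_nz, of e] g0 by (simp add: g_def n_def)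
    \<comment> \<open>This shift moves the leading term of \<open>g\<close> to the exponent
      \<open>n - 1\<close>, the only one that \<open>\<phi>\<close> sees, so \<open>\<phi>\<close>
      reads off the leading coefficient.\<close>
    let ?k = "n - 1 - degree g"
    have "(u ^^ ?k) z = (\<Sum>j\<le>degree g. scale (coeff g j) ((u ^^ (j + ?k)) v))"
    proof -
      have "(u ^^ ?k) z = act g ((u ^^ ?k) v)"
        using zg act_commute [of g "monom 1 ?k" v] by (simp add: act_monom)
      then show ?thesis by (simp add: poly_endo_def funpow_add)
    qed
    then have "\<phi> ((u ^^ ?k) z) = (\<Sum>j\<le>degree g. coeff g j * (if j = degree g then 1 else 0))"
      using deg by (simp add: phi.sum phi.scale, intro sum.cong) (auto simp: phi1)
    also have "\<dots> = lead_coeff g" by (subst sum.remove [of _ "degree g"]) (auto intro!: sum.neutral)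
    finally have "lead_coeff g = 0" using z(2) npos by (simp add: W'_def)
    then show False using g0 by simp
  qed
  then have "?Z \<inter> W' = {0}"
    using subspace_0 [OF gen_subspace] subspace_0 [OF sub] by blast
  then have D0: "dim (?Z \<inter> W') = 0" by simp
  have S: "{x + y |x y. x \<in> ?Z \<and> y \<in> W'} = W"
    unfolding Z split by blast
  have "dim W = n + dim W'"
    using dim_sums_Int [OF gen_subspace sub, of "{()}" "\<lambda>_. v", unfolded D0 S dimZ] by simp
  then show thesis
    using that [OF sub inv' _ split] by (auto simp: W'_def n_def)
qed

text \<open>Split off the cyclic submodule of a vector of maximal order and recurse into the
  complement. The clause on annihilators carries the divisibility chain: the maximal order
  \<open>m\<close> kills the complement, so the factors found there divide it. The same clause later
  identifies \<open>f 0\<close> as the minimal polynomial. The zero space has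
  \<open>n = 0\<close>.\<close>

theorem rational_canonical_form:
  assumes "subspace W" "\<And>x. x \<in> W \<Longrightarrow> u x \<in> W"
  shows "\<exists>(n::nat) f v. decomp W {..<n} f v \<and> (\<forall>i. Suc i < n \<longrightarrow> f (Suc i) dvd f i) \<and>
    (\<forall>g. (\<forall>w\<in>W. act g w = 0) \<longrightarrow> (\<forall>i<n. f i dvd g)) \<and> (n > 0 \<longrightarrow> (\<forall>w\<in>W. act (f 0) w = 0))"
  using assms
proof (induction "dim W" arbitrary: W rule: less_induct)
  case less
  note W = less(2) and inv = less(3)
  obtain v m where v: "v \<in> W" "is_order m v" and m: "\<And>w. w \<in> W \<Longrightarrow> act m w = 0"
    using exists_maximal_order [OF W inv] by blast
  have mon: "monic m" using v by (simp add: is_order_def)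
  show ?case
  proof (cases "degree m = 0")
    case True
    then have "m = 1" using mon monic_degree_0 by blast
    then have "w = 0" if "w \<in> W" for w using m [OF that] by simp
    then have W0: "W = {0}" using subspace_0 [OF W] by blast
    then have "dim W = 0" by simp
    then have "decomp W {..<0::nat} (\<lambda>_. 1) (\<lambda>_. 0)" by (simp add: decomp_def gen_def W0)
    then show ?thesis by (intro exI [of _ 0] exI) auto
  next
    case False
    then have pos: "degree m > 0" by simp
    obtain W' where W': "subspace W'" "\<And>x. x \<in> W' \<Longrightarrow> u x \<in> W'" "W' \<subseteq> W"
      "W = {act g v + w |g w. w \<in> W'}" "dim W = degree m + dim W'"
      using cyclic_complement [OF W inv v m pos] by blast
    then have "dim W' < dim W" using pos by simp
    then obtain n f v' where IH: "decomp W' {..<n::nat} f v'"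
      "\<And>i. Suc i < n \<Longrightarrow> f (Suc i) dvd f i"
      "\<And>g i. \<forall>w\<in>W'. act g w = 0 \<Longrightarrow> i < n \<Longrightarrow> f i dvd g"
      using less(1) [OF _ W'(1,2)] by blast
    let ?f = "case_nat m f" and ?v = "case_nat v v'"
    have "gen {..<Suc n} ?v = W"
    proof -
      have "gen {..<Suc n} ?v = {act g v + w |g w. w \<in> gen {..<n} v'}"
      proof (intro equalityI subsetI)
        fix x assume "x \<in> gen {..<Suc n} ?v"
        then obtain g where "x = (\<Sum>i<Suc n. act (g i) (?v i))" by (rule genE)
        then have "x = act (g 0) v + (\<Sum>i<n. act (g (Suc i)) (v' i))"
          by (simp add: sum.lessThan_Suc_shift del: sum.lessThan_Suc)
        then show "x \<in> {act g v + w |g w. w \<in> gen {..<n} v'}"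
          using genI [of "\<lambda>i. g (Suc i)" v' "{..<n}"] by blast
      next
        fix x assume "x \<in> {act g v + w |g w. w \<in> gen {..<n} v'}"
        then obtain g h where x: "x = act g v + (\<Sum>i<n. act (h i) (v' i))" by (auto elim!: genE)
        have "x = (\<Sum>i<Suc n. act (case_nat g h i) (?v i))"
          unfolding x by (simp add: sum.lessThan_Suc_shift del: sum.lessThan_Suc)
        then show "x \<in> gen {..<Suc n} ?v" using genI by metis
      qed
      then show ?thesis using IH(1) W'(4) by (simp add: decomp_def)
    qed
    moreover have "(\<Sum>i<Suc n. degree (?f i)) = dim W"
      using IH(1) W'(5) by (simp add: decomp_def sum.lessThan_Suc_shift del: sum.lessThan_Suc)
    moreover have "\<forall>i<Suc n. monic (?f i) \<and> act (?f i) (?v i) = 0"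
      using IH(1) mon is_orderD [OF v(2)] by (auto simp: decomp_def split: nat.split)
    ultimately have "decomp W {..<Suc n} ?f ?v" by (simp add: decomp_def)
    moreover have "?f (Suc i) dvd ?f i" if "Suc i < Suc n" for i
      using that IH(2) IH(3) [of m i] m W'(3) by (auto split: nat.split)
    moreover have "?f i dvd g" if "\<forall>w\<in>W. act g w = 0" "i < Suc n" for g i
    proof (cases i)
      case 0
      have "act g v = 0" using that(1) v(1) by blast
      then show ?thesis using 0 v(2) by (simp add: is_order_def)
    next
      case (Suc j)
      then show ?thesis using that IH(3) [of g j] W'(3) by auto
    qed
    ultimately show ?thesis using m by (intro exI [of _ "Suc n"] exI [of _ ?f] exI [of _ ?v]) simp
  qed
qed

text \<open>By \<open>decomp_dvd\<close>, the coefficients in a relation among the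
  \<open>v i\<close> are multiples of the \<open>f i\<close>, so any images killed by the
  \<open>f i\<close> extend to a homomorphism into another space with its own endomorphism.\<close>

lemma decomp_universal:
  assumes D: "decomp UNIV I f v" and E: "endo scale' u'"
    and w: "\<And>i. i \<in> I \<Longrightarrow> poly_endo scale' (f i) u' (w i) = 0"
  obtains \<phi> where "Vector_Spaces.linear scale scale' \<phi>" "\<And>x. \<phi> (u x) = u' (\<phi> x)"
    "\<And>i. i \<in> I \<Longrightarrow> \<phi> (v i) = w i"
proof -
  interpret E: endo scale' u' by (rule E)
  have fin: "finite I" using D by (simp add: decomp_def)
  \<comment> \<open>One choice of coefficients for each vector; \<open>phi\<close> below shows that
    every other choice gives the same value.\<close>
  define rep where "rep x = (SOME g. x = (\<Sum>i\<in>I. act (g i) (v i)))" for x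
  define \<phi> where "\<phi> x = (\<Sum>i\<in>I. E.act (rep x i) (w i))" for x
  have rep: "x = (\<Sum>i\<in>I. act (rep x i) (v i))" for x
  proof -
    have "x \<in> gen I v" using D by (simp add: decomp_def)
    then have "\<exists>g. x = (\<Sum>i\<in>I. act (g i) (v i))" by (auto elim: genE)
    then show ?thesis unfolding rep_def by (rule someI_ex)
  qed
  have phi: "\<phi> x = (\<Sum>i\<in>I. E.act (g i) (w i))" if x: "x = (\<Sum>i\<in>I. act (g i) (v i))" for x g
  proof -
    have "(\<Sum>i\<in>I. act (rep x i - g i) (v i)) = 0"
      using rep [of x] x by (simp add: act_diff sum_subtractf)
    then have "f i dvd rep x i - g i" if "i \<in> I" for i
      using decomp_dvd [OF D, of "\<lambda>i. rep x i - g i"] that by blast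
    then have "E.act (rep x i - g i) (w i) = 0" if "i \<in> I" for i
      using w that E.act_eq_0_dvd by blast
    then have "E.act (rep x i) (w i) = E.act (g i) (w i)" if "i \<in> I" for i
      using that by (simp add: E.act_diff)
    then show ?thesis by (simp add: \<phi>_def)
  qed
  show thesis
  proof
    show "Vector_Spaces.linear scale scale' \<phi>"
      unfolding Vector_Spaces.linear_iff
    proof (intro conjI allI)
      show "vector_space scale" "vector_space scale'"
        by (rule vector_space_axioms E.vector_space_axioms)+
      fix x y c
      have "x + y = (\<Sum>i\<in>I. act (rep x i + rep y i) (v i))"
        using rep [of x] rep [of y] by (simp add: act_add sum.distrib)
      from phi [OF this] show "\<phi> (x + y) = \<phi> x + \<phi> y"
        by (simp add: \<phi>_def E.act_add sum.distrib)
      have "scale c x = (\<Sum>i\<in>I. act (smult c (rep x i)) (v i))"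
        using rep [of x] by (simp add: act_smult flip: scale_sum_right)
      from phi [OF this] show "\<phi> (scale c x) = scale' c (\<phi> x)"
        by (simp add: \<phi>_def E.act_smult E.scale_sum_right)
    qed
  next
    fix x
    have "u x = (\<Sum>i\<in>I. act (pCons 0 (rep x i)) (v i))"
      using rep [of x] by (simp flip: u.sum)
    from phi [OF this] show "\<phi> (u x) = u' (\<phi> x)"
      by (simp add: \<phi>_def E.u.sum)
  next
    fix k assume k: "k \<in> I"
    have "v k = (\<Sum>i\<in>I. act (if i = k then 1 else 0) (v i))"
      using fin k by (simp add: if_distrib [where f = "\<lambda>x. poly_endo scale x u _"] cong: if_cong)
    from phi [OF this] show "\<phi> (v k) = w k"
      using fin k by (simp add: if_distrib [where f = "\<lambda>x. poly_endo scale' x u' _"] cong: if_cong)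
  qed
qed

end

subsection \<open>Companion matrices\<close>

lemma sum_lessThan_add:
  "(\<Sum>i<k + l. f i) = (\<Sum>i<k. f i) + (\<Sum>i<l. f (k + i :: nat) :: 'a::comm_monoid_add)"
  by (induction l) (simp_all add: add.assoc)

lemma square_diag_block_mat:
  assumes "\<And>A. A \<in> set As \<Longrightarrow> square_mat A"
  shows "square_mat (diag_block_mat As)"
  using assms by (induction As) (auto simp: Let_def)

lemma square_companion: "square_mat (companion f)"
  by (simp add: companion_def Let_def)

lemma dim_companion [simp]:
  "dim_row (companion f) = degree f" "dim_col (companion f) = degree f"
  by (simp_all add: companion_def Let_def)

text \<open>Allows a pair of companion matrices to be treated as a single diagonal block and
  back.\<close>

lemma diag_block_mat_concat:
  "diag_block_mat (map (\<lambda>fs. diag_block_mat (map g fs)) fss) = diag_block_mat (map g (concat fss))"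
  by (induction fss) (auto simp: diag_block_mat_append Let_def)

context endo
begin

text \<open>The matrix condition of \<open>represented_by\<close> for an arbitrary list, so that it
  passes to the sublists that belong to single diagonal blocks.\<close>

definition acts :: "'v list \<Rightarrow> 'a mat \<Rightarrow> bool" where
  "acts B A \<longleftrightarrow> A \<in> carrier_mat (length B) (length B) \<and>
     (\<forall>j<length B. u (B ! j) = (\<Sum>i<length B. scale (A $$ (i, j)) (B ! i)))"

lemma represented_by_iff: "represented_by scale u B A \<longleftrightarrow> ordered_basis scale B \<and> acts B A"
  by (simp add: represented_by_def acts_def)

lemma acts_append:
  assumes "length B1 = dim_row A" "square_mat A" "length B2 = dim_row D" "square_mat D"
  shows "acts (B1 @ B2) (four_block_mat A (0\<^sub>m (dim_row A) (dim_col D)) (0\<^sub>m (dim_row D) (dim_col A)) D)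
     \<longleftrightarrow> acts B1 A \<and> acts B2 D"
    (is "acts _ ?M \<longleftrightarrow> _")
proof -
  define k where "k = length B1"
  define l where "l = length B2"
  have dims: "dim_row A = k" "dim_col A = k" "dim_row D = l" "dim_col D = l"
    using assms by (simp_all add: k_def l_def)
  have M: "?M \<in> carrier_mat (k + l) (k + l)" by (rule carrier_matI) (simp_all add: dims)
  have 1: "(\<Sum>i<k + l. scale (?M $$ (i, j)) ((B1 @ B2) ! i)) = (\<Sum>i<k. scale (A $$ (i, j)) (B1 ! i))"
    if "j < k" for j
    using that by (simp add: sum_lessThan_add dims nth_append flip: k_def)
  have 2: "(\<Sum>i<k + l. scale (?M $$ (i, k + j)) ((B1 @ B2) ! i)) = (\<Sum>i<l. scale (D $$ (i, j)) (B2 ! i))"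
    if "j < l" for j
    using that by (simp add: sum_lessThan_add dims nth_append flip: k_def)
  have all: "(\<forall>j<k + l. P j) \<longleftrightarrow> (\<forall>j<k. P j) \<and> (\<forall>j<l. P (k + j))" for P
    by (metis add_less_cancel_left le_add_diff_inverse less_or_eq_imp_le not_less trans_less_add1)
  have n: "(B1 @ B2) ! j = B1 ! j" if "j < k" for j
    using that by (simp add: nth_append k_def)
  have n': "(B1 @ B2) ! (k + j) = B2 ! j" for j
    by (simp add: nth_append k_def)
  have "acts (B1 @ B2) ?M \<longleftrightarrow>
    (\<forall>j<k + l. u ((B1 @ B2) ! j) = (\<Sum>i<k + l. scale (?M $$ (i, j)) ((B1 @ B2) ! i)))"
    using M unfolding acts_def length_append k_def [symmetric] l_def [symmetric] by (simp only: simp_thms)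
  also have "\<dots> \<longleftrightarrow> (\<forall>j<k. u (B1 ! j) = (\<Sum>i<k. scale (A $$ (i, j)) (B1 ! i))) \<and>
      (\<forall>j<l. u (B2 ! j) = (\<Sum>i<l. scale (D $$ (i, j)) (B2 ! i)))"
    unfolding all by (intro arg_cong2 [of _ _ _ _ "(\<and>)"] all_cong) (simp_all only: 1 2 n n')
  also have "\<dots> \<longleftrightarrow> acts B1 A \<and> acts B2 D"
    unfolding acts_def k_def [symmetric] l_def [symmetric]
    using dims by (simp only: carrier_matI simp_thms)
  finally show ?thesis .
qed

lemma acts_diag_block_mat_Cons:
  assumes "square_mat A" "\<And>M. M \<in> set As \<Longrightarrow> square_mat M"
  shows "acts B (diag_block_mat (A # As)) \<longleftrightarrow>
    (\<exists>B1 B2. B = B1 @ B2 \<and> acts B1 A \<and> acts B2 (diag_block_mat As))"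
proof
  assume a: "acts B (diag_block_mat (A # As))"
  then have "dim_row (diag_block_mat (A # As)) = length B"
    unfolding acts_def using carrier_matD(1) by blast
  then have "length B = dim_row A + dim_row (diag_block_mat As)"
    by (simp add: Let_def)
  then have "acts (take (dim_row A) B) A \<and> acts (drop (dim_row A) B) (diag_block_mat As)"
    using a assms square_diag_block_mat [of As]
    by (subst acts_append [symmetric]) (auto simp: Let_def)
  then show "\<exists>B1 B2. B = B1 @ B2 \<and> acts B1 A \<and> acts B2 (diag_block_mat As)"
    by (metis append_take_drop_id)
next
  assume "\<exists>B1 B2. B = B1 @ B2 \<and> acts B1 A \<and> acts B2 (diag_block_mat As)"
  then obtain B1 B2 where B: "B = B1 @ B2" "acts B1 A" "acts B2 (diag_block_mat As)" by blast
  then have "length B1 = dim_row A" "length B2 = dim_row (diag_block_mat As)"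
    unfolding acts_def using carrier_matD(1) by metis+
  then show "acts B (diag_block_mat (A # As))"
    using B assms square_diag_block_mat [of As] acts_append [of B1 A B2 "diag_block_mat As"]
    by (simp add: Let_def)
qed

text \<open>The subdiagonal forces \<open>B\<close> to be the string \<open>v, u v, ...\<close>, and
  the last column says that \<open>f\<close> kills \<open>v\<close>.\<close>

lemma acts_companion:
  assumes "monic f"
  shows "acts B (companion f) \<longleftrightarrow>
    (\<exists>v. B = map (\<lambda>j. (u ^^ j) v) [0..<degree f] \<and> act f v = 0)"
proof (cases "degree f = 0")
  case True
  then have "f = 1" using assms monic_degree_0 by blast
  \<comment> \<open>The polynomial 1 gives the empty matrix and the empty list, and 0 is the vector
    that it kills.\<close>
  then show ?thesis by (auto simp: acts_def companion_def Let_def intro!: exI [of _ 0])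
next
  case False
  define n where "n = degree f"
  have n: "n > 0" using False by (simp add: n_def)
  have last: "act f v = (\<Sum>i<n. scale (coeff f i) ((u ^^ i) v)) + (u ^^ n) v" for v
    using assms by (simp add: poly_endo_def n_def lessThan_Suc_atMost [symmetric])
  have column: "(\<Sum>i<n. scale (companion f $$ (i, j)) (B ! i)) =
      (if j = n - 1 then - (\<Sum>i<n. scale (coeff f i) (B ! i)) else B ! Suc j)" if "j < n" for j
  proof (cases "j = n - 1")
    case True
    then show ?thesis using that
      by (simp add: companion_def Let_def flip: n_def sum_negf)
  next
    case False
    then have "Suc j < n" using that by simp
    moreover have "(\<Sum>i<n. scale (companion f $$ (i, j)) (B ! i))
        = (\<Sum>i<n. if i = Suc j then B ! i else 0)"
      using False that by (intro sum.cong) (auto simp: companion_def Let_def simp flip: n_def)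
    ultimately show ?thesis using False by simp
  qed
  have dimf: "companion f \<in> carrier_mat (length B) (length B) \<longleftrightarrow> length B = n"
    by (metis carrier_matD(1) carrier_matI dim_companion n_def)
  show ?thesis
  proof
    assume a: "acts B (companion f)"
    then have len: "length B = n" using dimf by (simp add: acts_def)
    have step: "u (B ! j) = (if j = n - 1 then - (\<Sum>i<n. scale (coeff f i) (B ! i)) else B ! Suc j)"
      if "j < n" for j
      using a that column [OF that] by (simp add: acts_def len)
    define v where "v = B ! 0"
    have pow: "B ! j = (u ^^ j) v" if "j < n" for j
      using that
    proof (induction j)
      case (Suc j)
      then show ?case using step [of j] by auto
    qed (simp add: v_def)
    have "(u ^^ n) v = u (B ! (n - 1))"
      using pow [of "n - 1"] n by (cases n) auto
    also have "\<dots> = - (\<Sum>i<n. scale (coeff f i) ((u ^^ i) v))"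
      using step [of "n - 1"] n pow by simp
    finally have "act f v = 0" by (simp add: last)
    moreover have "B = map (\<lambda>j. (u ^^ j) v) [0..<n]"
      using pow len by (intro nth_equalityI) auto
    ultimately show "\<exists>v. B = map (\<lambda>j. (u ^^ j) v) [0..<degree f] \<and> act f v = 0"
      unfolding n_def by blast
  next
    assume "\<exists>v. B = map (\<lambda>j. (u ^^ j) v) [0..<degree f] \<and> act f v = 0"
    then obtain v where B: "B = map (\<lambda>j. (u ^^ j) v) [0..<n]" and 0: "act f v = 0"
      by (auto simp: n_def)
    have "u (B ! j) = (if j = n - 1 then - (\<Sum>i<n. scale (coeff f i) (B ! i)) else B ! Suc j)"
      if "j < n" for j
    proof (cases "j = n - 1")
      case True
      then have "u (B ! j) = u ((u ^^ (n - 1)) v)" using n by (simp add: B)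
      also have "\<dots> = (u ^^ n) v" using n by (cases n) simp_all
      also have "\<dots> = - (\<Sum>i<n. scale (coeff f i) (B ! i))"
        using 0 by (simp add: last B eq_neg_iff_add_eq_0 add.commute)
      finally show ?thesis using True by simp
    next
      case False
      then have "Suc j < n" using that by simp
      then show ?thesis using False that by (simp add: B)
    qed
    then show "acts B (companion f)"
      using column dimf by (simp add: acts_def B)
  qed
qed

lemma acts_diag_companion:
  assumes "\<And>f. f \<in> set fs \<Longrightarrow> monic f"
  shows "acts B (diag_block_mat (map companion fs)) \<longleftrightarrow>
    (\<exists>v. B = concat (map (\<lambda>i. map (\<lambda>j. (u ^^ j) (v i)) [0..<degree (fs ! i)]) [0..<length fs]) \<and>
       (\<forall>i<length fs. act (fs ! i) (v i) = 0))"
  using assms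
proof (induction fs arbitrary: B)
  case Nil
  then show ?case by (auto simp: acts_def)
next
  case (Cons f fs)
  let ?C = "\<lambda>fs v. concat (map (\<lambda>i. map (\<lambda>j. (u ^^ j) (v i)) [0..<degree (fs ! i)]) [0..<length fs])"
  have C: "?C (f # fs) w = map (\<lambda>j. (u ^^ j) (w 0)) [0..<degree f] @ ?C fs (\<lambda>i. w (Suc i))" for w
    by (simp add: upt_conv_Cons map_Suc_upt [symmetric] o_def del: upt_Suc)
  have all: "(\<forall>i<length (f # fs). act ((f # fs) ! i) (w i) = 0) \<longleftrightarrow>
      act f (w 0) = 0 \<and> (\<forall>i<length fs. act (fs ! i) (w (Suc i)) = 0)" for w
    by (auto simp: less_Suc_eq_0_disj)
  have "acts B (diag_block_mat (map companion (f # fs))) \<longleftrightarrow>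
    (\<exists>B1 B2. B = B1 @ B2 \<and> acts B1 (companion f) \<and> acts B2 (diag_block_mat (map companion fs)))"
    unfolding list.map by (rule acts_diag_block_mat_Cons) (auto simp: square_companion simp del: square_mat.simps)
  also have "\<dots> \<longleftrightarrow> (\<exists>v v'. B = map (\<lambda>j. (u ^^ j) v) [0..<degree f] @ ?C fs v' \<and> act f v = 0 \<and>
      (\<forall>i<length fs. act (fs ! i) (v' i) = 0))"
    using Cons.IH Cons.prems acts_companion [of f] by auto
  also have "\<dots> \<longleftrightarrow> (\<exists>w. B = ?C (f # fs) w \<and> (\<forall>i<length (f # fs). act ((f # fs) ! i) (w i) = 0))"
  proof
    assume "\<exists>v v'. B = map (\<lambda>j. (u ^^ j) v) [0..<degree f] @ ?C fs v' \<and> act f v = 0 \<and>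
      (\<forall>i<length fs. act (fs ! i) (v' i) = 0)"
    then obtain v v' where "B = map (\<lambda>j. (u ^^ j) v) [0..<degree f] @ ?C fs v'" "act f v = 0"
      "\<forall>i<length fs. act (fs ! i) (v' i) = 0" by blast
    then have "B = ?C (f # fs) (case_nat v v') \<and>
        (\<forall>i<length (f # fs). act ((f # fs) ! i) (case_nat v v' i) = 0)"
      unfolding C all by simp
    then show "\<exists>w. B = ?C (f # fs) w \<and> (\<forall>i<length (f # fs). act ((f # fs) ! i) (w i) = 0)" by blast
  next
    assume "\<exists>w. B = ?C (f # fs) w \<and> (\<forall>i<length (f # fs). act ((f # fs) ! i) (w i) = 0)"
    then obtain w where "B = map (\<lambda>j. (u ^^ j) (w 0)) [0..<degree f] @ ?C fs (\<lambda>i. w (Suc i)) \<and>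
        act f (w 0) = 0 \<and> (\<forall>i<length fs. act (fs ! i) (w (Suc i)) = 0)"
      unfolding C all by blast
    then show "\<exists>v v'. B = map (\<lambda>j. (u ^^ j) v) [0..<degree f] @ ?C fs v' \<and> act f v = 0 \<and>
      (\<forall>i<length fs. act (fs ! i) (v' i) = 0)"
      by (intro exI [of _ "w 0"] exI [of _ "\<lambda>i. w (Suc i)"])
  qed
  finally show ?case .
qed

end

context fd_endo
begin

text \<open>Trades independence for a count of vectors, the form in which \<open>decomp\<close>
  records it.\<close>

lemma ordered_basis_iff:
  "ordered_basis scale B \<longleftrightarrow> length B = dim UNIV \<and> span (set B) = UNIV"
proof
  assume "ordered_basis scale B"
  then have B: "distinct B" "independent (set B)" "span (set B) = UNIV"
    by (auto simp: ordered_basis_def)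
  then show "length B = dim UNIV \<and> span (set B) = UNIV"
    using dim_span_eq_card_independent [OF B(2)] distinct_card [OF B(1)] by simp
next
  assume B: "length B = dim UNIV \<and> span (set B) = UNIV"
  then have "dim UNIV \<le> card (set B)" by (intro span_card_ge_dim) auto
  then have c: "card (set B) = length B" using B card_length [of B] by linarith
  then have "distinct B" by (rule card_distinct)
  moreover have "independent (set B)"
    by (rule card_le_dim_spanning [of _ UNIV]) (use B c in auto)
  ultimately show "ordered_basis scale B" using B by (simp add: ordered_basis_def)
qed

text \<open>The bridge between matrices and modules: a basis adapted to companion blocks is the
  concatenation of the strings of iterates of the generators.\<close>

lemma represented_by_companions_iff:
  assumes "\<And>f. f \<in> set fs \<Longrightarrow> monic f"
  shows "(\<exists>B. represented_by scale u B (diag_block_mat (map companion fs))) \<longleftrightarrow>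
    (\<exists>v. decomp UNIV {..<length fs} (\<lambda>i. fs ! i) v)"
proof -
  let ?C = "\<lambda>v. concat (map (\<lambda>i. map (\<lambda>j. (u ^^ j) (v i)) [0..<degree (fs ! i)]) [0..<length fs])"
  have len: "length (?C v) = (\<Sum>i<length fs. degree (fs ! i))" for v
    by (simp add: length_concat o_def sum_list_sum_nth atLeast0LessThan)
  have set: "set (?C v) = (\<Union>i<length fs. (\<lambda>j. (u ^^ j) (v i)) ` {..<degree (fs ! i)})" for v
    by (auto simp: atLeast0LessThan)
  have span: "span (set (?C v)) = gen {..<length fs} v"
    if "\<And>i. i < length fs \<Longrightarrow> act (fs ! i) (v i) = 0" for v
  proof (rule antisym)
    show "gen {..<length fs} v \<subseteq> span (set (?C v))"
      unfolding set
    proof (rule gen_subset_span)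
      fix i assume "i \<in> {..<length fs}"
      then show "fs ! i \<noteq> 0 \<and> act (fs ! i) (v i) = 0"
        using that [of i] assms [OF nth_mem, of i] by auto
    qed
    have "(u ^^ j) (v i) \<in> gen {..<length fs} v" if "i < length fs" for i j
      using gen_base [of "{..<length fs}" i "monom 1 j" v] that by (simp add: act_monom)
    then show "span (set (?C v)) \<subseteq> gen {..<length fs} v"
      unfolding set by (intro span_minimal gen_subspace) auto
  qed
  have "(\<exists>B. represented_by scale u B (diag_block_mat (map companion fs))) \<longleftrightarrow>
    (\<exists>v. (\<Sum>i<length fs. degree (fs ! i)) = dim UNIV \<and> span (set (?C v)) = UNIV \<and>
       (\<forall>i<length fs. act (fs ! i) (v i) = 0))"
  proof -
    have "(\<exists>B. Q B \<and> (\<exists>v. B = C v \<and> P v)) \<longleftrightarrow> (\<exists>v. Q (C v) \<and> P v)"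
      for Q :: "'v list \<Rightarrow> bool" and C :: "(nat \<Rightarrow> 'v) \<Rightarrow> 'v list" and P
      by blast
    note this [of "\<lambda>B. length B = dim UNIV \<and> span (set B) = UNIV" ?C
        "\<lambda>v. \<forall>i<length fs. act (fs ! i) (v i) = 0"]
    then show ?thesis
      unfolding represented_by_iff ordered_basis_iff
      by (simp only: acts_diag_companion assms len conj_assoc)
  qed
  also have "\<dots> \<longleftrightarrow> (\<exists>v. decomp UNIV {..<length fs} (\<lambda>i. fs ! i) v)"
  proof (rule ex_cong1)
    fix v
    have mon: "\<forall>i<length fs. monic (fs ! i)" using assms nth_mem by blast
    show "(\<Sum>i<length fs. degree (fs ! i)) = dim UNIV \<and> span (set (?C v)) = UNIV \<and>
        (\<forall>i<length fs. act (fs ! i) (v i) = 0) \<longleftrightarrow> decomp UNIV {..<length fs} (\<lambda>i. fs ! i) v"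
    proof (cases "\<forall>i<length fs. act (fs ! i) (v i) = 0")
      case True
      then have "span (set (?C v)) = gen {..<length fs} v" by (intro span) blast
      then show ?thesis using True mon by (simp only: decomp_def) auto
    next
      case False
      then show ?thesis by (auto simp: decomp_def)
    qed
  qed
  finally show ?thesis .
qed

section \<open>Rearranging and splitting decompositions\<close>

lemma decomp_reindex:
  assumes "decomp W I f v" "bij_betw h J I"
  shows "decomp W J (f \<circ> h) (v \<circ> h)"
proof -
  have "gen J (v \<circ> h) = gen I v"
  proof (intro equalityI subsetI)
    fix x assume "x \<in> gen J (v \<circ> h)"
    then obtain g where "x = (\<Sum>j\<in>J. act (g j) (v (h j)))" by (auto elim: genE)
    also have "\<dots> = (\<Sum>i\<in>I. act (g (the_inv_into J h i)) (v i))"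
      using assms(2)
      by (subst sum.reindex_bij_betw [OF assms(2), symmetric])
         (auto intro!: sum.cong simp: the_inv_into_f_f bij_betw_def)
    finally show "x \<in> gen I v" by (simp add: genI [of "\<lambda>i. g (the_inv_into J h i)"])
  next
    fix x assume "x \<in> gen I v"
    then obtain g where "x = (\<Sum>i\<in>I. act (g i) (v i))" by (auto elim: genE)
    also have "\<dots> = (\<Sum>j\<in>J. act (g (h j)) ((v \<circ> h) j))"
      by (subst sum.reindex_bij_betw [OF assms(2), symmetric]) simp
    finally show "x \<in> gen J (v \<circ> h)" using genI [of "\<lambda>j. g (h j)" "v \<circ> h" J] by simp
  qed
  moreover have "(\<Sum>j\<in>J. degree (f (h j))) = (\<Sum>i\<in>I. degree (f i))"
    by (rule sum.reindex_bij_betw [OF assms(2)])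
  moreover have "finite J" using assms bij_betw_finite by (auto simp: decomp_def)
  moreover have "h j \<in> I" if "j \<in> J" for j using assms(2) that by (auto simp: bij_betw_def)
  ultimately show ?thesis using assms(1) by (simp add: decomp_def)
qed

text \<open>Chinese remainder theorem for the cyclic summands: \<open>act (g i) (v i)\<close> is
  killed by \<open>f i\<close> and \<open>act (f i) (v i)\<close> by \<open>g i\<close>, and a
  Bezout identity recovers \<open>v i\<close> from the two.\<close>

lemma decomp_split:
  assumes D: "decomp W I (\<lambda>i. f i * g i) v" and fg: "\<And>i. i \<in> I \<Longrightarrow> monic (f i) \<and> monic (g i) \<and> comaximal (f i) (g i)"
  obtains w where "decomp W (I \<times> UNIV) (\<lambda>(i, b). if b then f i else g i) w"
proof -
  have fin: "finite I" using D by (simp add: decomp_def)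
  define w where "w = (\<lambda>(i, b). if b then act (g i) (v i) else act (f i) (v i))"
  have split: "(\<Sum>x\<in>I \<times> UNIV. F x) = (\<Sum>i\<in>I. F (i, True) + F (i, False))" for F :: "_ \<Rightarrow> 'c::comm_monoid_add"
    by (simp add: sum.cartesian_product' UNIV_bool add.commute)
  have "gen (I \<times> UNIV) w = gen I v"
  proof (intro equalityI subsetI)
    fix x assume "x \<in> gen (I \<times> UNIV) w"
    then obtain e where "x = (\<Sum>y\<in>I \<times> UNIV. act (e y) (w y))" by (rule genE)
    then have "x = (\<Sum>i\<in>I. act (e (i, True) * g i + e (i, False) * f i) (v i))"
      by (simp add: split w_def act_add act_mult)
    then show "x \<in> gen I v"
      using genI [of "\<lambda>i. e (i, True) * g i + e (i, False) * f i" v I] by simp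
  next
    fix x assume "x \<in> gen I v"
    then obtain e where x: "x = (\<Sum>i\<in>I. act (e i) (v i))" by (rule genE)
    have "\<exists>a b. a * f i + b * g i = 1" if "i \<in> I" for i
      using fg [OF that] by (simp add: comaximal_def)
    then obtain a b where ab: "\<And>i. i \<in> I \<Longrightarrow> a i * f i + b i * g i = 1" by metis
    have "x = (\<Sum>i\<in>I. act (e i * b i) (act (g i) (v i)) + act (e i * a i) (act (f i) (v i)))"
    proof -
      have "act (e i) (v i) = act (e i * b i) (act (g i) (v i)) + act (e i * a i) (act (f i) (v i))"
        if "i \<in> I" for i
      proof -
        have "e i = e i * (a i * f i + b i * g i)" using ab [OF that] by simp
        also have "\<dots> = (e i * b i) * g i + (e i * a i) * f i" by (simp add: algebra_simps)
        finally show ?thesis by (metis act_add act_mult)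
      qed
      then show ?thesis unfolding x by (intro sum.cong) auto
    qed
    also have "\<dots> = (\<Sum>y\<in>I \<times> UNIV. act ((\<lambda>(i, t). if t then e i * b i else e i * a i) y) (w y))"
      by (simp add: split w_def)
    finally show "x \<in> gen (I \<times> UNIV) w"
      using genI [of "\<lambda>(i, t). if t then e i * b i else e i * a i" w "I \<times> UNIV"] by simp
  qed
  moreover have "(\<Sum>y\<in>I \<times> UNIV. degree ((\<lambda>(i, b). if b then f i else g i) y)) = (\<Sum>i\<in>I. degree (f i * g i))"
  proof -
    have "degree (f i * g i) = degree (f i) + degree (g i)" if "i \<in> I" for i
      using fg [OF that] by (intro degree_mult_eq) auto
    then show ?thesis by (simp add: split)
  qed
  ultimately have "decomp W (I \<times> UNIV) (\<lambda>(i, b). if b then f i else g i) w"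
    using D fg fin by (auto simp: decomp_def w_def mult.commute simp flip: act_mult)
  then show thesis by (rule that)
qed

end

subsection \<open>Eigenvalues in the algebraic closure\<close>

context endo
begin

text \<open>Linear forms with values in the algebraic closure, on which the transpose of \<open>u\<close> acts by
  \<open>\<Lambda> \<mapsto> \<Lambda> \<circ> u\<close>, replace the scalar extension of the vector space.\<close>

definition closure_form :: "('v \<Rightarrow> 'a alg_closure) \<Rightarrow> bool" where
  "closure_form \<Lambda> \<longleftrightarrow> (\<forall>x y. \<Lambda> (x + y) = \<Lambda> x + \<Lambda> y) \<and> (\<forall>c x. \<Lambda> (scale c x) = to_ac c * \<Lambda> x)"

lemma closure_form_0: "closure_form \<Lambda> \<Longrightarrow> \<Lambda> 0 = 0"
  unfolding closure_form_def by (metis add_cancel_right_left)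

lemma closure_form_sum: "closure_form \<Lambda> \<Longrightarrow> \<Lambda> (\<Sum>i\<in>I. f i) = (\<Sum>i\<in>I. \<Lambda> (f i))"
  by (induction I rule: infinite_finite_induct) (simp_all add: closure_form_0, simp add: closure_form_def)

text \<open>The space consists of all functions, because \<open>endo\<close> speaks of a whole type;
  the forms that are linear over the base field are a stable part of it, by
  \<open>form_act_closure_form\<close>.\<close>

interpretation form: endo "\<lambda>c \<Lambda> v. c * \<Lambda> v" "\<lambda>(\<Lambda>::'v \<Rightarrow> 'a alg_closure) v. \<Lambda> (u v)"
proof -
  have *: "vector_space (\<lambda>c (\<Lambda>::'v \<Rightarrow> 'a alg_closure) v. c * \<Lambda> v)"
    by unfold_locales (simp_all add: fun_eq_iff algebra_simps)
  then show "endo (\<lambda>c \<Lambda> v. c * \<Lambda> v) (\<lambda>(\<Lambda>::'v \<Rightarrow> 'a alg_closure) v. \<Lambda> (u v))"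
    by (simp add: endo_def endo_axioms_def Vector_Spaces.linear_iff fun_eq_iff)
qed

lemma form_act_map_poly:
  "closure_form \<Lambda> \<Longrightarrow> form.act (map_poly to_ac f) \<Lambda> v = \<Lambda> (act f v)"
proof (induction f arbitrary: v)
  case (pCons c f)
  then show ?case by (simp add: map_poly_pCons closure_form_def act_u)
qed (simp add: closure_form_0)

lemma form_act_eigen:
  assumes "\<And>v. \<Lambda> (u v) = x * \<Lambda> v"
  shows "form.act g \<Lambda> v = poly g x * \<Lambda> v"
  by (induction g arbitrary: v) (simp_all add: assms algebra_simps)

lemma form_act_closure_form: "closure_form \<Lambda> \<Longrightarrow> closure_form (form.act g \<Lambda>)"
  by (induction g) (simp_all add: closure_form_def u.add u.scale algebra_simps)

text \<open>Split a linear factor \<open>t - x\<close> off \<open>g\<close>, with cofactor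
  \<open>h\<close>. Either \<open>h\<close> already kills the form and has smaller degree, or the
  image of the form under \<open>h\<close> is an eigenform for \<open>x\<close>.\<close>

lemma exists_closure_eigenform:
  assumes "closure_form \<Lambda>" "\<Lambda> \<noteq> 0" "g \<noteq> 0" "form.act g \<Lambda> = 0"
  obtains x \<Lambda>' where "poly g x = 0" "closure_form \<Lambda>'" "\<Lambda>' \<noteq> 0" "\<And>v. \<Lambda>' (u v) = x * \<Lambda>' v"
proof -
  have "\<exists>x \<Lambda>'. poly g x = 0 \<and> closure_form \<Lambda>' \<and> \<Lambda>' \<noteq> 0 \<and> (\<forall>v. \<Lambda>' (u v) = x * \<Lambda>' v)"
    using assms(3,4)
  proof (induction "degree g" arbitrary: g)
    case 0
    have "\<Lambda> = 0" by (rule form.act_unit_0 [OF 0(2) 0(1) [symmetric] 0(3)])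
    then show ?case using assms(2) by contradiction
  next
    case (Suc k)
    have "degree g > 0" using Suc(2) by simp
    then obtain x where x: "poly g x = 0" using alg_closed_imp_poly_has_root by blast
    then obtain h where h: "g = [:- x, 1:] * h" by (metis dvdE poly_eq_0_iff_dvd)
    have "h \<noteq> 0" using h Suc(3) by (metis mult_zero_right)
    have "degree g = degree [:- x, 1:] + degree h"
      unfolding h using \<open>h \<noteq> 0\<close> by (intro degree_mult_eq) simp_all
    then have deg: "degree h = k" using Suc(2) by simp
    show ?case
    proof (cases "form.act h \<Lambda> = 0")
      case True
      obtain x' \<Lambda>' where *: "poly h x' = 0" "closure_form \<Lambda>' \<and> \<Lambda>' \<noteq> 0 \<and> (\<forall>v. \<Lambda>' (u v) = x' * \<Lambda>' v)"
        using Suc(1) [OF deg [symmetric] \<open>h \<noteq> 0\<close> True] by blast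
      then have "poly g x' = 0" by (simp only: h poly_mult mult_zero_right)
      then show ?thesis using *(2) by blast
    next
      case False
      have "form.act [:- x, 1:] (form.act h \<Lambda>) = 0"
        using Suc.prems(2) by (simp only: h form.act_mult)
      then have "form.act h \<Lambda> (u v) = x * form.act h \<Lambda> v" for v
        by (simp add: fun_eq_iff add_eq_0_iff)
      then show ?thesis
        using x False form_act_closure_form [OF assms(1)] by blast
    qed
  qed
  then show thesis using that by blast
qed

end

context fd_endo
begin

text \<open>The values of an eigenform on the basis form a left eigenvector of the matrix, and
  transposing keeps the eigenvalues. The right-hand side no longer mentions the basis.\<close>

lemma eigenvalue_iff_closure_form:
  assumes "represented_by scale u B A"
  shows "eigenvalue (map_mat to_ac A) x \<longleftrightarrow>
    (\<exists>\<Lambda>. closure_form \<Lambda> \<and> \<Lambda> \<noteq> 0 \<and> (\<forall>v. \<Lambda> (u v) = x * \<Lambda> v))"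
proof -
  define n where "n = length B"
  have B: "distinct B" "independent (set B)" "span (set B) = UNIV"
    and A: "A \<in> carrier_mat n n"
    and uB: "\<And>j. j < n \<Longrightarrow> u (B ! j) = (\<Sum>i<n. scale (A $$ (i, j)) (B ! i))"
    using assms by (auto simp: represented_by_def ordered_basis_def n_def)
  let ?M = "map_mat to_ac A"
  have M: "?M \<in> carrier_mat n n" "?M\<^sup>T \<in> carrier_mat n n" using A by simp_all
  have "eigenvalue ?M x \<longleftrightarrow> eigenvalue ?M\<^sup>T x"
    using M by (simp add: eigenvalue_root_char_poly char_poly_transpose_mat)
  also have "\<dots> \<longleftrightarrow> (\<exists>l. (\<exists>j<n. l j \<noteq> 0) \<and> (\<forall>j<n. (\<Sum>i<n. to_ac (A $$ (i, j)) * l i) = x * l j))"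
  proof
    assume "eigenvalue ?M\<^sup>T x"
    then obtain w where w: "w \<in> carrier_vec n" "w \<noteq> 0\<^sub>v n" "?M\<^sup>T *\<^sub>v w = x \<cdot>\<^sub>v w"
      using A by (auto simp: eigenvalue_def eigenvector_def)
    have "\<exists>j<n. w $ j \<noteq> 0" using w(1,2) by (metis carrier_vecD eq_vecI index_zero_vec)
    moreover have "(\<Sum>i<n. to_ac (A $$ (i, j)) * w $ i) = x * w $ j" if "j < n" for j
    proof -
      have "(?M\<^sup>T *\<^sub>v w) $ j = x * w $ j" using w that by simp
      then show ?thesis using w(1) A that by (simp add: scalar_prod_def atLeast0LessThan)
    qed
    ultimately show "\<exists>l. (\<exists>j<n. l j \<noteq> 0) \<and> (\<forall>j<n. (\<Sum>i<n. to_ac (A $$ (i, j)) * l i) = x * l j)"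
      by blast
  next
    assume "\<exists>l. (\<exists>j<n. l j \<noteq> 0) \<and> (\<forall>j<n. (\<Sum>i<n. to_ac (A $$ (i, j)) * l i) = x * l j)"
    then obtain l k where l: "k < n" "l k \<noteq> 0"
      "\<And>j. j < n \<Longrightarrow> (\<Sum>i<n. to_ac (A $$ (i, j)) * l i) = x * l j" by blast
    have "vec n l \<noteq> 0\<^sub>v n" using l by (metis index_vec index_zero_vec(1))
    moreover have "?M\<^sup>T *\<^sub>v vec n l = x \<cdot>\<^sub>v vec n l"
      using A l(3) by (intro eq_vecI) (simp_all add: scalar_prod_def atLeast0LessThan)
    ultimately show "eigenvalue ?M\<^sup>T x"
      using A by (auto simp: eigenvalue_def eigenvector_def intro!: exI [of _ "vec n l"])
  qed
  also have "\<dots> \<longleftrightarrow> (\<exists>\<Lambda>. closure_form \<Lambda> \<and> \<Lambda> \<noteq> 0 \<and> (\<forall>v. \<Lambda> (u v) = x * \<Lambda> v))"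
  proof -
    define c where "c v i = representation (set B) v (B ! i)" for v i
    have c: "v = (\<Sum>i<n. scale (c v i) (B ! i))" for v
    proof -
      have "v = (\<Sum>b\<in>set B. scale (representation (set B) v b) b)"
        using sum_representation_eq [OF B(2), of v "set B"] B(3) by simp
      also have "\<dots> = (\<Sum>i<n. scale (c v i) (B ! i))"
        unfolding c_def n_def
        by (rule sum.reindex_bij_betw [OF bij_betw_nth [OF B(1) refl refl], symmetric])
      finally show ?thesis .
    qed
    show ?thesis
    proof
      assume "\<exists>l. (\<exists>j<n. l j \<noteq> 0) \<and> (\<forall>j<n. (\<Sum>i<n. to_ac (A $$ (i, j)) * l i) = x * l j)"
      then obtain l k where l: "k < n" "l k \<noteq> 0"
        "\<And>j. j < n \<Longrightarrow> (\<Sum>i<n. to_ac (A $$ (i, j)) * l i) = x * l j" by blast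
      define \<Lambda> where "\<Lambda> v = (\<Sum>i<n. to_ac (c v i) * l i)" for v
      have cf: "closure_form \<Lambda>"
        using B(3) by (auto simp: closure_form_def \<Lambda>_def c_def representation_add [OF B(2)]
            representation_scale [OF B(2)] algebra_simps sum.distrib sum_distrib_left)
      have \<Lambda>B: "\<Lambda> (B ! j) = l j" if "j < n" for j
      proof -
        have "c (B ! j) i = (if i = j then 1 else 0)" if "i < n" for i
          using that \<open>j < n\<close> B(1) representation_basis [OF B(2), of "B ! j"]
          by (auto simp: c_def n_def nth_eq_iff_index_eq)
        then have "\<Lambda> (B ! j) = (\<Sum>i<n. if i = j then l i else 0)"
          unfolding \<Lambda>_def by (intro sum.cong) auto
        then show ?thesis using that by simp
      qed
      have "\<Lambda> (u (B ! j)) = x * \<Lambda> (B ! j)" if "j < n" for j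
        using cf that l(3) by (simp add: uB closure_form_sum \<Lambda>B) (simp add: closure_form_def \<Lambda>B)
      then have "\<Lambda> (u (\<Sum>i<n. scale (c v i) (B ! i))) = x * \<Lambda> (\<Sum>i<n. scale (c v i) (B ! i))" for v
        using cf by (simp add: u.sum u.scale closure_form_sum sum_distrib_left)
          (simp add: closure_form_def mult.left_commute)
      then have "\<forall>v. \<Lambda> (u v) = x * \<Lambda> v" using c by metis
      moreover have "\<Lambda> \<noteq> 0" using \<Lambda>B [OF l(1)] l(2) by auto
      ultimately show "\<exists>\<Lambda>. closure_form \<Lambda> \<and> \<Lambda> \<noteq> 0 \<and> (\<forall>v. \<Lambda> (u v) = x * \<Lambda> v)" using cf by blast
    next
      assume "\<exists>\<Lambda>. closure_form \<Lambda> \<and> \<Lambda> \<noteq> 0 \<and> (\<forall>v. \<Lambda> (u v) = x * \<Lambda> v)"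
      then obtain \<Lambda> where L: "closure_form \<Lambda>" "\<Lambda> \<noteq> 0" "\<And>v. \<Lambda> (u v) = x * \<Lambda> v" by blast
      have "\<exists>j<n. \<Lambda> (B ! j) \<noteq> 0"
      proof (rule ccontr)
        assume "\<not> (\<exists>j<n. \<Lambda> (B ! j) \<noteq> 0)"
        then have "\<Lambda> (\<Sum>i<n. scale (c v i) (B ! i)) = 0" for v
          using L(1) by (simp add: closure_form_sum) (simp add: closure_form_def)
        then have "\<Lambda> v = 0" for v using c by metis
        then show False using L(2) by (simp add: fun_eq_iff)
      qed
      moreover have "(\<Sum>i<n. to_ac (A $$ (i, j)) * \<Lambda> (B ! i)) = x * \<Lambda> (B ! j)" if "j < n" for j
      proof -
        have "x * \<Lambda> (B ! j) = \<Lambda> (u (B ! j))" by (simp add: L(3))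
        also have "\<dots> = (\<Sum>i<n. to_ac (A $$ (i, j)) * \<Lambda> (B ! i))"
          using that L(1) by (simp add: uB closure_form_sum) (simp add: closure_form_def)
        finally show ?thesis by simp
      qed
      ultimately show "\<exists>l. (\<exists>j<n. l j \<noteq> 0) \<and> (\<forall>j<n. (\<Sum>i<n. to_ac (A $$ (i, j)) * l i) = x * l j)"
        by (intro exI [of _ "\<lambda>i. \<Lambda> (B ! i)"]) auto
    qed
  qed
  finally show ?thesis .
qed

lemma exists_representation: "\<exists>B A. represented_by scale u B A"
proof -
  obtain n :: nat and f v where D: "decomp UNIV {..<n} f v"
    using rational_canonical_form [OF subspace_UNIV UNIV_I] by metis
  have "decomp UNIV {..<length (map f [0..<n])} (\<lambda>i. map f [0..<n] ! i) v"
    using D by (simp add: decomp_def)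
  moreover have "monic g" if "g \<in> set (map f [0..<n])" for g
    using that D by (auto simp: decomp_def)
  ultimately show ?thesis using represented_by_companions_iff [of "map f [0..<n]"] by blast
qed

lemma closure_eigenvalues_iff:
  "x \<in> closure_eigenvalues scale u \<longleftrightarrow>
    (\<exists>\<Lambda>. closure_form \<Lambda> \<and> \<Lambda> \<noteq> 0 \<and> (\<forall>v. \<Lambda> (u v) = x * \<Lambda> v))"
    (is "_ \<longleftrightarrow> ?R")
proof
  assume "x \<in> closure_eigenvalues scale u"
  then obtain B A where "represented_by scale u B A" "eigenvalue (map_mat to_ac A) x"
    by (auto simp: closure_eigenvalues_def)
  then show ?R by (simp only: eigenvalue_iff_closure_form)
next
  assume R: ?R
  obtain B A where BA: "represented_by scale u B A" using exists_representation by blast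
  then have "eigenvalue (map_mat to_ac A) x" using R by (simp only: eigenvalue_iff_closure_form)
  then show "x \<in> closure_eigenvalues scale u" using BA by (auto simp: closure_eigenvalues_def)
qed

lemma closure_eigenvalue_root:
  assumes "x \<in> closure_eigenvalues scale u" "\<And>v. act m v = 0"
  shows "poly (map_poly to_ac m) x = 0"
proof -
  obtain \<Lambda> where L: "closure_form \<Lambda>" "\<Lambda> \<noteq> 0" "\<And>v. \<Lambda> (u v) = x * \<Lambda> v"
    using assms(1) closure_eigenvalues_iff by blast
  have "poly (map_poly to_ac m) x * \<Lambda> v = 0" for v
    using form_act_eigen [where \<Lambda> = \<Lambda> and x = x, OF L(3), of "map_poly to_ac m" v] form_act_map_poly [OF L(1), of m v]
      assms(2) closure_form_0 [OF L(1)] by simp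
  then show ?thesis using L(2) by (auto simp: fun_eq_iff)
qed

text \<open>A nonzero kernel makes \<open>act f\<close> non-surjective, so some nonzero linear form
  vanishes on its image. Under the transposed action \<open>f\<close> kills this form, and the
  eigenform derived from it belongs to a root of \<open>f\<close>.\<close>

lemma exists_closure_eigenvalue:
  assumes "f \<noteq> 0" "act f v = 0" "v \<noteq> 0"
  obtains x where "x \<in> closure_eigenvalues scale u" "poly (map_poly to_ac f) x = 0"
proof -
  have "\<not> inj (act f)" using assms(2,3) act.zero by (metis injD)
  then have "\<not> surj (act f)" using linear_surj_imp_inj [OF act_linear] by blast
  then obtain y where y: "y \<notin> range (act f)" by blast
  have sub: "subspace (range (act f))" using act.subspace_image [OF subspace_UNIV] by simp
  obtain C where C: "C \<subseteq> range (act f)" "independent C" "range (act f) \<subseteq> span C"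
    using maximal_independent_subset by blast
  have "span C \<subseteq> range (act f)" using C(1) sub by (rule span_minimal)
  then have ind: "independent (insert y C)" and yC: "y \<notin> C"
    using y C independent_insertI by blast+
  interpret pair: vector_space_pair scale "(*) :: 'a \<Rightarrow> 'a \<Rightarrow> 'a"
    by unfold_locales (auto simp: algebra_simps)
  obtain \<phi> where phi: "Vector_Spaces.linear scale (*) \<phi>"
    and phiB: "\<And>z. z \<in> insert y C \<Longrightarrow> \<phi> z = (if z = y then 1 else 0)"
    using pair.linear_independent_extend [OF ind, of "\<lambda>z. if z = y then 1 else 0"] by blast
  interpret phi: Vector_Spaces.linear scale "(*)" \<phi> by (rule phi)
  have "\<phi> z = 0" if "z \<in> span C" for z
    using that phiB yC phi.eq_0_on_span [of C z] by fastforce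
  then have phi0: "\<phi> (act f w) = 0" for w using C(3) by blast
  let ?L = "\<lambda>w. to_ac (\<phi> w)"
  have L: "closure_form ?L" by (simp add: closure_form_def phi.add phi.scale)
  moreover have "?L \<noteq> 0" using phiB [of y] by (auto simp: fun_eq_iff intro!: exI [of _ y])
  moreover have "map_poly to_ac f \<noteq> 0" using assms(1) by (simp add: map_poly_eq_0_iff)
  moreover have "poly_endo (\<lambda>c \<Lambda> v. c * \<Lambda> v) (map_poly to_ac f) (\<lambda>\<Lambda> v. \<Lambda> (u v)) ?L = 0"
    using form_act_map_poly [OF L, of f] phi0 by (simp add: fun_eq_iff)
  ultimately obtain x \<Lambda>' where "poly (map_poly to_ac f) x = 0" "closure_form \<Lambda>'" "\<Lambda>' \<noteq> 0"
    "\<And>v. \<Lambda>' (u v) = x * \<Lambda>' v" by (rule exists_closure_eigenform) blast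
  then show thesis using that closure_eigenvalues_iff by blast
qed

end

subsection \<open>The relation between \<open>u\<close> and \<open>a\<close>\<close>

lemma quadratic_irreducible:
  fixes b c :: "'a::field"
  assumes "\<And>x. x\<^sup>2 + b * x + c \<noteq> 0"
  shows "irreducible [:c, b, 1:]"
proof (rule irreducibleI)
  show "[:c, b, 1:] \<noteq> 0" by simp
  then show "\<not> is_unit [:c, b, 1:]" by (simp add: is_unit_iff_degree)
next
  fix f g assume fg: "[:c, b, 1:] = f * g"
  have nz: "f \<noteq> 0" "g \<noteq> 0" using fg by auto
  have noroot: "degree h \<noteq> 1" if "h dvd [:c, b, 1:]" for h
  proof
    assume "degree h = 1"
    then obtain k l where h: "h = [:k, l:]" "l \<noteq> 0" using degree1_coeffs by blast
    have "poly h (- k / l) = 0" using h by simp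
    then have "poly [:c, b, 1:] (- k / l) = 0" using that by (metis poly_eq_0_iff_dvd dvd_trans)
    then show False using assms [of "- k / l"] by (simp add: power2_eq_square algebra_simps)
  qed
  have "degree f \<noteq> 1" "degree g \<noteq> 1" using noroot fg by auto
  moreover have "degree f + degree g = degree [:c, b, 1:]"
    using degree_mult_eq [OF nz] fg by simp
  ultimately have "degree f = 0 \<or> degree g = 0" by simp arith
  then show "is_unit f \<or> is_unit g" using nz by (simp add: is_unit_iff_degree)
qed

section \<open>Concavity and parity of kernel dimensions\<close>

context finite_dimensional_vector_space
begin

text \<open>The jump from \<open>k\<close> to \<open>k + 1\<close> is the dimension of the
  intersection of the kernel of \<open>c\<close> with the range of \<open>c ^^ k\<close>, and these
  ranges decrease.\<close>

lemma dim_ker_powers_concave: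
  assumes c: "Vector_Spaces.linear scale scale c"
  shows "dim {x. (c ^^ (k + 2)) x = 0} + dim {x. (c ^^ k) x = 0} \<le> 2 * dim {x. (c ^^ (k + 1)) x = 0}"
proof -
  interpret E: fd_endo scale c Basis
    by (intro fd_endo.intro endo.intro endo_axioms.intro c vector_space_axioms
        finite_dimensional_vector_space_axioms)
  have pow: "Vector_Spaces.linear scale scale (c ^^ k)" for k
    using E.act_linear [of "monom 1 k"] by (simp add: E.act_monom [abs_def])
  have 1: "dim {x. (c ^^ k) x = 0} + dim (range (c ^^ k)) = dim UNIV" for k
    using dim_kernel_image [OF pow, of UNIV k] by simp
  have 2: "dim {x \<in> range (c ^^ k). c x = 0} + dim (range (c ^^ (k + 1))) = dim (range (c ^^ k))" for k
  proof -
    interpret P: Vector_Spaces.linear scale scale "c ^^ k" by (rule pow)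
    have "range (c ^^ (k + 1)) = c ` range (c ^^ k)" by (simp add: image_comp)
    then show ?thesis using dim_kernel_image [OF c P.subspace_image [OF subspace_UNIV]] by simp
  qed
  have "range (c ^^ (k + 1)) \<subseteq> range (c ^^ k)"
    by (auto simp: funpow_swap1)
  then have "{x \<in> range (c ^^ (k + 1)). c x = 0} \<subseteq> {x \<in> range (c ^^ k). c x = 0}" by blast
  then have "dim {x \<in> range (c ^^ (k + 1)). c x = 0} \<le> dim {x \<in> range (c ^^ k). c x = 0}"
    by (rule dim_subset)
  then show ?thesis
    using 1 [of k] 1 [of "k + 1"] 1 [of "k + 2"] 2 [of k] 2 [of "k + 1"]
    by (simp only: add.assoc one_add_one)
qed

end

context fd_endo
begin

text \<open>The invariant factors of \<open>W\<close> divide \<open>f ^ k\<close>, hence are powers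
  of \<open>f\<close> and have even degree.\<close>

lemma even_dim_primary:
  assumes W: "subspace W" "\<And>x. x \<in> W \<Longrightarrow> u x \<in> W"
    and f: "irreducible f" "monic f" "even (degree f)" and 0: "\<And>w. w \<in> W \<Longrightarrow> act (f ^ k) w = 0"
  shows "even (dim W)"
proof -
  obtain n :: nat and g v where D: "decomp W {..<n} g v"
    and dvd: "\<forall>e. (\<forall>w\<in>W. act e w = 0) \<longrightarrow> (\<forall>i<n. g i dvd e)"
    using rational_canonical_form [OF W] by metis
  \<comment> \<open>\<open>[:0, 1:]\<close> acts as a second prime with exponent 0, to fit the
    two-prime form of \<open>monic_dvd_powers\<close>; the even degree keeps \<open>f\<close> from
    dividing it.\<close>
  have nd: "\<not> f dvd [:0, 1:]"
  proof
    assume "f dvd [:0, 1:]"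
    then have "degree f \<le> 1" using dvd_imp_degree_le [of f "[:0, 1:]"] by simp
    then show False using irreducible_poly_degree_pos [OF f(1)] f(3) by (cases "degree f") auto
  qed
  have "even (degree (g i))" if "i < n" for i
  proof -
    have "g i dvd f ^ k * [:0, 1:] ^ 0" using dvd 0 that by simp
    moreover have "monic (g i)" using D that by (simp add: decomp_def)
    ultimately obtain m l where "g i = f ^ m * [:0, 1:] ^ l" "l \<le> 0"
      using monic_dvd_powers [OF f(1) irreducible_linear_field_poly [OF one_neq_zero] f(2) _ _ irreducible_comaximal [OF f(1) nd]]
      by (metis lead_coeff_pCons(1) lead_coeff_1 one_neq_zero one_pCons pCons_eq_0_iff)
    then have "degree (g i) = m * degree f" using f(2) degree_power_eq [of f m] by fastforce
    then show ?thesis using f(3) by simp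
  qed
  then have "even (\<Sum>i<n. degree (g i))" by (intro dvd_sum) simp
  then show ?thesis using D by (simp add: decomp_def)
qed

end

text \<open>With \<open>tr q = \<tau> / d\<close> and \<open>q(0) = N / d\<^sup>2\<close>, the
  coefficients of \<open>r\<close> in the theorem become
  \<open>\<kappa> = d (\<tau>\<^sup>2 - 2 N) / N\<close> and \<open>d\<^sup>2\<close>; the
  assumption on \<open>\<kappa>\<close> is this equation cleared of its denominator. Irreducibility
  of \<open>p\<close> is expressed by the absence of roots.\<close>

locale quadratic_data =
  fixes \<tau> N d \<kappa> :: "'a::field"
  assumes d: "d \<noteq> 0" and \<tau>: "\<tau> \<noteq> 0" and noroot: "x\<^sup>2 - \<tau> * x + N \<noteq> 0"
    and \<kappa>: "N * \<kappa> = d * (\<tau>\<^sup>2 - 2 * N)"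
begin

abbreviation p :: "'a poly" where "p \<equiv> [:N, - \<tau>, 1:]"
abbreviation e :: "'a poly" where "e \<equiv> [:- d, 1:]"
abbreviation r :: "'a poly" where "r \<equiv> [:d\<^sup>2, - \<kappa>, 1:]"

lemma N: "N \<noteq> 0"
  using noroot [of 0] by simp

lemma irreducible_p: "irreducible p"
  by (rule quadratic_irreducible) (use noroot in simp)

text \<open>A root \<open>z\<close> of \<open>r\<close> would yield the root \<open>\<tau> d / (z + d)\<close> of \<open>p\<close>.\<close>

lemma irreducible_r: "irreducible r"
proof (rule quadratic_irreducible)
  fix z :: 'a
  show "z\<^sup>2 + - \<kappa> * z + d\<^sup>2 \<noteq> 0"
  proof
    assume "z\<^sup>2 + - \<kappa> * z + d\<^sup>2 = 0"
    then have "N * (z\<^sup>2 + - \<kappa> * z + d\<^sup>2) = 0" by simp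
    then have "N * z\<^sup>2 - (N * \<kappa>) * z + N * d\<^sup>2 = 0" by (simp add: algebra_simps)
    moreover have "N * (z + d)\<^sup>2 - d * \<tau>\<^sup>2 * z = N * z\<^sup>2 - (N * \<kappa>) * z + N * d\<^sup>2"
      unfolding \<kappa> by (simp add: power2_eq_square algebra_simps)
    ultimately have *: "N * (z + d)\<^sup>2 = d * \<tau>\<^sup>2 * z" by simp
    \<comment> \<open>At \<open>z = - d\<close> the equation would read
      \<open>0 = - d\<^sup>2 \<tau>\<^sup>2\<close>; here the nonzero trace of \<open>p\<close>
      enters.\<close>
    have nz: "z + d \<noteq> 0"
    proof
      assume "z + d = 0"
      then have "z = - d" by (simp add: eq_neg_iff_add_eq_0)
      then show False using * d \<tau> by simp
    qed
    define s where "s = \<tau> * d / (z + d)"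
    have s: "s * (z + d) = \<tau> * d" using nz by (simp add: s_def)
    have "(s\<^sup>2 - \<tau> * s + N) * (z + d)\<^sup>2 = (s * (z + d))\<^sup>2 - \<tau> * (s * (z + d)) * (z + d) + N * (z + d)\<^sup>2"
      by (simp add: power2_eq_square algebra_simps)
    also have "\<dots> = 0" unfolding s * by (simp add: power2_eq_square algebra_simps)
    finally show False using nz noroot by simp
  qed
qed

lemma irreducible_e: "irreducible e"
  by (rule irreducible_linear_field_poly [OF one_neq_zero])

text \<open>Stated for any \<open>c\<close> to cover both \<open>t - d\<close>, for the primary
  splitting, and \<open>t + d\<close>, for dividing by \<open>u + d\<close>.\<close>

lemma comaximal_linear_r: "comaximal [:c, 1:] r"
proof (rule comaximal_commute, rule irreducible_comaximal [OF irreducible_r])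
  show "\<not> r dvd [:c, 1:]"
    using dvd_imp_degree_le [of r "[:c, 1:]"] by auto
qed

lemmas comaximal_e_r = comaximal_linear_r [of "- d"]

end

text \<open>Asks for the affine relation only: the construction first produces such an
  \<open>a\<close> and then proves \<open>p(a) = 0\<close>, which \<open>quadratic_quotient\<close>
  adds.\<close>

locale twisted = fd_endo scale u Basis + quadratic_data \<tau> N d \<kappa>
  for scale :: "'a::field \<Rightarrow> 'v::ab_group_add \<Rightarrow> 'v" and u Basis and \<tau> N d \<kappa> :: 'a +
  fixes a :: "'v \<Rightarrow> 'v"
  assumes a_lin: "Vector_Spaces.linear scale scale a"
    and inj: "u x = 0 \<Longrightarrow> x = 0"
    and rel: "u (a (u x)) = scale (d\<^sup>2) (a x) - scale \<tau> (u (scale d x - u x))"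
begin

sublocale a: fd_endo scale a Basis
  by (intro fd_endo.intro endo.intro endo_axioms.intro a_lin vector_space_axioms
      finite_dimensional_vector_space_axioms)

text \<open>The defect of \<open>a\<close> from being a root of \<open>p\<close>, and the operator that conjugates \<open>u\<close> to \<open>d\<^sup>2 u\<^sup>-\<^sup>1\<close>.\<close>

definition E :: "'v \<Rightarrow> 'v" where "E x = a (a x) - scale \<tau> (a x) + scale N x"
definition c :: "'v \<Rightarrow> 'v" where "c x = scale d (a x) + u (a x) - scale \<tau> (u x)"

lemmas lin_simps = u.add u.diff u.scale u.neg a.u.add a.u.diff a.u.scale a.u.neg
  scale_right_distrib scale_right_diff_distrib scale_minus_right

lemma E_linear: "Vector_Spaces.linear scale scale E"
  by (simp add: Vector_Spaces.linear_iff vector_space_axioms E_def lin_simps mult.commute)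

lemma c_linear: "Vector_Spaces.linear scale scale c"
  by (simp add: Vector_Spaces.linear_iff vector_space_axioms c_def lin_simps mult.commute)

sublocale E: Vector_Spaces.linear scale scale E by (rule E_linear)
sublocale c: Vector_Spaces.linear scale scale c by (rule c_linear)

lemma u_inj: "u x = u y \<longleftrightarrow> x = y"
  using inj [of "x - y"] by (auto simp: u.diff)

lemma ucu: "u (c (u x)) = scale (d\<^sup>2) (c x)"
  by (simp add: c_def lin_simps rel power2_eq_square algebra_simps)

lemma ucc_aux: "u (c (c x)) =
    scale d (act [:d, 1:] (act [:d, 1:] (a (a x) - scale \<tau> (a x)))) + scale (\<tau>\<^sup>2 * d\<^sup>2) (u x)"
  by (simp add: c_def lin_simps rel power2_eq_square algebra_simps)

text \<open>Rests on \<open>N r = N (t + d)\<^sup>2 - d \<tau>\<^sup>2 t\<close>. Keeping the defect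
  \<open>E\<close> lets the formula serve twice: for \<open>E = 0\<close> it is
  \<open>u c\<^sup>2 = - d N r(u)\<close>, and in the construction, where \<open>c\<^sup>2\<close>
  is known on a generator, it gives an equation for the defect.\<close>

lemma ucc: "u (c (c x)) = scale d (act [:d, 1:] (act [:d, 1:] (E x))) - scale (d * N) (act r x)"
proof -
  have "d * N * \<kappa> = d * (N * \<kappa>)" by simp
  then have "d * N * \<kappa> = d * d * \<tau> * \<tau> - d * N * d - d * N * d"
    unfolding \<kappa> by (simp add: power2_eq_square algebra_simps)
  then have "smult (d * N) r = smult (d * N) ([:d, 1:] * [:d, 1:]) - [:0, \<tau>\<^sup>2 * d\<^sup>2:]"
    by (simp add: power2_eq_square algebra_simps)
  then have "act (smult (d * N) r) x = act (smult (d * N) ([:d, 1:] * [:d, 1:]) - [:0, \<tau>\<^sup>2 * d\<^sup>2:]) x"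
    by (rule arg_cong)
  then have "scale (d * N) (act r x) =
      scale d (scale N (act [:d, 1:] (act [:d, 1:] x))) - scale (\<tau>\<^sup>2 * d\<^sup>2) (u x)"
    by (simp only: act_diff act_smult act_mult scale_scale) (simp add: u.scale)
  moreover have "act [:d, 1:] (act [:d, 1:] (E x)) =
      act [:d, 1:] (act [:d, 1:] (a (a x) - scale \<tau> (a x))) + scale N (act [:d, 1:] (act [:d, 1:] x))"
    by (simp only: E_def act.add act.scale)
  ultimately show ?thesis
    unfolding ucc_aux by (simp only: scale_right_distrib) (simp add: algebra_simps)
qed

text \<open>The vector \<open>u (a (u (a (u x))))\<close> can be expanded by applying the relation
  to its inner or to its outer three operators; comparing the results gives the claim up to the
  factor \<open>d\<^sup>2\<close>. So the defect commutes with \<open>u\<close> although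
  \<open>a\<close> does not, and its vanishing can be checked on generators.\<close>

lemma E_u: "E (u x) = u (E x)"
proof -
  define y where "y = a (u x)"
  have uy: "u y = scale (d\<^sup>2) (a x) - scale \<tau> (u (scale d x - u x))" by (simp add: y_def rel)
  have "a (u y) = scale (d\<^sup>2) (a (a x)) - scale \<tau> (a (u (scale d x - u x)))"
    unfolding uy by (simp add: lin_simps)
  then have "scale (d\<^sup>2) (u (a (a x))) = u (a (u y)) + scale \<tau> (u (a (u (scale d x - u x))))"
    by (simp add: lin_simps)
  also have "\<dots> = scale (d\<^sup>2) (a y) - scale \<tau> (u (scale d y - u y))
      + scale \<tau> (scale (d\<^sup>2) (a (scale d x - u x)) - scale \<tau> (u (scale d (scale d x - u x) - u (scale d x - u x))))"
    by (simp only: rel)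
  finally have "scale (d\<^sup>2) (a y) = scale (d\<^sup>2) (u (a (a x)) - scale \<tau> (u (a x)) + scale \<tau> (a (u x)))"
    by (simp add: lin_simps uy y_def [symmetric] power2_eq_square algebra_simps)
  then have "a (a (u x)) = u (a (a x)) - scale \<tau> (u (a x)) + scale \<tau> (a (u x))"
    using d by (simp add: y_def)
  then show ?thesis by (simp add: E_def lin_simps)
qed

lemma E_a: "E (a x) = a (E x)"
  by (simp add: E_def lin_simps)

lemma E_act: "E (act g x) = act g (E x)"
  by (induction g) (simp_all add: E.zero E.add E.scale E_u)

lemma E_c: "E (c x) = c (E x)"
  by (simp add: c_def E.add E.diff E.scale E_u E_a)

text \<open>By \<open>ucu\<close>, the operators \<open>c u\<close> and
  \<open>u\<^sup>-\<^sup>1 c\<close> agree up to the unit \<open>d\<^sup>2\<close>.\<close>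

lemma ker_c_pow_u: "(c ^^ k) (u x) = 0 \<longleftrightarrow> (c ^^ k) x = 0"
proof (induction k arbitrary: x)
  case 0
  then show ?case using u_inj [of x 0] by simp
next
  case (Suc k)
  have pow: "(c ^^ k) (scale b y) = scale b ((c ^^ k) y)" for b y
    by (induction k) (simp_all add: c.scale)
  have "(c ^^ Suc k) (u x) = 0 \<longleftrightarrow> (c ^^ k) (u (c (u x))) = 0"
    using Suc.IH by (simp add: funpow_swap1)
  also have "\<dots> \<longleftrightarrow> (c ^^ Suc k) x = 0"
    using d by (simp add: ucu pow funpow_swap1)
  finally show ?case .
qed

end

locale quadratic_quotient = twisted +
  assumes E0: "E x = 0"
begin

text \<open>With \<open>y = (u - d) x\<close> the relation becomes
  \<open>d (u - d) a x = u (\<tau> y - a y)\<close>, and \<open>y\<close> lies in the kernel of the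
  next lower power.\<close>

lemma ker_u_minus_d_a: "act (e ^ k) x = 0 \<Longrightarrow> act (e ^ k) (a x) = 0"
proof (induction k arbitrary: x)
  case (Suc k)
  define y where "y = act e x"
  have y: "act (e ^ k) y = 0"
    using Suc.prems by (simp only: power_Suc2 act_mult y_def)
  have ux: "u x = scale d x + y" by (simp add: y_def)
  have "u (a (scale d x + y)) = scale (d\<^sup>2) (a x) + scale \<tau> (u y)"
    using rel [of x] unfolding ux by (simp add: lin_simps)
  then have "scale d (act e (a x)) = act [:0, 1:] (scale \<tau> y - a y)"
    by (simp add: lin_simps power2_eq_square algebra_simps)
  then have "scale d (act (e ^ k) (act e (a x))) = act (e ^ k) (act [:0, 1:] (scale \<tau> y - a y))"
    by (metis act.scale)
  also have "\<dots> = act [:0, 1:] (act (e ^ k) (scale \<tau> y - a y))" by (rule act_commute)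
  also have "\<dots> = 0" using y Suc.IH [OF y] by (simp add: act.diff act.scale)
  finally have "act (e ^ k) (act e (a x)) = 0" using d by simp
  then show ?case by (simp only: power_Suc2 act_mult)
qed simp

text \<open>The operator \<open>a\<close> turns this kernel into a vector space over the quadratic
  extension defined by \<open>p\<close>; accordingly \<open>even_dim_primary\<close> is applied to
  \<open>a\<close> in place of \<open>u\<close>, with exponent 1.\<close>

lemma even_dim_ker_e: "even (dim {x. act (e ^ k) x = 0})"
proof (rule a.even_dim_primary [OF _ _ irreducible_p])
  show "subspace {x. act (e ^ k) x = 0}"
    by (simp add: subspace_def act.add act.scale)
  show "a.act (p ^ 1) w = 0" for w
    using E0 [of w] by (simp add: E_def lin_simps algebra_simps)
qed (use ker_u_minus_d_a in auto)

text \<open>\<open>c\<^sup>2\<close> and \<open>r(u)\<close> have the same kernel because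
  \<open>u\<close>, \<open>d\<close> and \<open>N\<close> are invertible; as \<open>r(u)\<close>
  commutes with \<open>u\<close>, this passes to powers.\<close>

lemma ker_c_pow: "(c ^^ (2 * k)) x = 0 \<longleftrightarrow> act (r ^ k) x = 0"
proof (induction k arbitrary: x)
  case (Suc k)
  have "(c ^^ (2 * Suc k)) x = (c ^^ (2 * k)) (c (c x))" by (simp add: funpow_swap1)
  then have "(c ^^ (2 * Suc k)) x = 0 \<longleftrightarrow> act (r ^ k) (c (c x)) = 0" using Suc.IH by simp
  also have "\<dots> \<longleftrightarrow> act (r ^ k) (u (c (c x))) = 0"
    using u_inj [of "act (r ^ k) (c (c x))" 0] by (simp add: act_u)
  also have "\<dots> \<longleftrightarrow> act (r ^ k) (act r x) = 0"
    using d N by (simp only: ucc E0 act.zero scale_zero_right diff_0 act.neg act.diff act.scale) simp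
  finally show ?case by (simp only: power_Suc2 act_mult)
qed simp

lemma even_dim_ker_c: "even (dim {x. (c ^^ k) x = 0})"
proof (rule even_dim_primary [OF _ _ irreducible_r])
  have add: "(c ^^ k) (x + y) = (c ^^ k) x + (c ^^ k) y"
    and scale: "(c ^^ k) (scale b x) = scale b ((c ^^ k) x)" for b x y
    by (induction k) (simp_all add: c.add c.scale)
  then show "subspace {x. (c ^^ k) x = 0}"
    using scale [of 0 0] by (simp add: subspace_def)
  fix w assume "w \<in> {x. (c ^^ k) x = 0}"
  moreover have "(c ^^ k) 0 = 0" using scale [of 0 0] by simp
  \<comment> \<open>Doubling the exponent reaches an even power of \<open>c\<close>, where
    \<open>ker_c_pow\<close> shows that \<open>r ^ k\<close> kills \<open>w\<close>.\<close>
  moreover have "(c ^^ (2 * k)) w = (c ^^ k) ((c ^^ k) w)" by (simp add: mult_2 funpow_add)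
  ultimately have "(c ^^ (2 * k)) w = 0" by simp
  then show "act (r ^ k) w = 0" by (simp only: ker_c_pow)
qed (simp_all add: ker_c_pow_u)

text \<open>If the jumps of \<open>dim (ker c\<^sup>k)\<close> from \<open>2j\<close> to \<open>2j + 4\<close> have equal sums in pairs, then all four
  are equal, since jumps decrease.\<close>

lemma four_dvd_dim_ker_r:
  assumes "dim {x. act (r ^ (j + 2)) x = 0} + dim {x. act (r ^ j) x = 0} = 2 * dim {x. act (r ^ (j + 1)) x = 0}"
  shows "4 dvd dim {x. act (r ^ (j + 1)) x = 0} - dim {x. act (r ^ j) x = 0}"
proof -
  define D where "D k = dim {x. (c ^^ k) x = 0}" for k
  have r: "dim {x. act (r ^ k) x = 0} = D (2 * k)" for k by (simp add: D_def ker_c_pow)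
  have conc: "D (k + 2) + D k \<le> 2 * D (k + 1)" for k
    unfolding D_def by (rule dim_ker_powers_concave [OF c_linear])
  have ev: "even (D k)" for k unfolding D_def by (rule even_dim_ker_c)
  have mono: "D k \<le> D (k + 1)" for k
    unfolding D_def by (rule dim_subset) (auto simp: c.zero)
  have "D (2 * j + 2 + 2) + D (2 * j) = 2 * D (2 * j + 2)"
    using assms unfolding r by (simp add: algebra_simps)
  then have eq: "D (2 * j + 1) + D (2 * j + 1) = D (2 * j) + D (2 * j + 2)"
    using conc [of "2 * j"] conc [of "2 * j + 1"] conc [of "2 * j + 2"] by simp
  obtain x y where "D (2 * j) = 2 * x" "D (2 * j + 1) = 2 * y" using ev by (metis evenE)
  then have "D (2 * j + 2) - D (2 * j) = 4 * (y - x)" using eq mono [of "2 * j"] by simp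
  then show ?thesis unfolding r by simp
qed

end

subsection \<open>Pairing of the invariant factors\<close>

text \<open>For exponents \<open>m i\<close> of a prime, these sums are the kernel dimensions of its
  powers divided by its degree; the jumps form the partition conjugate to \<open>m\<close>.\<close>

lemma sum_min_Suc:
  fixes m :: "nat \<Rightarrow> nat"
  shows "(\<Sum>i<n. min (m i) (Suc j)) = (\<Sum>i<n. min (m i) j) + card {i. i < n \<and> j < m i}"
proof -
  have "(\<Sum>i<n. min (m i) (Suc j)) = (\<Sum>i<n. min (m i) j + (if j < m i then 1 else 0))"
    by (intro sum.cong) (auto simp: min_def)
  also have "\<dots> = (\<Sum>i<n. min (m i) j) + (\<Sum>i<n. if j < m i then 1 else 0)"
    by (rule sum.distrib)
  also have "(\<Sum>i<n. if j < m i then 1 else 0) = card {i. i < n \<and> j < m i}"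
    by (simp add: sum.If_cases Int_def conj_commute)
  finally show ?thesis .
qed

text \<open>The sequence drops to at most \<open>j\<close> right after index \<open>i\<close>. As
  indices start at 0, a drop after an even index gives an odd count.\<close>

lemma card_above:
  fixes m :: "nat \<Rightarrow> nat"
  assumes "antimono m" "\<And>i. i \<ge> n \<Longrightarrow> m i = 0" "m (Suc i) \<le> j" "j < m i"
  shows "card {i. i < n \<and> j < m i} = Suc i"
proof -
  have "i' < n \<and> j < m i' \<longleftrightarrow> i' \<le> i" for i'
  proof
    assume *: "i' < n \<and> j < m i'"
    show "i' \<le> i"
    proof (rule ccontr)
      assume "\<not> i' \<le> i"
      then have "m i' \<le> m (Suc i)" using antimonoD [OF assms(1)] by simp
      then show False using * assms(3) by simp
    qed
  next
    assume "i' \<le> i"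
    then have "m i \<le> m i'" using antimonoD [OF assms(1)] by simp
    then have "j < m i'" using assms(4) by simp
    moreover from this have "i' < n" using assms(2) [of i'] by (cases "i' < n") auto
    ultimately show "i' < n \<and> j < m i'" by simp
  qed
  then have "{i. i < n \<and> j < m i} = {..i}" by auto
  then show ?thesis by simp
qed

text \<open>A drop after an even index would be an odd jump in a sequence of even sums.\<close>

lemma antimono_pairs_eq:
  fixes m :: "nat \<Rightarrow> nat"
  assumes m: "antimono m" "\<And>i. i \<ge> n \<Longrightarrow> m i = 0"
    and ev: "\<And>j. even (\<Sum>i<n. min (m i) j)"
  shows "m (2 * k) = m (2 * k + 1)"
proof (rule ccontr)
  assume "m (2 * k) \<noteq> m (2 * k + 1)"
  moreover have "m (2 * k + 1) \<le> m (2 * k)" using antimonoD [OF m(1)] by simp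
  ultimately have "card {i. i < n \<and> m (2 * k + 1) < m i} = Suc (2 * k)"
    using m by (intro card_above) auto
  then show False
    using ev [of "m (2 * k + 1)"] ev [of "Suc (m (2 * k + 1))"] unfolding sum_min_Suc by simp
qed

text \<open>A drop of at least 2 after an even index would give two consecutive equal odd jumps,
  while \<open>ev\<close> says that equal consecutive jumps are even.\<close>

lemma antimono_pairs_near:
  fixes m :: "nat \<Rightarrow> nat"
  assumes m: "antimono m" "\<And>i. i \<ge> n \<Longrightarrow> m i = 0"
    and ev: "\<And>j. (\<Sum>i<n. min (m i) (j + 2)) + (\<Sum>i<n. min (m i) j) = 2 * (\<Sum>i<n. min (m i) (j + 1)) \<Longrightarrow>
      even ((\<Sum>i<n. min (m i) (j + 1)) - (\<Sum>i<n. min (m i) j))"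
  shows "m (2 * k) = m (2 * k + 1) \<or> m (2 * k) = Suc (m (2 * k + 1))"
proof (rule ccontr)
  assume neg: "\<not> ?thesis"
  have "m (2 * k + 1) \<le> m (2 * k)" using antimonoD [OF m(1)] by simp
  then have gt: "Suc (m (2 * k + 1)) < m (2 * k)" using neg by linarith
  define j where "j = m (2 * k + 1)"
  have "card {i. i < n \<and> j < m i} = Suc (2 * k)" "card {i. i < n \<and> Suc j < m i} = Suc (2 * k)"
    using m gt by (auto simp: j_def intro!: card_above)
  then show False using ev [of j] by (simp add: sum_min_Suc)
qed

context fd_endo
begin

text \<open>The gcd of \<open>f i\<close> and \<open>g ^ j\<close> is
  \<open>g ^ min (m i) j\<close>; it is put in the Bezout form that \<open>dim_ker_act\<close>
  expects.\<close>

lemma dim_ker_power: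
  assumes D: "decomp UNIV {..<n::nat} f v" and g: "monic g" "comaximal g h"
    and f: "\<And>i. i < n \<Longrightarrow> f i = g ^ m i * h ^ k i"
  shows "dim {x. act (g ^ j) x = 0} = degree g * (\<Sum>i<n. min (m i) j)"
proof -
  have "dim {x. act (g ^ j) x = 0} = (\<Sum>i<n. degree (g ^ min (m i) j))"
  proof (rule dim_ker_act [OF D])
    fix i assume "i \<in> {..<n}"
    then have fi: "f i = g ^ m i * h ^ k i" using f by simp
    let ?l = "min (m i) j"
    have "comaximal (g ^ (m i - ?l) * h ^ k i) (g ^ (j - ?l))"
    proof (cases "m i \<le> j")
      case True
      then show ?thesis using g(2) by (simp add: comaximal_commute comaximal_powers)
    next
      case False
      then show ?thesis by simp
    qed
    then obtain x y where "x * (g ^ (m i - ?l) * h ^ k i) + y * g ^ (j - ?l) = 1"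
      unfolding comaximal_def by blast
    then have "g ^ ?l = g ^ ?l * (x * (g ^ (m i - ?l) * h ^ k i) + y * g ^ (j - ?l))" by simp
    also have "\<dots> = x * ((g ^ ?l * g ^ (m i - ?l)) * h ^ k i) + y * (g ^ ?l * g ^ (j - ?l))"
      by (simp add: algebra_simps)
    also have "\<dots> = x * f i + y * g ^ j" by (simp add: fi flip: power_add)
    finally have "g ^ ?l = x * f i + y * g ^ j" .
    moreover have "g ^ ?l dvd f i" "g ^ ?l dvd g ^ j"
      by (simp_all add: fi dvd_mult2 le_imp_power_dvd)
    ultimately show "g ^ ?l dvd f i \<and> g ^ ?l dvd g ^ j \<and> (\<exists>x y. g ^ ?l = x * f i + y * g ^ j)"
      by blast
  qed
  also have "\<dots> = degree g * (\<Sum>i<n. min (m i) j)"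
  proof -
    have "g \<noteq> 0" using g(1) by auto
    then show ?thesis by (simp add: degree_power_eq sum_distrib_left mult.commute)
  qed
  finally show ?thesis .
qed

lemma act_all_iff: "poly_endo scale g u = (\<lambda>_. 0) \<longleftrightarrow> (\<forall>v. act g v = 0)"
  by (auto simp: fun_eq_iff)

end

lemma poly_map_poly_to_ac:
  "poly (map_poly to_ac (f + g)) x = poly (map_poly to_ac f) x + poly (map_poly to_ac g) x"
  "poly (map_poly to_ac (f * g)) x = poly (map_poly to_ac f) x * poly (map_poly to_ac g) x"
proof -
  have pCons: "poly (map_poly to_ac (pCons c h)) x = to_ac c + x * poly (map_poly to_ac h) x" for c h
    by (cases "c = 0 \<and> h = 0") (simp_all add: map_poly_pCons)
  have add: "poly (map_poly to_ac (f + g)) x = poly (map_poly to_ac f) x + poly (map_poly to_ac g) x" for f g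
    by (induction f g rule: poly_induct2) (simp_all add: pCons algebra_simps)
  have smult: "poly (map_poly to_ac (smult c g)) x = to_ac c * poly (map_poly to_ac g) x" for c g
    by (induction g) (simp_all add: pCons algebra_simps)
  show "poly (map_poly to_ac (f + g)) x = poly (map_poly to_ac f) x + poly (map_poly to_ac g) x"
    by (rule add)
  show "poly (map_poly to_ac (f * g)) x = poly (map_poly to_ac f) x * poly (map_poly to_ac g) x"
    by (induction f) (simp_all add: pCons add smult algebra_simps)
qed

locale quadratic_endo = fd_endo scale u Basis + quadratic_data \<tau> N d \<kappa>
  for scale :: "'a::field \<Rightarrow> 'v::ab_group_add \<Rightarrow> 'v" and u Basis and \<tau> N d \<kappa> :: 'a
begin

definition condition_ii :: bool where
  "condition_ii \<longleftrightarrow> (\<exists>k l. is_minimal_polynomial scale u (e ^ k * r ^ l)) \<and>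
    (\<exists>s. are_invariant_factors scale u s \<and>
       (\<forall>k\<ge>1. s (2 * k - 1) = s (2 * k) \<or> s (2 * k - 1) = r * s (2 * k)))"

lemma exceptional_annihilator:
  assumes "\<And>x. x \<in> closure_eigenvalues scale u \<Longrightarrow> poly (map_poly to_ac (e * r)) x = 0"
  obtains k l where "\<And>v. act (e ^ k * r ^ l) v = 0"
proof -
  have step: "\<exists>k l. \<forall>v. act m v = 0 \<longrightarrow> act (e ^ k * r ^ l) v = 0" if "m \<noteq> 0" for m
    using that
  proof (induction "degree m" arbitrary: m rule: less_induct)
    case less
    show ?case
    proof (cases "degree m = 0")
      case True
      then have "act m v = 0 \<longrightarrow> act (e ^ 0 * r ^ 0) v = 0" for v
        using act_unit_0 [OF less(2) True] by simp
      then show ?thesis by blast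
    next
      case False
      then obtain f where f: "irreducible f" "f dvd m" using exists_irreducible_factor by blast
      then obtain g where g: "m = f * g" by (elim dvdE)
      have nz: "f \<noteq> 0" "g \<noteq> 0" using less(2) g by auto
      then have "degree g < degree m"
        using irreducible_poly_degree_pos [OF f(1)] g by (simp add: degree_mult_eq)
      then obtain k l where kl: "\<And>v. act g v = 0 \<Longrightarrow> act (e ^ k * r ^ l) v = 0"
        using less(1) nz by blast
      show ?thesis
      proof (cases "\<exists>v. v \<noteq> 0 \<and> act f v = 0")
        case False
        then have "act m v = 0 \<longrightarrow> act (e ^ k * r ^ l) v = 0" for v
          unfolding g act_mult [of f] using kl by blast
        then show ?thesis by blast
      next
        case True
        then obtain v where v: "v \<noteq> 0" "act f v = 0" by blast
        obtain x where x: "x \<in> closure_eigenvalues scale u" "poly (map_poly to_ac f) x = 0"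
          using exists_closure_eigenvalue [OF nz(1) v(2,1)] by blast
        have "f dvd e * r"
        proof (rule ccontr)
          assume "\<not> f dvd e * r"
          \<comment> \<open>Evaluated at the common root \<open>x\<close>, this Bezout identity
            would read \<open>0 = 1\<close>.\<close>
          then obtain y z where "y * f + z * (e * r) = 1"
            using irreducible_comaximal [OF f(1)] unfolding comaximal_def by blast
          then have "poly (map_poly to_ac (y * f + z * (e * r))) x = 1" by simp
          then show False
            using x(2) assms [OF x(1)] by (simp only: poly_map_poly_to_ac) simp
        qed
        then have "f dvd e \<or> f dvd r"
          using irreducible_comaximal [OF f(1)] comaximal_dvd_mult by blast
        then have "f dvd e ^ 1 * r ^ 0 \<or> f dvd e ^ 0 * r ^ 1" by simp
        then obtain k' l' where f': "f dvd e ^ k' * r ^ l'" by blast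
        have "act (e ^ (k + k') * r ^ (l + l')) v = 0" if "act m v = 0" for v
        proof -
          have "act g (act f v) = 0" using that by (simp add: g mult.commute flip: act_mult)
          then have "act (e ^ k * r ^ l) (act f v) = 0" by (rule kl)
          then have "act ((e ^ k * r ^ l) * f) v = 0" by (simp only: act_mult)
          moreover have "(e ^ k * r ^ l) * f dvd (e ^ k * r ^ l) * (e ^ k' * r ^ l')"
            using f' by (intro mult_dvd_mono) auto
          ultimately have "act ((e ^ k * r ^ l) * (e ^ k' * r ^ l')) v = 0"
            using act_eq_0_dvd by blast
          then show ?thesis by (simp only: power_add mult_ac)
        qed
        then show ?thesis by blast
      qed
    qed
  qed
  obtain n :: nat and f v where D: "decomp UNIV {..<n} f v" and f0: "\<forall>w. n > 0 \<longrightarrow> act (f 0) w = 0"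
    using rational_canonical_form [OF subspace_UNIV UNIV_I] by (metis UNIV_I)
  show thesis
  proof (cases "n > 0")
    case True
    then have "monic (f 0)" using D by (simp add: decomp_def)
    then have "f 0 \<noteq> 0" by auto
    then obtain k l where "\<forall>v. act (f 0) v = 0 \<longrightarrow> act (e ^ k * r ^ l) v = 0" using step by blast
    then show thesis using that f0 True by blast
  next
    case False
    then have "UNIV = {0::'v}" using D by (auto simp: decomp_def gen_def)
    then have "act (e ^ 0 * r ^ 0) v = 0" for v by auto
    then show thesis by (rule that)
  qed
qed

end

context quadratic_quotient
begin

sublocale quadratic_endo ..

theorem quotient_imp_condition_ii:
  assumes ann: "\<And>v. act (e ^ K * r ^ L) v = 0"
  shows condition_ii
proof -
  obtain n :: nat and f v where D: "decomp UNIV {..<n} f v"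
    and chain: "\<forall>i. Suc i < n \<longrightarrow> f (Suc i) dvd f i"
    and min: "\<forall>g. (\<forall>w. act g w = 0) \<longrightarrow> (\<forall>i<n. f i dvd g)"
    and f0: "\<forall>w. n > 0 \<longrightarrow> act (f 0) w = 0"
    using rational_canonical_form [OF subspace_UNIV UNIV_I] by (metis UNIV_I)
  have mon: "monic (f i)" if "i < n" for i using D that by (simp add: decomp_def)
  have "\<exists>m k. f i = e ^ m * r ^ k" if i: "i < n" for i
  proof -
    have "f i dvd e ^ K * r ^ L" using min ann i by blast
    then show ?thesis
      using monic_dvd_powers [OF irreducible_e irreducible_r _ _ mon [OF i] comaximal_e_r] by simp metis
  qed
  then obtain m0 k0 where f: "\<And>i. i < n \<Longrightarrow> f i = e ^ m0 i * r ^ k0 i" by metis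
  \<comment> \<open>The exponents are extended by 0 beyond \<open>n\<close>, so that the last pair
    may be completed by a trivial factor.\<close>
  define m where "m i = (if i < n then m0 i else 0)" for i
  define k where "k i = (if i < n then k0 i else 0)" for i
  have fmk: "f i = e ^ m i * r ^ k i" if "i < n" for i using f that by (simp add: m_def k_def)
  have fkm: "f i = r ^ k i * e ^ m i" if "i < n" for i using fmk [OF that] by (simp only: mult.commute)
  have step: "m (Suc i) \<le> m i \<and> k (Suc i) \<le> k i" for i
  proof (cases "Suc i < n")
    case True
    then have "e ^ m (Suc i) * r ^ k (Suc i) dvd e ^ m i * r ^ k i"
      using chain fmk by (metis Suc_lessD)
    then show ?thesis by (intro powers_dvd_powers [OF comaximal_e_r]) simp_all
  qed (simp add: m_def k_def)
  then have anti: "antimono m" "antimono k" by (simp_all add: antimono_iff_le_Suc)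
  have m0: "m i = 0" "k i = 0" if "i \<ge> n" for i using that by (simp_all add: m_def k_def)
  have dim_e: "dim {x. act (e ^ j) x = 0} = (\<Sum>i<n. min (m i) j)" for j
    using dim_ker_power [OF D _ comaximal_e_r fmk] by simp
  have dim_r: "dim {x. act (r ^ j) x = 0} = 2 * (\<Sum>i<n. min (k i) j)" for j
    using dim_ker_power [OF D _ comaximal_commute [OF comaximal_e_r] fkm] by simp
  have meq: "m (2 * j) = m (2 * j + 1)" for j
    using anti(1) m0(1)
  proof (rule antimono_pairs_eq)
    show "even (\<Sum>i<n. min (m i) j)" for j using even_dim_ker_e [of j] by (simp only: dim_e)
  qed
  have knear: "k (2 * j) = k (2 * j + 1) \<or> k (2 * j) = Suc (k (2 * j + 1))" for j
    using anti(2) m0(2)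
  proof (rule antimono_pairs_near)
    fix j
    assume *: "(\<Sum>i<n. min (k i) (j + 2)) + (\<Sum>i<n. min (k i) j) = 2 * (\<Sum>i<n. min (k i) (j + 1))"
    have "dim {x. act (r ^ (j + 2)) x = 0} + dim {x. act (r ^ j) x = 0} = 2 * dim {x. act (r ^ (j + 1)) x = 0}"
      unfolding dim_r using * by linarith
    then have "4 dvd dim {x. act (r ^ (j + 1)) x = 0} - dim {x. act (r ^ j) x = 0}"
      by (rule four_dvd_dim_ker_r)
    \<comment> \<open>The dimensions are twice the sums because \<open>r\<close> has degree 2, so
      divisibility by 4 becomes evenness.\<close>
    then have "2 * 2 dvd 2 * ((\<Sum>i<n. min (k i) (j + 1)) - (\<Sum>i<n. min (k i) j))"
      by (simp only: dim_r diff_mult_distrib2) simp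
    then show "even ((\<Sum>i<n. min (k i) (j + 1)) - (\<Sum>i<n. min (k i) j))"
      by (simp only: nat_mult_dvd_cancel1 zero_less_numeral)
  qed
  \<comment> \<open>Factors are numbered from 1 and exponents from 0: the factors at
    \<open>2 * j - 1\<close> and \<open>2 * j\<close> have the exponents at \<open>2 * i\<close> and
    \<open>2 * i + 1\<close>, where \<open>j = i + 1\<close>.\<close>
  define s where "s i = e ^ m (i - 1) * r ^ k (i - 1)" for i
  have sf: "s (Suc i) = f i" if "i < n" for i using fmk [OF that] by (simp add: s_def)
  have "are_invariant_factors scale u s"
    unfolding are_invariant_factors_def
  proof (intro conjI allI impI exI [of _ n])
    fix i :: nat assume i: "1 \<le> i"
    show "monic (s i)" by (simp add: s_def lead_coeff_mult lead_coeff_power)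
    have "m i \<le> m (i - 1) \<and> k i \<le> k (i - 1)" using step [of "i - 1"] i by simp
    then show "s (i + 1) dvd s i"
      by (simp add: s_def mult_dvd_mono le_imp_power_dvd)
  next
    fix i assume "n < i"
    then show "s i = 1" using m0 [of "i - 1"] by (simp add: s_def)
  next
    let ?fs = "map f [0..<n]"
    have "decomp UNIV {..<length ?fs} (\<lambda>i. ?fs ! i) v"
      using D by (simp add: decomp_def)
    moreover have "monic g" if "g \<in> set ?fs" for g using that mon by auto
    ultimately obtain B where B: "represented_by scale u B (diag_block_mat (map companion ?fs))"
      using represented_by_companions_iff [of ?fs] by blast
    have "map (\<lambda>i. companion (s i)) [1..<n + 1] = map companion ?fs"
      by (rule nth_equalityI) (simp_all add: sf del: upt_Suc)
    then show "\<exists>B. represented_by scale u B (diag_block_mat (map (\<lambda>i. companion (s i)) [1..<n + 1]))"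
      using B by metis
  qed
  moreover have "s (2 * j - 1) = s (2 * j) \<or> s (2 * j - 1) = r * s (2 * j)" if "j \<ge> 1" for j
  proof -
    from that obtain i where i: "j = Suc i" by (cases j) auto
    have "s (2 * j - 1) = e ^ m (2 * i) * r ^ k (2 * i)"
      "s (2 * j) = e ^ m (2 * i + 1) * r ^ k (2 * i + 1)"
      by (simp_all add: s_def i)
    then show ?thesis using meq [of i] knear [of i] by (auto simp only: power_Suc mult_ac)
  qed
  moreover have "\<exists>k l. is_minimal_polynomial scale u (e ^ k * r ^ l)"
  proof (cases "n > 0")
    case True
    have "is_minimal_polynomial scale u (f 0)"
      unfolding is_minimal_polynomial_def act_all_iff using mon True f0 min by blast
    then show ?thesis using fmk [OF True] by metis
  next
    case False
    \<comment> \<open>The space is zero here, and its minimal polynomial is 1.\<close>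
    have "act g w = 0" for g w
    proof -
      have "w \<in> gen {..<n} v" using D by (simp add: decomp_def)
      then have "w = 0" using False by (auto simp: gen_def)
      then show ?thesis by simp
    qed
    then have "is_minimal_polynomial scale u (e ^ 0 * r ^ 0)"
      unfolding is_minimal_polynomial_def act_all_iff by simp
    then show ?thesis by blast
  qed
  ultimately show ?thesis unfolding condition_ii_def by blast
qed

end

subsection \<open>Construction of quotients\<close>

lemma concat_pairs: "concat (map (\<lambda>k. [g (2 * k), g (2 * k + 1)]) [0..<K]) = map g [0..<2 * K]"
  by (induction K) simp_all

context endo
begin

text \<open>With the next lemma: \<open>f(u)\<close> is bijective on the kernel of
  \<open>g(u)\<close>. This permits division by \<open>u + d\<close> on the \<open>r\<close>-primary
  part.\<close>

lemma act_comaximal_eq_0: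
  assumes "comaximal f g" "act f z = 0" "act g z = 0"
  shows "z = 0"
proof -
  obtain x y where "x * f + y * g = 1" using assms(1) by (auto simp: comaximal_def)
  then have "z = act (x * f + y * g) z" by simp
  also have "\<dots> = 0" using assms(2,3) by (simp add: act_add act_mult)
  finally show ?thesis .
qed

lemma act_comaximal_preimage:
  assumes "comaximal f g" "act g t = 0"
  obtains y where "act g y = 0" "act f y = t"
proof -
  obtain x y where xy: "x * f + y * g = 1" using assms(1) by (auto simp: comaximal_def)
  have "t = act (x * f + y * g) t" by (simp add: xy)
  then have "act f (act x t) = t" using assms(2) by (simp add: act_add act_mult act_commute [of f])
  moreover have "act g (act x t) = 0" using assms(2) by (simp add: act_commute [of g])
  ultimately show thesis using that by blast
qed

lemma act_ker_u: "u x = 0 \<Longrightarrow> act g x = scale (poly g 0) x"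
  by (induction g) (simp_all add: u.scale)

end

context fd_endo
begin

lemma inj_surj:
  assumes "\<And>x. u x = 0 \<Longrightarrow> x = 0"
  shows "inj u" "surj u"
proof -
  show "inj u"
  proof (rule injI)
    fix x y assume "u x = u y"
    then have "u (x - y) = 0" by (simp add: u.diff)
    then have "x - y = 0" by (rule assms)
    then show "x = y" by simp
  qed
  then show "surj u" by (rule linear_inj_imp_surj [OF lin])
qed

lemma decomp_extend:
  assumes D: "decomp W I f v" and J: "I \<subseteq> J" "finite J" "\<And>i. i \<in> J - I \<Longrightarrow> f i = 1"
  shows "decomp W J f (\<lambda>i. if i \<in> I then v i else 0)"
proof -
  have sum: "(\<Sum>i\<in>J. act (g i) (if i \<in> I then v i else 0)) = (\<Sum>i\<in>I. act (g i) (v i))" for g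
    using J by (intro sum.mono_neutral_cong_right) auto
  have "(\<Sum>i\<in>J. degree (f i)) = (\<Sum>i\<in>I. degree (f i))"
    using J by (intro sum.mono_neutral_right) auto
  moreover have "monic (f i) \<and> act (f i) (if i \<in> I then v i else 0) = 0" if "i \<in> J" for i
    using that D J(3) [of i] by (cases "i \<in> I") (auto simp: decomp_def)
  ultimately show ?thesis using D J by (simp add: decomp_def gen_def sum)
qed

lemma decomp_kills_dvd:
  assumes D: "decomp UNIV I f v" and g: "\<And>x. act g x = 0" and k: "k \<in> I"
  shows "f k dvd g"
proof -
  have "(\<Sum>i\<in>I. act (if i = k then g else 0) (v i)) = 0"
    using g by (intro sum.neutral) auto
  from decomp_dvd [OF D this k] show ?thesis by simp
qed

text \<open>The kernel of \<open>L\<close> is a submodule containing the generators. Asking only for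
  a stable kernel suits the defect \<open>E\<close>, the graph map below and polynomials in
  \<open>u\<close> alike.\<close>

lemma decomp_all_zero:
  assumes D: "decomp UNIV I f v" and L: "Vector_Spaces.linear scale scale L"
    and Lu: "\<And>x. L x = 0 \<Longrightarrow> L (u x) = 0" and 0: "\<And>i. i \<in> I \<Longrightarrow> L (v i) = 0"
  shows "L x = 0"
proof -
  interpret L: Vector_Spaces.linear scale scale L by (rule L)
  have "subspace {x. L x = 0}" by (simp add: subspace_def L.add L.scale)
  then have "gen I v \<subseteq> {x. L x = 0}" by (rule gen_leastI) (use Lu 0 in auto)
  then show ?thesis using D by (auto simp: decomp_def)
qed

end

context quadratic_endo
begin

definition condition_iii :: bool where
  "condition_iii \<longleftrightarrow> (\<exists>B Ms. represented_by scale u B (diag_block_mat Ms) \<and>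
     (\<forall>M\<in>set Ms.
        (\<exists>n. \<exists>\<epsilon>\<in>{0, 1}. M = diag_block_mat [companion (r ^ (n + \<epsilon>)), companion (r ^ n)]) \<or>
        (\<exists>n\<ge>1. M = diag_block_mat [companion (e ^ n), companion (e ^ n)])))"

lemma powers_eq:
  assumes "e ^ m * r ^ n = e ^ m' * r ^ n'"
  shows "m = m' \<and> n = n'"
  using powers_dvd_powers [OF comaximal_e_r, of m n m' n'] powers_dvd_powers [OF comaximal_e_r, of m' n' m n]
    assms by simp

theorem condition_ii_imp_iii:
  assumes condition_ii
  shows condition_iii
proof -
  obtain K L where min: "is_minimal_polynomial scale u (e ^ K * r ^ L)"
    using assms unfolding condition_ii_def by blast
  obtain s where s: "are_invariant_factors scale u s"
    and pairs: "\<And>j. j \<ge> 1 \<Longrightarrow> s (2 * j - 1) = s (2 * j) \<or> s (2 * j - 1) = r * s (2 * j)"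
    using assms unfolding condition_ii_def by blast
  have mon: "monic (s (Suc i))" for i using s by (simp add: are_invariant_factors_def)
  obtain n B where s1: "\<And>i. i > n \<Longrightarrow> s i = 1"
    and B: "represented_by scale u B (diag_block_mat (map (\<lambda>i. companion (s i)) [1..<n + 1]))"
    using s unfolding are_invariant_factors_def by blast
  let ?fs = "map s [1..<n + 1]"
  have "map (\<lambda>i. companion (s i)) [1..<n + 1] = map companion ?fs" by simp
  then have "\<exists>B. represented_by scale u B (diag_block_mat (map companion ?fs))" using B by metis
  moreover have "monic f" if "f \<in> set ?fs" for f
  proof -
    from that obtain i where "i \<ge> 1" "f = s i" by auto
    then show ?thesis using mon [of "i - 1"] by simp
  qed
  ultimately obtain v where "decomp UNIV {..<length ?fs} (\<lambda>i. ?fs ! i) v"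
    using represented_by_companions_iff [of ?fs] by blast
  then have D: "decomp UNIV {..<n} (\<lambda>i. s (Suc i)) v"
    by (simp add: decomp_def del: upt_Suc)
  have "\<exists>m k. s (Suc i) = e ^ m * r ^ k" for i
  proof (cases "i < n")
    case True
    then have "s (Suc i) dvd e ^ K * r ^ L"
      using decomp_kills_dvd [OF D] min by (simp add: is_minimal_polynomial_def act_all_iff)
    then show ?thesis
      using monic_dvd_powers [OF irreducible_e irreducible_r _ _ mon comaximal_e_r] by simp metis
  next
    case False
    then have "s (Suc i) = e ^ 0 * r ^ 0" using s1 by simp
    then show ?thesis by blast
  qed
  then obtain m k where mk: "\<And>i. s (Suc i) = e ^ m i * r ^ k i" by metis
  have pair: "m (2 * j) = m (2 * j + 1) \<and> (k (2 * j) = k (2 * j + 1) \<or> k (2 * j) = k (2 * j + 1) + 1)" for j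
  proof -
    have "s (Suc (2 * j)) = s (Suc (2 * j + 1)) \<or> s (Suc (2 * j)) = r * s (Suc (2 * j + 1))"
      using pairs [of "Suc j"] by simp
    then have "e ^ m (2 * j) * r ^ k (2 * j) = e ^ m (2 * j + 1) * r ^ k (2 * j + 1) \<or>
        e ^ m (2 * j) * r ^ k (2 * j) = e ^ m (2 * j + 1) * r ^ (k (2 * j + 1) + 1)"
      unfolding mk by (simp only: power_add power_one_right mult_ac)
    then show ?thesis using powers_eq by blast
  qed
  \<comment> \<open>Padding with factors 1 up to \<open>2 * n\<close> completes every pair, whatever
    the parity of \<open>n\<close>.\<close>
  have "decomp UNIV {..<2 * n} (\<lambda>i. s (Suc i)) (\<lambda>i. if i \<in> {..<n} then v i else 0)"
    by (rule decomp_extend [OF D]) (auto simp: s1)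
  then have D1: "decomp UNIV {..<2 * n} (\<lambda>i. e ^ m i * r ^ k i) (\<lambda>i. if i \<in> {..<n} then v i else 0)"
    unfolding mk .
  define F where "F = (\<lambda>(i, b). if b then e ^ m i else r ^ k i)"
  have monp: "monic (e ^ j)" "monic (r ^ j)" for j by (simp_all add: lead_coeff_power)
  obtain w where D2: "decomp UNIV ({..<2 * n} \<times> UNIV) F w"
    unfolding F_def
    by (rule decomp_split [OF D1]) (simp_all add: monp comaximal_powers [OF comaximal_e_r])
  \<comment> \<open>All powers of \<open>r\<close> come before all powers of \<open>e\<close>, each
    in the order of the invariant factors, so that paired factors are adjacent.\<close>
  define xs where "xs = map (\<lambda>i. (i, False)) [0..<2 * n] @ map (\<lambda>i. (i, True)) [0..<2 * n]"
  have "distinct xs" by (auto simp: xs_def distinct_map inj_on_def)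
  moreover have "set xs = {..<2 * n} \<times> UNIV"
    by (auto simp: xs_def UNIV_bool)
  ultimately have bij: "bij_betw ((!) xs) {..<length xs} ({..<2 * n} \<times> UNIV)"
    by (intro bij_betw_nth) auto
  let ?gs = "map F xs"
  have "decomp UNIV {..<length ?gs} (\<lambda>i. ?gs ! i) (w \<circ> (!) xs)"
    using decomp_reindex [OF D2 bij] by (simp add: decomp_def o_def)
  moreover have "monic g" if "g \<in> set ?gs" for g
    using that by (auto simp: F_def monp)
  ultimately obtain B' where B': "represented_by scale u B' (diag_block_mat (map companion ?gs))"
    using represented_by_companions_iff [of ?gs] by blast
  define fss where "fss = map (\<lambda>j. [r ^ k (2 * j), r ^ k (2 * j + 1)]) [0..<n] @
    map (\<lambda>j. [e ^ m (2 * j), e ^ m (2 * j + 1)]) [0..<n]"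
  have "?gs = concat fss"
    using concat_pairs [of "\<lambda>i. r ^ k i" n] concat_pairs [of "\<lambda>i. e ^ m i" n]
    by (simp add: fss_def xs_def F_def o_def)
  then have rep: "represented_by scale u B' (diag_block_mat (map (\<lambda>fs. diag_block_mat (map companion fs)) fss))"
    using B' by (simp only: diag_block_mat_concat)
  have "(\<exists>n. \<exists>\<epsilon>\<in>{0, 1}. M = diag_block_mat [companion (r ^ (n + \<epsilon>)), companion (r ^ n)]) \<or>
        (\<exists>n\<ge>1. M = diag_block_mat [companion (e ^ n), companion (e ^ n)])"
    if M: "M \<in> set (map (\<lambda>fs. diag_block_mat (map companion fs)) fss)" for M
  proof -
    from M consider j where "M = diag_block_mat [companion (r ^ k (2 * j)), companion (r ^ k (2 * j + 1))]"
      | j where "M = diag_block_mat [companion (e ^ m (2 * j)), companion (e ^ m (2 * j + 1))]"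
      unfolding fss_def by (auto simp del: diag_block_mat.simps)
    then show ?thesis
    proof cases
      case (1 j)
      then have "\<exists>\<epsilon>\<in>{0, 1}. M = diag_block_mat [companion (r ^ (k (2 * j + 1) + \<epsilon>)), companion (r ^ k (2 * j + 1))]"
        using pair [of j] by (metis add_0_right insertCI)
      then show ?thesis by blast
    next
      case (2 j)
      show ?thesis
      proof (cases "m (2 * j) = 0")
        case True
        \<comment> \<open>Blocks of powers of \<open>e\<close> need a positive exponent, so an empty
          pair is counted among the blocks of powers of \<open>r\<close>.\<close>
        then have "M = diag_block_mat [companion (r ^ (0 + 0)), companion (r ^ 0)]"
          using 2 pair [of j] by (simp del: diag_block_mat.simps)
        then show ?thesis by blast
      next
        case False
        then have "m (2 * j) \<ge> 1 \<and> M = diag_block_mat [companion (e ^ m (2 * j)), companion (e ^ m (2 * j))]"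
          using 2 pair [of j] by (simp del: diag_block_mat.simps)
        then show ?thesis by blast
      qed
    qed
  qed
  then show ?thesis unfolding condition_iii_def using rep by blast
qed

text \<open>The graph \<open>x \<mapsto> (x, a x)\<close> of the operator \<open>a\<close> to be constructed intertwines \<open>u\<close> with the
  operator \<open>T\<close> below, which encodes the relation \<open>a u = d\<^sup>2 u\<^sup>-\<^sup>1 a - \<tau> (d - u)\<close>; so \<open>a\<close> is obtained
  from its values on generators by the universal property.\<close>

lemma exists_twisted:
  assumes D: "decomp UNIV I F v" and inj: "\<And>x. u x = 0 \<Longrightarrow> x = 0"
    and F: "\<And>i. i \<in> I \<Longrightarrow> \<exists>f\<in>{e, r}. \<exists>n. F i = f ^ n" and y: "\<And>i. i \<in> I \<Longrightarrow> act (F i) (y i) = 0"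
  obtains a where "twisted scale u Basis \<tau> N d \<kappa> a" "\<And>i. i \<in> I \<Longrightarrow> a (v i) = y i"
proof -
  have "inj u" and surj: "surj u" using inj_surj inj by blast+
  define U where "U = inv_into UNIV u"
  have U_lin: "Vector_Spaces.linear scale scale U"
    unfolding U_def by (rule inj_linear_imp_inv_linear [OF lin \<open>inj u\<close>])
  interpret U: Vector_Spaces.linear scale scale U by (rule U_lin)
  have uU [simp]: "u (U x) = x" and Uu [simp]: "U (u x) = x" for x
    using surj \<open>inj u\<close> by (simp_all add: U_def surj_f_inv_f)
  have act_U: "act g (U x) = U (act g x)" for g x
    using act_u [of g "U x"] by (metis uU Uu)
  define scale2 where "scale2 b z = (scale b (fst z), scale b (snd z))" for b and z :: "'v \<times> 'v"
  define T where "T z = (u (fst z), scale (d\<^sup>2) (U (snd z)) - scale \<tau> (scale d (fst z) - u (fst z)))"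
    for z :: "'v \<times> 'v"
  have "vector_space scale2"
    by unfold_locales (simp_all add: scale2_def prod_eq_iff algebra_simps)
  then have endoT: "endo scale2 T"
    by (simp add: endo_def endo_axioms_def Vector_Spaces.linear_iff scale2_def T_def prod_eq_iff
        u.add u.scale U.add U.scale algebra_simps)
  interpret T: endo scale2 T by (rule endoT)
  \<comment> \<open>The map \<open>z \<mapsto> d\<^sup>2 / z\<close> permutes the roots of
    \<open>e\<close> and those of \<open>r\<close>, so for both polynomials
    \<open>f(d\<^sup>2 u\<^sup>-\<^sup>1)\<close> is \<open>f(u)\<close> times a unit; the
    off-diagonal entry of \<open>f(T)\<close> is a multiple of \<open>f(u)\<close> too. Hence a
    power of \<open>f\<close> that kills both components of a pair kills the pair under
    \<open>T\<close>.\<close>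
  have Te: "T.act e z = (act e (fst z), scale \<tau> (act e (fst z)) - scale d (U (act e (snd z))))" for z
    by (simp add: scale2_def T_def U.add U.diff U.scale prod_eq_iff power2_eq_square algebra_simps)
  have Tr: "T.act r z = (act r (fst z), scale (d\<^sup>2) (U (U (act r (snd z))))
      - scale \<tau> (scale d (U (act r (fst z))) - act r (fst z)))" for z
    by (simp add: scale2_def T_def u.add u.diff u.scale U.add U.diff U.scale prod_eq_iff
        power2_eq_square algebra_simps)
  have Tpow: "T.act (f ^ n) z = 0"
    if "f \<in> {e, r}" "act (f ^ n) (fst z) = 0" "act (f ^ n) (snd z) = 0" for f n z
    using that(2,3)
  proof (induction n arbitrary: z)
    case 0
    then show ?case by (simp add: prod_eq_iff)
  next
    case (Suc n)
    have *: "act (f ^ n) (act f (fst z)) = 0" "act (f ^ n) (act f (snd z)) = 0"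
      using Suc.prems by (simp_all only: power_Suc2 act_mult)
    have "act (f ^ n) (fst (T.act f z)) = 0 \<and> act (f ^ n) (snd (T.act f z)) = 0"
    proof (cases "f = e")
      case True
      then show ?thesis using * by (simp only: Te fst_conv snd_conv act.diff act.scale act_U) (simp add: U.zero)
    next
      case False
      then have "f = r" using that(1) by simp
      then show ?thesis using * by (simp only: Tr fst_conv snd_conv act.diff act.scale act_U) (simp add: U.zero)
    qed
    then have "T.act (f ^ n) (T.act f z) = 0" using Suc.IH by blast
    then show ?case by (simp only: power_Suc2 T.act_mult)
  qed
  have "act (F i) (v i) = 0" if "i \<in> I" for i using D that by (simp add: decomp_def)
  then have TF: "T.act (F i) (v i, y i) = 0" if "i \<in> I" for i
    using F [OF that] y [OF that] Tpow [of _ _ "(v i, y i)"] that by fastforce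
  obtain \<phi> where phi: "Vector_Spaces.linear scale scale2 \<phi>" "\<And>x. \<phi> (u x) = T (\<phi> x)"
    "\<And>i. i \<in> I \<Longrightarrow> \<phi> (v i) = (v i, y i)"
    using decomp_universal [OF D endoT, of "\<lambda>i. (v i, y i)"] TF by blast
  interpret phi: Vector_Spaces.linear scale scale2 \<phi> by (rule phi(1))
  \<comment> \<open>The first component of \<open>\<phi>\<close> commutes with \<open>u\<close> and
    fixes the generators, so \<open>\<phi>\<close> is indeed a graph.\<close>
  have "fst (\<phi> x) - x = 0" for x
  proof (rule decomp_all_zero [OF D, where L = "\<lambda>x. fst (\<phi> x) - x"])
    show "Vector_Spaces.linear scale scale (\<lambda>x. fst (\<phi> x) - x)"
      by (simp add: Vector_Spaces.linear_iff vector_space_axioms phi.add phi.scale scale2_def algebra_simps)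
    show "fst (\<phi> (u x)) - u x = 0" if "fst (\<phi> x) - x = 0" for x
      using that by (simp add: phi(2) T_def)
  qed (simp add: phi(3))
  then have fst: "fst (\<phi> x) = x" for x by simp
  define a where "a x = snd (\<phi> x)" for x
  have "twisted scale u Basis \<tau> N d \<kappa> a"
  proof (intro twisted.intro fd_endo_axioms quadratic_data_axioms twisted_axioms.intro)
    show "Vector_Spaces.linear scale scale a"
      by (simp add: Vector_Spaces.linear_iff vector_space_axioms a_def phi.add phi.scale scale2_def)
    show "x = 0" if "u x = 0" for x using inj that .
    show "u (a (u x)) = scale (d\<^sup>2) (a x) - scale \<tau> (u (scale d x - u x))" for x
      by (simp add: a_def phi(2) T_def fst u.diff u.scale)
  qed
  moreover have "a (v i) = y i" if "i \<in> I" for i using phi(3) [OF that] by (simp add: a_def)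
  ultimately show thesis by (rule that)
qed

definition good_pair :: "'a poly \<Rightarrow> 'a poly \<Rightarrow> bool" where
  "good_pair f g \<longleftrightarrow> (\<exists>n. f = r ^ Suc n \<and> g = r ^ n) \<or> (\<exists>h\<in>{e, r}. \<exists>n. f = h ^ n \<and> g = h ^ n)"

text \<open>On a pair with equal annihilators, \<open>a\<close> acts through the companion matrix of
  \<open>p\<close>. On a pair \<open>r ^ Suc n\<close>, \<open>r ^ n\<close> one demands
  \<open>c v1 = v2\<close>; then \<open>u c\<^sup>2 = - d N r(u)\<close> dictates
  \<open>u c v2 = - d N r(u) v1\<close>. The images \<open>y1\<close> and \<open>y2\<close> under
  \<open>a\<close> result from solving the definition of \<open>c\<close> for \<open>a\<close>, with
  \<open>u + d\<close> invertible on the \<open>r\<close>-primary part.\<close>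

lemma good_pairs_imp_quotient:
  fixes K :: nat
  assumes D: "decomp UNIV {..<2 * K} F v" and inj: "\<And>x. u x = 0 \<Longrightarrow> x = 0"
    and good: "\<And>k. k < K \<Longrightarrow> good_pair (F (2 * k)) (F (2 * k + 1))"
  obtains a where "quadratic_quotient scale u Basis \<tau> N d \<kappa> a"
proof -
  have "inj u" and surj: "surj u" using inj_surj inj by blast+
  have Fv: "act (F i) (v i) = 0" if "i < 2 * K" for i using D that by (simp add: decomp_def)
  have "\<exists>y1 y2. act (F (2 * k)) y1 = 0 \<and> act (F (2 * k + 1)) y2 = 0 \<and>
      (y1 = v (2 * k + 1) \<and> y2 = scale \<tau> (v (2 * k + 1)) - scale N (v (2 * k)) \<or>
       (\<exists>n. F (2 * k) = r ^ n) \<and> act [:d, 1:] y1 = v (2 * k + 1) + scale \<tau> (u (v (2 * k))) \<and>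
       u (act [:d, 1:] y2) = scale \<tau> (u (u (v (2 * k + 1)))) - scale (d * N) (act r (v (2 * k))))"
    if k: "k < K" for k
  proof -
    let ?v1 = "v (2 * k)" and ?v2 = "v (2 * k + 1)"
    have Fv1: "act (F (2 * k)) ?v1 = 0" and Fv2: "act (F (2 * k + 1)) ?v2 = 0" using Fv k by simp_all
    consider n where "F (2 * k) = r ^ Suc n" "F (2 * k + 1) = r ^ n" | "F (2 * k) = F (2 * k + 1)"
      using good [OF k] unfolding good_pair_def by metis
    then show ?thesis
    proof cases
      case (1 n)
      note cm = comaximal_power_right [OF comaximal_linear_r [of d]]
      have "act (F (2 * k)) ?v2 = 0"
        by (rule act_eq_0_dvd [OF _ Fv2]) (simp only: 1 le_imp_power_dvd le_SucI order_refl)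
      then have "act (r ^ Suc n) (?v2 + scale \<tau> (u ?v1)) = 0"
        using Fv1 by (simp only: 1 act.add act.scale act_u u.zero scale_zero_right add_0_right)
      then obtain y1 where y1: "act (r ^ Suc n) y1 = 0" "act [:d, 1:] y1 = ?v2 + scale \<tau> (u ?v1)"
        by (rule act_comaximal_preimage [OF cm])
      \<comment> \<open>\<open>t\<close> is the prescribed value of \<open>(u + d) y2\<close>; it is
        killed by \<open>r ^ n\<close> because \<open>r ^ n\<close> kills \<open>?v2\<close> and
        \<open>r ^ Suc n\<close> kills \<open>?v1\<close>.\<close>
      obtain t where t: "u t = scale \<tau> (u (u ?v2)) - scale (d * N) (act r ?v1)"
        using surj by (metis surjD)
      have "u (act (r ^ n) t) = scale \<tau> (u (u (act (r ^ n) ?v2))) - scale (d * N) (act (r ^ Suc n) ?v1)"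
        by (simp only: act_u [symmetric] t act.diff act.scale power_Suc2 act_mult)
      also have "\<dots> = 0" using Fv1 Fv2 by (simp only: 1 u.zero scale_zero_right diff_0_right)
      finally have "act (r ^ n) t = 0" by (rule inj)
      then obtain y2 where "act (r ^ n) y2 = 0" "act [:d, 1:] y2 = t"
        by (rule act_comaximal_preimage [OF cm])
      then show ?thesis using y1 1 t by metis
    next
      case 2
      then have "act (F (2 * k)) ?v2 = 0 \<and> act (F (2 * k + 1)) (scale \<tau> ?v2 - scale N ?v1) = 0"
        using Fv1 Fv2 by (simp add: act.diff act.scale)
      then show ?thesis by blast
    qed
  qed
  then obtain y1 y2 where Y: "\<And>k. k < K \<Longrightarrow> act (F (2 * k)) (y1 k) = 0 \<and> act (F (2 * k + 1)) (y2 k) = 0 \<and>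
      (y1 k = v (2 * k + 1) \<and> y2 k = scale \<tau> (v (2 * k + 1)) - scale N (v (2 * k)) \<or>
       (\<exists>n. F (2 * k) = r ^ n) \<and> act [:d, 1:] (y1 k) = v (2 * k + 1) + scale \<tau> (u (v (2 * k))) \<and>
       u (act [:d, 1:] (y2 k)) = scale \<tau> (u (u (v (2 * k + 1)))) - scale (d * N) (act r (v (2 * k))))"
    by metis
  define y where "y i = (if even i then y1 (i div 2) else y2 (i div 2))" for i
  have index: "\<exists>k<K. i = 2 * k \<or> i = 2 * k + 1" if "i < 2 * K" for i
    using that by (intro exI [of _ "i div 2"]) auto
  have "act (F i) (y i) = 0" if "i \<in> {..<2 * K}" for i
    using index [of i] that Y by (auto simp: y_def)
  moreover have "\<exists>f\<in>{e, r}. \<exists>n. F i = f ^ n" if "i \<in> {..<2 * K}" for i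
  proof -
    have "i < 2 * K" using that by simp
    then obtain k where k: "k < K" "i = 2 * k \<or> i = 2 * k + 1" using index by blast
    then show ?thesis using good [OF k(1)] unfolding good_pair_def by blast
  qed
  ultimately obtain a where a: "twisted scale u Basis \<tau> N d \<kappa> a"
    "\<And>i. i \<in> {..<2 * K} \<Longrightarrow> a (v i) = y i"
    using exists_twisted [OF D inj, of y] by blast
  interpret tw: twisted scale u Basis \<tau> N d \<kappa> a by (rule a(1))
  have E: "tw.E (v (2 * k)) = 0 \<and> tw.E (v (2 * k + 1)) = 0" if k: "k < K" for k
  proof -
    define v1 where "v1 = v (2 * k)"
    define v2 where "v2 = v (2 * k + 1)"
    have av: "a v1 = y1 k" "a v2 = y2 k"
      using a(2) [of "2 * k"] a(2) [of "2 * k + 1"] k by (simp_all add: y_def v1_def v2_def)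
    consider "y1 k = v2" "y2 k = scale \<tau> v2 - scale N v1"
      | n where "F (2 * k) = r ^ n" "act [:d, 1:] (y1 k) = v2 + scale \<tau> (u v1)"
        "u (act [:d, 1:] (y2 k)) = scale \<tau> (u (u v2)) - scale (d * N) (act r v1)"
      using Y [OF k] unfolding v1_def [symmetric] v2_def [symmetric] by blast
    then have "tw.E v1 = 0 \<and> tw.E v2 = 0"
    proof cases
      case 1
      have "a v1 = v2" "a v2 = scale \<tau> v2 - scale N v1" by (simp_all only: av 1)
      then show ?thesis by (simp add: tw.E_def tw.lin_simps)
    next
      case (2 n)
      have c1: "tw.c v1 = v2"
        using 2(2) by (simp add: tw.c_def av)
      have "u (tw.c v2) = - scale (d * N) (act r v1)"
        using 2(3) by (simp add: tw.c_def av tw.lin_simps algebra_simps)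
      moreover have "x = 0" if "y = x - z" "y = - z" for x y z :: 'v using that by simp
      \<comment> \<open>At \<open>v1\<close>, where \<open>c\<^sup>2\<close> has its intended value,
        \<open>ucc\<close> leaves only the term with the defect.\<close>
      ultimately have "scale d (act [:d, 1:] (act [:d, 1:] (tw.E v1))) = 0"
        using tw.ucc [of v1] unfolding c1 by blast
      then have 0: "act [:d, 1:] (act [:d, 1:] (tw.E v1)) = 0" using d by (simp del: act_pCons)
      have rE: "act (r ^ n) (tw.E v1) = 0"
        using Fv [of "2 * k"] k 2(1) by (simp add: v1_def tw.E.zero flip: tw.E_act)
      note cm = comaximal_power_right [OF comaximal_linear_r [of d], of n]
      have "act [:d, 1:] (tw.E v1) = 0"
        by (rule act_comaximal_eq_0 [OF cm 0]) (simp only: act_commute [of "r ^ n"] rE act.zero)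
      then have E1: "tw.E v1 = 0"
        by (rule act_comaximal_eq_0 [OF cm _ rE])
      \<comment> \<open>The defect commutes with \<open>c\<close>, which carries \<open>v1\<close>
        to \<open>v2\<close>.\<close>
      have "tw.E v2 = 0" using tw.E_c [of v1] by (simp add: c1 E1 tw.c.zero)
      then show ?thesis using E1 by blast
    qed
    then show ?thesis by (simp only: v1_def v2_def)
  qed
  have "tw.E x = 0" for x
  proof (rule decomp_all_zero [OF D tw.E_linear])
    show "tw.E (u x) = 0" if "tw.E x = 0" for x using that by (simp add: tw.E_u)
    show "tw.E (v i) = 0" if "i \<in> {..<2 * K}" for i
      using index [of i] that E by auto
  qed
  then have "quadratic_quotient scale u Basis \<tau> N d \<kappa> a" by unfold_locales
  then show thesis by (rule that)
qed

lemma condition_iii_imp: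
  assumes condition_iii
  obtains a L where "quadratic_quotient scale u Basis \<tau> N d \<kappa> a" "\<And>x. act (e ^ L * r ^ L) x = 0"
proof -
  obtain B Ms where B: "represented_by scale u B (diag_block_mat Ms)" and
    Ms: "\<forall>M\<in>set Ms.
        (\<exists>n. \<exists>\<epsilon>\<in>{0, 1}. M = diag_block_mat [companion (r ^ (n + \<epsilon>)), companion (r ^ n)]) \<or>
        (\<exists>n\<ge>1. M = diag_block_mat [companion (e ^ n), companion (e ^ n)])"
    using assms unfolding condition_iii_def by blast
  let ?diag = "\<lambda>(f, g). diag_block_mat (map companion [f, g])"
  have "\<exists>ps. Ms = map ?diag ps \<and> (\<forall>(f, g)\<in>set ps. good_pair f g)"
    using Ms
  proof (induction Ms)
    case (Cons M Ms)
    then obtain ps where ps: "Ms = map ?diag ps" "\<forall>(f, g)\<in>set ps. good_pair f g" by auto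
    have "\<exists>f g. M = ?diag (f, g) \<and> good_pair f g"
    proof -
      from Cons.prems consider n where "M = ?diag (r ^ n, r ^ n)" | n where "M = ?diag (r ^ Suc n, r ^ n)"
        | n where "M = ?diag (e ^ n, e ^ n)"
        by (auto simp del: diag_block_mat.simps power_Suc)
      then show ?thesis
      proof cases
        case (1 n)
        then show ?thesis unfolding good_pair_def by blast
      next
        case (2 n)
        then show ?thesis unfolding good_pair_def by blast
      next
        case (3 n)
        then show ?thesis unfolding good_pair_def by blast
      qed
    qed
    then obtain f g where fg: "M = ?diag (f, g)" "good_pair f g" by blast
    have "M # Ms = map ?diag ((f, g) # ps)" using fg(1) ps(1) by (simp del: diag_block_mat.simps)
    moreover have "\<forall>(f, g)\<in>set ((f, g) # ps). good_pair f g" using fg(2) ps(2) by simp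
    ultimately show ?case by (intro exI [of _ "(f, g) # ps"] conjI)
  qed simp
  then obtain ps where ps: "Ms = map ?diag ps" "\<forall>(f, g)\<in>set ps. good_pair f g" by blast
  define K where "K = length ps"
  define F where "F i = (if even i then fst (ps ! (i div 2)) else snd (ps ! (i div 2)))" for i
  have good: "good_pair (F (2 * k)) (F (2 * k + 1))" if "k < K" for k
    using ps(2) nth_mem [of k ps] that by (auto simp: F_def K_def)
  define fs where "fs = map F [0..<2 * K]"
  have "map (\<lambda>(f, g). [f, g]) ps = map (\<lambda>k. [F (2 * k), F (2 * k + 1)]) [0..<K]"
    by (rule nth_equalityI) (auto simp: K_def F_def split: prod.split)
  then have fs: "fs = concat (map (\<lambda>(f, g). [f, g]) ps)"
    unfolding fs_def concat_pairs [symmetric] by simp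
  have "Ms = map (\<lambda>gs. diag_block_mat (map companion gs)) (map (\<lambda>(f, g). [f, g]) ps)"
    unfolding ps(1) by (simp add: case_prod_beta del: diag_block_mat.simps)
  then have "represented_by scale u B (diag_block_mat (map companion fs))"
    using B unfolding fs by (simp only: diag_block_mat_concat)
  moreover have pow: "\<exists>f\<in>{e, r}. \<exists>n. F i = f ^ n" if "i < 2 * K" for i
  proof -
    have "\<exists>k<K. i = 2 * k \<or> i = 2 * k + 1"
      using that by (intro exI [of _ "i div 2"]) auto
    then obtain k where k: "k < K" "i = 2 * k \<or> i = 2 * k + 1" by blast
    then show ?thesis using good [OF k(1)] unfolding good_pair_def by blast
  qed
  moreover have mon: "monic g" if "g \<in> set fs" for g
    using that pow by (force simp: fs_def lead_coeff_power)
  ultimately obtain v where "decomp UNIV {..<length fs} (\<lambda>i. fs ! i) v"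
    using represented_by_companions_iff [of fs] by blast
  then have D: "decomp UNIV {..<2 * K} F v" by (simp add: decomp_def fs_def)
  \<comment> \<open>The degrees of all factors add up to the dimension, so it bounds every exponent
    and one power serves all generators.\<close>
  define L where "L = dim UNIV"
  have gens: "act (e ^ L * r ^ L) (v i) = 0" if i: "i < 2 * K" for i
  proof -
    obtain f n where f: "f \<in> {e, r}" "F i = f ^ n" using pow [OF i] by blast
    have f0: "f \<noteq> 0" "degree f \<ge> 1" using f(1) by auto
    have "degree (F i) \<le> (\<Sum>i<2 * K. degree (F i))" using i by (intro member_le_sum) auto
    also have "\<dots> = L" using D by (simp add: decomp_def L_def)
    finally have "n * degree f \<le> L" using f0 by (simp add: f(2) degree_power_eq mult.commute)
    moreover have "n * 1 \<le> n * degree f" using f0(2) by (rule mult_le_mono2)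
    ultimately have "n \<le> L" by linarith
    then have "f ^ n dvd f ^ L" by (rule le_imp_power_dvd)
    moreover have "f ^ L dvd e ^ L * r ^ L" using f(1) by auto
    ultimately have "F i dvd e ^ L * r ^ L" using f(2) dvd_trans by metis
    moreover have "act (F i) (v i) = 0" using D i by (simp add: decomp_def)
    ultimately show ?thesis by (rule act_eq_0_dvd)
  qed
  have ann: "act (e ^ L * r ^ L) x = 0" for x
  proof (rule decomp_all_zero [OF D act_linear])
    show "act (e ^ L * r ^ L) (u x) = 0" if "act (e ^ L * r ^ L) x = 0" for x
      using that by (simp only: act_u u.zero)
  qed (use gens in simp)
  \<comment> \<open>The constant term of the annihilator is a power of \<open>- d\<close> times a
    power of \<open>d\<^sup>2\<close>, hence nonzero.\<close>
  have "x = 0" if "u x = 0" for x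
    using act_ker_u [OF that, of "e ^ L * r ^ L"] ann [of x] d by (simp add: poly_power)
  then obtain a where "quadratic_quotient scale u Basis \<tau> N d \<kappa> a"
    using good_pairs_imp_quotient [OF D _ good] by blast
  then show thesis using ann that by blast
qed

end

section \<open>Translation into quotients and eigenvalues, and the theorem\<close>

lemma monic_quadratic:
  assumes "monic p" "degree p = 2"
  shows "p = [:poly p 0, - tr p, 1:]"
  using assms
  by (intro poly_eqI) (auto simp: coeff_pCons tr_def poly_0_coeff_0 numeral_2_eq_2 coeff_eq_0 split: nat.split)

context quadratic_endo
begin

text \<open>The explicit coefficients of \<open>H d p\<close>.\<close>

abbreviation q :: "'a poly" where "q \<equiv> [:N / d\<^sup>2, - (\<tau> / d), 1:]"

lemma quotient_imp_pq_quotient: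
  assumes "quadratic_quotient scale u Basis \<tau> N d \<kappa> a"
  shows "pq_quotient scale p q u"
proof -
  interpret Q: quadratic_quotient scale u Basis \<tau> N d \<kappa> a by (rule assms)
  have pa: "a (a x) = scale \<tau> (a x) - scale N x" for x
    using Q.E0 [of x] by (simp add: Q.E_def algebra_simps)
  have "x = 0" if "a x = 0" for x using pa [of x] that Q.a.u.zero N by simp
  then have a: "inj a" "surj a" using Q.a.inj_surj by blast+
  have u: "inj u" "surj u" using inj_surj Q.inj by blast+
  define U where "U = inv_into UNIV u"
  have U_lin: "Vector_Spaces.linear scale scale U"
    unfolding U_def by (rule inj_linear_imp_inv_linear [OF lin u(1)])
  interpret U: Vector_Spaces.linear scale scale U by (rule U_lin)
  have uU [simp]: "u (U x) = x" and Uu [simp]: "U (u x) = x" for x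
    using u by (simp_all add: U_def surj_f_inv_f)
  define b where "b x = U (a x)" for x
  have b_lin: "Vector_Spaces.linear scale scale b"
    by (simp add: Vector_Spaces.linear_iff vector_space_axioms b_def U.add U.scale Q.a.u.add Q.a.u.scale)
  interpret b: endo scale b by (intro endo.intro endo_axioms.intro vector_space_axioms b_lin)
  have "bij U" by (rule o_bij [of u]) (simp_all add: fun_eq_iff)
  moreover have "bij a" using a by (simp add: bij_def)
  ultimately have bij_b: "bij b" using bij_comp [of a U] by (simp add: b_def [abs_def] o_def)
  have ub: "u (b x) = a x" for x by (simp add: b_def)
  have "b (b x) = scale (\<tau> / d) (b x) - scale (N / d\<^sup>2) x" for x
  proof -
    \<comment> \<open>At \<open>b x\<close> the relation contains \<open>a\<^sup>2\<close>, which
      \<open>p(a) = 0\<close> reduces; applying \<open>u\<^sup>-\<^sup>1\<close> then leaves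
      \<open>d\<^sup>2 q(b) = 0\<close>.\<close>
    have "u (a (a x)) = scale (d\<^sup>2) (a (b x)) - scale \<tau> (u (scale d (b x) - a x))"
      using Q.rel [of "b x"] by (simp only: ub)
    then have "scale (d\<^sup>2) (a (b x)) = scale (\<tau> * d) (u (b x)) - scale N (u x)"
      by (simp add: pa u.diff u.scale scale_right_diff_distrib ub algebra_simps)
    then have "U (scale (d\<^sup>2) (a (b x))) = U (scale (\<tau> * d) (u (b x)) - scale N (u x))"
      by (rule arg_cong)
    then have "scale (d\<^sup>2) (b (b x)) = scale (\<tau> * d) (b x) - scale N x"
      by (simp add: U.diff U.scale b_def)
    then have "scale (inverse (d\<^sup>2)) (scale (d\<^sup>2) (b (b x))) =
        scale (inverse (d\<^sup>2)) (scale (\<tau> * d) (b x) - scale N x)"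
      by (rule arg_cong)
    then show ?thesis
      using d by (simp add: scale_right_diff_distrib power2_eq_square field_simps)
  qed
  then have "poly_endo scale q b = (\<lambda>_. 0)"
    by (simp add: fun_eq_iff b.u.add b.u.scale b.u.diff algebra_simps)
  moreover have "poly_endo scale p a = (\<lambda>_. 0)"
    by (simp add: fun_eq_iff Q.lin_simps pa)
  moreover have "u = a \<circ> inv_into UNIV b"
  proof
    fix x
    obtain y where "x = b y" using bij_b by (metis bij_pointE)
    then show "u x = (a \<circ> inv_into UNIV b) x" using bij_b ub by (simp add: bij_is_inj)
  qed
  ultimately show ?thesis
    unfolding pq_quotient_def automorphism_def using Q.a_lin b_lin bij_b \<open>bij a\<close> by blast
qed

lemma pq_quotient_imp_quotient:
  assumes "pq_quotient scale p q u"
  obtains a where "quadratic_quotient scale u Basis \<tau> N d \<kappa> a"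
proof -
  obtain a b where lin_ab: "Vector_Spaces.linear scale scale a" "Vector_Spaces.linear scale scale b"
    and bij: "bij a" "bij b" and p: "poly_endo scale p a = (\<lambda>_. 0)" and q: "poly_endo scale q b = (\<lambda>_. 0)"
    and u: "u = a \<circ> inv_into UNIV b"
    using assms unfolding pq_quotient_def automorphism_def by blast
  interpret a: endo scale a by (intro endo.intro endo_axioms.intro vector_space_axioms lin_ab)
  interpret b: endo scale b by (intro endo.intro endo_axioms.intro vector_space_axioms lin_ab)
  have ub: "u (b x) = a x" for x using bij(2) by (simp add: u bij_is_inj)
  have pa: "a (a x) = scale \<tau> (a x) - scale N x" for x
  proof -
    have "a.act p x = 0" using p by (simp add: fun_eq_iff)
    then show ?thesis by (simp add: a.u.add a.u.scale a.u.diff algebra_simps)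
  qed
  have qb: "scale (d\<^sup>2) (b (b x)) = scale (\<tau> * d) (b x) - scale N x" for x
  proof -
    have "b.act q x = 0" using q by (simp add: fun_eq_iff)
    then have "b (b x) = scale (\<tau> / d) (b x) - scale (N / d\<^sup>2) x"
      by (simp add: b.u.add b.u.scale b.u.diff algebra_simps)
    then show ?thesis using d by (simp add: scale_right_diff_distrib power2_eq_square)
  qed
  have "twisted scale u Basis \<tau> N d \<kappa> a"
  proof (intro twisted.intro fd_endo_axioms quadratic_data_axioms twisted_axioms.intro lin_ab(1))
    fix x assume "u x = 0"
    moreover obtain y where y: "x = b y" using bij(2) by (metis bij_pointE)
    ultimately have "a y = a 0" by (simp add: ub a.u.zero)
    then have "y = 0" using bij_is_inj [OF bij(1)] by (rule injD [rotated])
    then show "x = 0" using y by (simp add: b.u.zero)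
  next
    fix x
    \<comment> \<open>Through preimages under \<open>b\<close>, the operator \<open>u\<close>
      becomes \<open>a\<close>: \<open>u x = a z\<close> and \<open>u z = a w\<close>. The relation
      then reduces to the equations of \<open>a\<close> and \<open>b\<close>.\<close>
    obtain z where z: "x = b z" using bij(2) by (metis bij_pointE)
    obtain w where w: "z = b w" using bij(2) by (metis bij_pointE)
    have "scale (d\<^sup>2) (a x) = a (scale (d\<^sup>2) (b (b w)))" by (simp add: z w a.u.scale)
    also have "\<dots> = scale (\<tau> * d) (a z) - scale N (u z)"
      by (simp only: qb a.u.diff a.u.scale) (simp add: w ub)
    finally have 1: "scale (d\<^sup>2) (a x) = scale (\<tau> * d) (a z) - scale N (u z)" .
    have "u (a (u x)) = scale \<tau> (u (a z)) - scale N (u z)"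
      by (simp add: z ub pa u.diff u.scale)
    also have "\<dots> = scale (d\<^sup>2) (a x) - scale \<tau> (u (scale d x - u x))"
      unfolding 1 by (simp add: z ub u.diff u.scale scale_right_diff_distrib)
    finally show "u (a (u x)) = scale (d\<^sup>2) (a x) - scale \<tau> (u (scale d x - u x))" .
  qed
  then interpret T: twisted scale u Basis \<tau> N d \<kappa> a .
  have "quadratic_quotient scale u Basis \<tau> N d \<kappa> a"
    by unfold_locales (simp add: T.E_def pa)
  then show thesis by (rule that)
qed

text \<open>If \<open>p\<close> has the roots \<open>\<alpha>\<close> and \<open>\<beta>\<close>,
  then \<open>q\<close> has the roots \<open>\<alpha> / d\<close> and \<open>\<beta> / d\<close>.
  The quotients are \<open>d\<close>, \<open>d \<alpha> / \<beta>\<close> and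
  \<open>d \<beta> / \<alpha>\<close>; the last two have product \<open>d\<^sup>2\<close> and sum
  \<open>\<kappa>\<close>, so they are the roots of \<open>r\<close>.\<close>

lemma Root_quotients:
  "{x * inverse y | x y. x \<in> Root p \<and> y \<in> Root q} = {x. poly (map_poly to_ac (e * r)) x = 0}"
proof -
  have ev: "poly (map_poly to_ac [:c0, c1, 1:]) x = to_ac c0 + x * (to_ac c1 + x)" for c0 c1 :: 'a and x
    by (simp add: map_poly_pCons)
  have "degree (map_poly to_ac p) > 0" by (simp add: map_poly_pCons)
  then obtain \<alpha> where "poly (map_poly to_ac p) \<alpha> = 0" using alg_closed_imp_poly_has_root by blast
  then have \<alpha>: "to_ac N + \<alpha> * (- to_ac \<tau> + \<alpha>) = 0" by (simp add: ev)
  \<comment> \<open>With this choice of the second root, Vieta's formulas hold by construction,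
    whether or not the roots differ.\<close>
  define \<beta> where "\<beta> = to_ac \<tau> - \<alpha>"
  have sum: "to_ac \<tau> = \<alpha> + \<beta>" by (simp add: \<beta>_def)
  have prod: "to_ac N = \<alpha> * \<beta>" using \<alpha> by (simp add: \<beta>_def algebra_simps add_eq_0_iff)
  have nz: "\<alpha> \<noteq> 0" "\<beta> \<noteq> 0" using prod N by auto
  define D where "D = to_ac d"
  have D: "D \<noteq> 0" using d by (simp add: D_def)
  have "to_ac (N * \<kappa>) = to_ac (d * (\<tau>\<^sup>2 - 2 * N))" by (simp only: \<kappa>)
  then have "\<alpha> * \<beta> * to_ac \<kappa> = D * ((\<alpha> + \<beta>)\<^sup>2 - 2 * (\<alpha> * \<beta>))"
    by (simp add: sum prod D_def)
  then have k: "to_ac \<kappa> = D * \<alpha> / \<beta> + D * \<beta> / \<alpha>"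
    using nz by (simp add: field_simps power2_eq_square)
  have Rp: "Root p = {\<alpha>, \<beta>}"
  proof -
    have "poly (map_poly to_ac p) x = (x - \<alpha>) * (x - \<beta>)" for x
      by (simp add: ev sum prod algebra_simps)
    then show ?thesis by (auto simp: Root_def)
  qed
  have Rq: "Root q = {\<alpha> / D, \<beta> / D}"
  proof -
    have coeffs: "to_ac (N / d\<^sup>2) = (\<alpha> / D) * (\<beta> / D)" "to_ac (- (\<tau> / d)) = - (\<alpha> / D + \<beta> / D)"
      by (simp_all add: sum prod D_def power2_eq_square add_divide_distrib)
    have "poly (map_poly to_ac q) x = (x - \<alpha> / D) * (x - \<beta> / D)" for x
      by (simp only: ev coeffs) (simp add: algebra_simps)
    then show ?thesis by (auto simp: Root_def)
  qed
  have "poly (map_poly to_ac e) x = x - D" for x by (simp add: map_poly_pCons D_def)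
  moreover have "poly (map_poly to_ac r) x = (x - D * \<alpha> / \<beta>) * (x - D * \<beta> / \<alpha>)" for x
  proof -
    have c0: "to_ac (d\<^sup>2) = (D * \<alpha> / \<beta>) * (D * \<beta> / \<alpha>)"
      using nz by (simp add: D_def power2_eq_square)
    have c1: "to_ac (- \<kappa>) = - (D * \<alpha> / \<beta> + D * \<beta> / \<alpha>)" by (simp add: k)
    show ?thesis by (simp only: ev c0 c1) (simp add: c0 [symmetric] algebra_simps nz)
  qed
  ultimately have "{x. poly (map_poly to_ac (e * r)) x = 0} = {D, D * \<alpha> / \<beta>, D * \<beta> / \<alpha>}"
    by (auto simp only: poly_map_poly_to_ac mult_eq_0_iff eq_iff_diff_eq_0 [symmetric])
  moreover have "{x * inverse y | x y. x \<in> Root p \<and> y \<in> Root q} =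
      {\<alpha> * inverse (\<alpha> / D), \<alpha> * inverse (\<beta> / D), \<beta> * inverse (\<alpha> / D), \<beta> * inverse (\<beta> / D)}"
    unfolding Rp Rq by blast
  moreover have "\<alpha> * inverse (\<alpha> / D) = D" "\<beta> * inverse (\<beta> / D) = D"
    "\<alpha> * inverse (\<beta> / D) = D * \<alpha> / \<beta>" "\<beta> * inverse (\<alpha> / D) = D * \<beta> / \<alpha>"
    using nz D by simp_all
  ultimately show ?thesis by (simp only:) blast
qed

theorem equivalences:
  defines "condition_i \<equiv> pq_quotient scale p q u \<and> q_exceptional scale p q u"
  shows "(condition_i \<longleftrightarrow> condition_ii) \<and> (condition_ii \<longleftrightarrow> condition_iii)"
proof -
  have exc: "q_exceptional scale p q u \<longleftrightarrow>
      (\<forall>x\<in>closure_eigenvalues scale u. poly (map_poly to_ac (e * r)) x = 0)"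
    unfolding q_exceptional_def Root_quotients by blast
  have "condition_ii" if c: condition_i
  proof -
    obtain a where "quadratic_quotient scale u Basis \<tau> N d \<kappa> a"
      using pq_quotient_imp_quotient c unfolding condition_i_def by blast
    then interpret Q: quadratic_quotient scale u Basis \<tau> N d \<kappa> a .
    obtain k l where "\<And>v. act (e ^ k * r ^ l) v = 0"
      using exceptional_annihilator c exc unfolding condition_i_def by blast
    then show ?thesis by (rule Q.quotient_imp_condition_ii)
  qed
  moreover have "condition_i" if c: condition_iii
  proof -
    obtain a L where a: "quadratic_quotient scale u Basis \<tau> N d \<kappa> a" and L: "\<And>x. act (e ^ L * r ^ L) x = 0"
      using condition_iii_imp [OF c] by blast
    have "poly (map_poly to_ac (e * r)) x = 0" if x: "x \<in> closure_eigenvalues scale u" for x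
    proof -
      have pow: "poly (map_poly to_ac (g ^ n)) x = poly (map_poly to_ac g) x ^ n" for g n
        by (induction n) (simp_all add: poly_map_poly_to_ac)
      have "poly (map_poly to_ac (e ^ L * r ^ L)) x = 0"
        by (rule closure_eigenvalue_root [OF x L])
      then have "poly (map_poly to_ac e) x = 0 \<or> poly (map_poly to_ac r) x = 0"
        by (simp only: poly_map_poly_to_ac pow mult_eq_0_iff power_eq_0_iff) blast
      then show ?thesis by (simp only: poly_map_poly_to_ac mult_eq_0_iff)
    qed
    then show ?thesis
      unfolding condition_i_def exc using quotient_imp_pq_quotient [OF a] by blast
  qed
  ultimately show ?thesis using condition_ii_imp_iii by blast
qed

end

theorem theorem4p29:
  fixes p q r :: "'a::field poly" and d :: 'a
    and scale :: "'a \<Rightarrow> 'v::ab_group_add \<Rightarrow> 'v" and Basis :: "'v set"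
    and u :: "'v \<Rightarrow> 'v"
  assumes "Factorial_Ring.irreducible p" "monic p" "Polynomial.degree p = 2"
    and "Factorial_Ring.irreducible q" "monic q" "Polynomial.degree q = 2"
    and "d \<noteq> 0" "q = H d p"
    and "tr p \<noteq> 0"
    and "r = monom 1 2 - monom ((tr p * tr q - 2 * d * poly q 0) / poly q 0) 1
               + [:poly p 0 / poly q 0:]"
    and "finite_dimensional_vector_space scale Basis"
    and "Vector_Spaces.linear scale scale u"
  defines "i \<equiv> pq_quotient scale p q u \<and> q_exceptional scale p q u"
    and "ii \<equiv> (\<exists>k l. is_minimal_polynomial scale u ([:- d, 1:] ^ k * r ^ l)) \<and>
              (\<exists>s. are_invariant_factors scale u s \<and>
                 (\<forall>k\<ge>1. s (2 * k - 1) = s (2 * k) \<or> s (2 * k - 1) = r * s (2 * k)))"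
    and "iii \<equiv> (\<exists>B Ms. represented_by scale u B (diag_block_mat Ms) \<and>
              (\<forall>M\<in>set Ms.
                 (\<exists>n. \<exists>e\<in>{0, 1}.
                    M = diag_block_mat [companion (r ^ (n + e)), companion (r ^ n)]) \<or>
                 (\<exists>n\<ge>1.
                    M = diag_block_mat [companion ([:- d, 1:] ^ n), companion ([:- d, 1:] ^ n)])))"
  shows "(i \<longleftrightarrow> ii) \<and> (ii \<longleftrightarrow> iii)"
proof -
  define N where "N = poly p 0"
  define \<tau> where "\<tau> = tr p"
  define \<kappa> where "\<kappa> = d * (\<tau>\<^sup>2 - 2 * N) / N"
  have p: "p = [:N, - \<tau>, 1:]"
    unfolding N_def \<tau>_def using assms(2,3) by (rule monic_quadratic)
  have noroot: "x\<^sup>2 - \<tau> * x + N \<noteq> 0" for x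
  proof
    assume "x\<^sup>2 - \<tau> * x + N = 0"
    then have "poly p x = 0" by (simp add: p power2_eq_square algebra_simps)
    then obtain g where g: "p = [:- x, 1:] * g" by (metis dvdE poly_eq_0_iff_dvd)
    then have "is_unit [:- x, 1:] \<or> is_unit g" using assms(1) irreducibleD by blast
    moreover have "g \<noteq> 0" using g p by auto
    moreover from this have "degree p = 1 + degree g" unfolding g by (subst degree_mult_eq) simp_all
    ultimately show False using assms(3) is_unit_iff_degree [of g] is_unit_iff_degree [of "[:- x, 1:]"] by simp
  qed
  have N0: "N \<noteq> 0" using noroot [of 0] by simp
  have q: "q = [:N / d\<^sup>2, - (\<tau> / d), 1:]"
    using assms(7) by (simp add: assms(8) H_def p pcompose_pCons power2_eq_square field_simps)
  have "tr q = \<tau> / d" by (simp add: q tr_def)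
  then have r: "r = [:d\<^sup>2, - \<kappa>, 1:]"
    using assms(7) N0 unfolding assms(10) \<kappa>_def
    by (simp add: q \<tau>_def [symmetric] N_def [symmetric] monom_altdef power2_eq_square field_simps)
  interpret finite_dimensional_vector_space scale Basis by (rule assms(11))
  interpret quadratic_endo scale u Basis \<tau> N d \<kappa>
    by (intro quadratic_endo.intro fd_endo.intro endo.intro endo_axioms.intro quadratic_data.intro
        assms vector_space_axioms finite_dimensional_vector_space_axioms)
      (use noroot N0 assms(9) in \<open>auto simp: \<kappa>_def \<tau>_def\<close>)
  show ?thesis
    using equivalences
    unfolding condition_ii_def condition_iii_def i_def ii_def iii_def p [symmetric] q [symmetric] r [symmetric] .
qed

end
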